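(* Let $\mathbb{S}:=\widehat{M^\infty_H}$, equipped with its universal Frobenius lift $\phi$. There exists a Frobenius lift $\Phi$ on $\widehat{E_{\mathbb{S}}}$ extending the universal Frobenius lift on $\mathbb{S}$ such that $\Phi$ is Lie invariant mod $p$ with eigenvalue $H^{-1}$, i.e. $\frac{1}{p}\Phi^*\omega\equiv H^{-1}\omega\pmod p$ in $\Omega_{\widehat{E_{\mathbb{S}}}/\mathbb{S}}$.
   Context: $p$ is a prime, $p\neq 2,3$; $z_4,z_6,z_4',z_6',z_4'',z_6'',\dots$ are variables. $\Delta=4z_4^3+27z_6^2$ and the Hasse polynomial $H\in\mathbb{Z}_{(p)}[z_4,z_6]$ is the coefficient of $x^{p-1}$ in $(x^3+z_4x+z_6)^{(p-1)/2}$. For a polynomial $\Sigma\in\mathbb{Z}_{(p)}[z_4,z_6]$ let $M_\Sigma=\mathbb{Z}_{(p)}[z_4,z_6,\Delta^{-1}\Sigma^{-1}]$, $M^r_\Sigma=M_\Sigma[z_4',z_6',\dots,z_4^{(r)},z_6^{(r)}]$, $M^\infty_\Sigma=\bigcup_r M^r_\Sigma$. The universal Frobenius lift is the unique ring endomorphism $\phi$ of the $p$-adic completion $\widehat{M^\infty_\Sigma}$ with $\phi(z_4^{(i)})=(z_4^{(i)})^p+pz_4^{(i+1)}$ and $\phi(z_6^{(i)})=(z_6^{(i)})^p+pz_6^{(i+1)}$ for all $i\ge 0$. For $\mathbb{S}=\widehat{M^\infty_\Sigma}$ let $E_{\mathbb{S}}=\mathrm{Spec}\,\mathbb{S}[x,y]/(y^2-(x^3+z_4x+z_6))$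 and $\widehat{E_{\mathbb{S}}}$ its $p$-adic completion. A Frobenius lift on $\widehat{E_{\mathbb{S}}}$ extending the universal one is a ring endomorphism of $\widehat{\mathcal{O}(E_{\mathbb{S}})}$ restricting to $\phi$ on $\mathbb{S}$ and reducing mod $p$ to the $p$-power Frobenius. With $\Omega_{\widehat{E_{\mathbb{S}}}/\mathbb{S}}:=\varprojlim_n\Omega_{(E_{\mathbb{S}}\otimes\mathbb{S}/p^n)/(\mathbb{S}/p^n)}$ and $\omega=dx/y$, $\Phi$ is Lie invariant mod $p^m$ with eigenvalue $\lambda\in\mathbb{S}$ if $\frac{1}{p}\Phi^*\omega\equiv\lambda\omega\pmod{p^m}$. *)

theory Defs
  imports
    "HOL-Library.Poly_Mapping"
    "HOL-Library.FuncSet"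
    "HOL-Computational_Algebra.Polynomial_Factorial"
    "HOL-Algebra.QuotRing"
    "HOL-Algebra.UnivPoly"
begin

section \<open>p-adic completion\<close>

definition ppow_ideal :: "nat \<Rightarrow> ('a, 'm) ring_scheme \<Rightarrow> nat \<Rightarrow> 'a set" where
  "ppow_ideal p R n = PIdl\<^bsub>R\<^esub> ([(p ^ n)] \<cdot>\<^bsub>R\<^esub> \<one>\<^bsub>R\<^esub>)"

abbreviation mod_ppow :: "nat \<Rightarrow> ('a, 'm) ring_scheme \<Rightarrow> nat \<Rightarrow> 'a set ring" where
  "mod_ppow p R n \<equiv> R Quot ppow_ideal p R n"

text \<open>If \<open>C\<close> is a coset of a subgroup of an ideal \<open>I\<close>, then \<open>I <+> C\<close> is the coset of \<open>I\<close>
  containing it, so the following is the projection \<open>R / p\<^sup>m R \<rightarrow> R / p\<^sup>n R\<close> for \<open>n \<le> m\<close>.\<close>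

definition ppow_proj :: "nat \<Rightarrow> ('a, 'm) ring_scheme \<Rightarrow> nat \<Rightarrow> 'a set \<Rightarrow> 'a set" where
  "ppow_proj p R n C = ppow_ideal p R n <+>\<^bsub>R\<^esub> C"

text \<open>The inverse limit of the rings \<open>R / p\<^sup>n R\<close>, as a ring of compatible sequences of cosets.\<close>

definition padic_completion :: "nat \<Rightarrow> ('a, 'm) ring_scheme \<Rightarrow> (nat \<Rightarrow> 'a set) ring" where
  "padic_completion p R =
    \<lparr>carrier = {f. \<forall>n. f n \<in> carrier (mod_ppow p R n) \<and> ppow_proj p R n (f (Suc n)) = f n},
     mult = (\<lambda>f g n. f n \<otimes>\<^bsub>mod_ppow p R n\<^esub> g n),
     one = (\<lambda>n. \<one>\<^bsub>mod_ppow p R n\<^esub>),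
     zero = (\<lambda>n. \<zero>\<^bsub>mod_ppow p R n\<^esub>),
     add = (\<lambda>f g n. f n \<oplus>\<^bsub>mod_ppow p R n\<^esub> g n)\<rparr>"

definition to_completion :: "nat \<Rightarrow> ('a, 'm) ring_scheme \<Rightarrow> 'a \<Rightarrow> nat \<Rightarrow> 'a set" where
  "to_completion p R a = (\<lambda>n. ppow_ideal p R n +>\<^bsub>R\<^esub> a)"

text \<open>The map \<open>R / p\<^sup>n R \<rightarrow> A / p\<^sup>n A\<close> induced by a ring homomorphism \<open>g : R \<rightarrow> A\<close>.\<close>

definition mod_ppow_map :: "nat \<Rightarrow> ('a, 'm) ring_scheme \<Rightarrow> ('r \<Rightarrow> 'a) \<Rightarrow> nat \<Rightarrow> 'r set \<Rightarrow> 'a set" where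
  "mod_ppow_map p A g n C = ppow_ideal p A n <+>\<^bsub>A\<^esub> (g ` C)"

text \<open>The endomorphism of \<open>A / p\<^sup>n A\<close> induced by a ring endomorphism of the completion of \<open>A\<close>:
  for \<open>a \<in> C\<close>, all the cosets in the union coincide.\<close>

definition completion_endo_mod ::
    "nat \<Rightarrow> ('a, 'm) ring_scheme \<Rightarrow> ((nat \<Rightarrow> 'a set) \<Rightarrow> (nat \<Rightarrow> 'a set)) \<Rightarrow> nat \<Rightarrow> 'a set \<Rightarrow> 'a set" where
  "completion_endo_mod p A \<Phi> n C = (\<Union>a\<in>C. \<Phi> (to_completion p A a) n)"


section \<open>Kaehler differentials\<close>

text \<open>The modules below are records extending rings; their \<open>mult\<close> and \<open>one\<close> fields are
  meaningless.\<close>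

text \<open>The free \<open>B\<close>-module on the set \<open>carrier B\<close>.\<close>

definition free_mod :: "('b, 'n) ring_scheme \<Rightarrow> ('b, 'b \<Rightarrow> 'b) module" where
  "free_mod B =
    \<lparr>carrier = {u. range u \<subseteq> carrier B \<and> finite {b. u b \<noteq> \<zero>\<^bsub>B\<^esub>} \<and> {b. u b \<noteq> \<zero>\<^bsub>B\<^esub>} \<subseteq> carrier B},
     mult = undefined,
     one = undefined,
     zero = (\<lambda>_. \<zero>\<^bsub>B\<^esub>),
     add = (\<lambda>u v b. u b \<oplus>\<^bsub>B\<^esub> v b),
     smult = (\<lambda>a u b. a \<otimes>\<^bsub>B\<^esub> u b)\<rparr>"

definition free_gen :: "('b, 'n) ring_scheme \<Rightarrow> 'b \<Rightarrow> 'b \<Rightarrow> 'b" where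
  "free_gen B b = (\<lambda>c. if c = b then \<one>\<^bsub>B\<^esub> else \<zero>\<^bsub>B\<^esub>)"

definition quot_module ::
    "('a, 'b, 'n) module_scheme \<Rightarrow> 'b set \<Rightarrow> ('a, 'b set) module" where
  "quot_module F N =
    \<lparr>carrier = a_rcosets\<^bsub>F\<^esub> N,
     mult = undefined,
     one = undefined,
     zero = N,
     add = set_add F,
     smult = (\<lambda>a C. N <+>\<^bsub>F\<^esub> ((\<lambda>u. a \<odot>\<^bsub>F\<^esub> u) ` C))\<rparr>"

definition kahler_rels :: "('r, 'm) ring_scheme \<Rightarrow> ('b, 'n) ring_scheme \<Rightarrow> ('r \<Rightarrow> 'b) \<Rightarrow> ('b \<Rightarrow> 'b) set" where
  "kahler_rels R B g =
    {free_gen B (b \<oplus>\<^bsub>B\<^esub> c) \<ominus>\<^bsub>free_mod B\<^esub> (free_gen B b \<oplus>\<^bsub>free_mod B\<^esub> free_gen B c) | b c.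
       b \<in> carrier B \<and> c \<in> carrier B}
    \<union> {free_gen B (b \<otimes>\<^bsub>B\<^esub> c) \<ominus>\<^bsub>free_mod B\<^esub>
         (b \<odot>\<^bsub>free_mod B\<^esub> free_gen B c \<oplus>\<^bsub>free_mod B\<^esub> c \<odot>\<^bsub>free_mod B\<^esub> free_gen B b) | b c.
       b \<in> carrier B \<and> c \<in> carrier B}
    \<union> {free_gen B (g r) | r. r \<in> carrier R}"

definition kahler_submod :: "('r, 'm) ring_scheme \<Rightarrow> ('b, 'n) ring_scheme \<Rightarrow> ('r \<Rightarrow> 'b) \<Rightarrow> ('b \<Rightarrow> 'b) set" where
  "kahler_submod R B g = \<Inter>{N. submodule N B (free_mod B) \<and> kahler_rels R B g \<subseteq> N}"

text \<open>The \<open>B\<close>-module of differentials of \<open>B\<close> relative to \<open>R\<close>, where \<open>B\<close> is an \<open>R\<close>-algebra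
  via \<open>g\<close>.\<close>

definition kahler :: "('r, 'm) ring_scheme \<Rightarrow> ('b, 'n) ring_scheme \<Rightarrow> ('r \<Rightarrow> 'b) \<Rightarrow> ('b, ('b \<Rightarrow> 'b) set) module" where
  "kahler R B g = quot_module (free_mod B) (kahler_submod R B g)"

definition kahler_d :: "('r, 'm) ring_scheme \<Rightarrow> ('b, 'n) ring_scheme \<Rightarrow> ('r \<Rightarrow> 'b) \<Rightarrow> 'b \<Rightarrow> ('b \<Rightarrow> 'b) set" where
  "kahler_d R B g b = kahler_submod R B g +>\<^bsub>free_mod B\<^esub> free_gen B b"

text \<open>The map \<open>\<Sum> u\<^sub>b [b] \<mapsto> \<Sum> h(u\<^sub>b) [h b]\<close> of free modules induced by \<open>h : B \<rightarrow> B'\<close>, and the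
  induced map \<open>a db \<mapsto> h(a) d(h b)\<close> on differentials. The latter is meaningful when \<open>h\<close> maps the
  image of the base ring of \<open>B\<close> into that of the base ring \<open>R'\<close> of \<open>B'\<close>.\<close>

definition free_mod_map ::
    "('b, 'n) ring_scheme \<Rightarrow> ('c, 'k) ring_scheme \<Rightarrow> ('b \<Rightarrow> 'c) \<Rightarrow> ('b \<Rightarrow> 'b) \<Rightarrow> 'c \<Rightarrow> 'c" where
  "free_mod_map B B' h u = (\<lambda>c. \<Oplus>\<^bsub>B'\<^esub>b\<in>{b. u b \<noteq> \<zero>\<^bsub>B\<^esub> \<and> h b = c}. h (u b))"

definition kahler_map ::
    "('b, 'n) ring_scheme \<Rightarrow> ('s, 'l) ring_scheme \<Rightarrow> ('c, 'k) ring_scheme \<Rightarrow> ('s \<Rightarrow> 'c) \<Rightarrow>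
     ('b \<Rightarrow> 'c) \<Rightarrow> ('b \<Rightarrow> 'b) set \<Rightarrow> ('c \<Rightarrow> 'c) set" where
  "kahler_map B R' B' g' h C = kahler_submod R' B' g' <+>\<^bsub>free_mod B'\<^esub> (free_mod_map B B' h ` C)"


section \<open>Differentials of the p-adic completion of an algebra\<close>

text \<open>Throughout, \<open>A\<close> is an \<open>R\<close>-algebra via \<open>g\<close>, and \<open>(A \<otimes> R/p\<^sup>n)/(R/p\<^sup>n)\<close> is represented by
  \<open>R / p\<^sup>n R \<rightarrow> A / p\<^sup>n A\<close>.\<close>

definition kahler_mod ::
    "nat \<Rightarrow> ('r, 'm) ring_scheme \<Rightarrow> ('a, 'n) ring_scheme \<Rightarrow> ('r \<Rightarrow> 'a) \<Rightarrow> nat \<Rightarrow>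
     ('a set, ('a set \<Rightarrow> 'a set) set) module" where
  "kahler_mod p R A g n = kahler (mod_ppow p R n) (mod_ppow p A n) (mod_ppow_map p A g n)"

definition kahler_mod_proj ::
    "nat \<Rightarrow> ('r, 'm) ring_scheme \<Rightarrow> ('a, 'n) ring_scheme \<Rightarrow> ('r \<Rightarrow> 'a) \<Rightarrow> nat \<Rightarrow>
     ('a set \<Rightarrow> 'a set) set \<Rightarrow> ('a set \<Rightarrow> 'a set) set" where
  "kahler_mod_proj p R A g n =
    kahler_map (mod_ppow p A (Suc n)) (mod_ppow p R n) (mod_ppow p A n) (mod_ppow_map p A g n)
      (ppow_proj p A n)"

text \<open>The inverse limit of the \<open>kahler_mod p R A g n\<close>, a module over \<open>padic_completion p A\<close>.\<close>

definition complete_kahler ::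
    "nat \<Rightarrow> ('r, 'm) ring_scheme \<Rightarrow> ('a, 'n) ring_scheme \<Rightarrow> ('r \<Rightarrow> 'a) \<Rightarrow>
     (nat \<Rightarrow> 'a set, nat \<Rightarrow> ('a set \<Rightarrow> 'a set) set) module" where
  "complete_kahler p R A g =
    \<lparr>carrier = {w. \<forall>n. w n \<in> carrier (kahler_mod p R A g n) \<and>
                       kahler_mod_proj p R A g n (w (Suc n)) = w n},
     mult = undefined,
     one = undefined,
     zero = (\<lambda>n. \<zero>\<^bsub>kahler_mod p R A g n\<^esub>),
     add = (\<lambda>v w n. v n \<oplus>\<^bsub>kahler_mod p R A g n\<^esub> w n),
     smult = (\<lambda>a w n. a n \<odot>\<^bsub>kahler_mod p R A g n\<^esub> w n)\<rparr>"

definition complete_d ::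
    "nat \<Rightarrow> ('r, 'm) ring_scheme \<Rightarrow> ('a, 'n) ring_scheme \<Rightarrow> ('r \<Rightarrow> 'a) \<Rightarrow>
     (nat \<Rightarrow> 'a set) \<Rightarrow> nat \<Rightarrow> ('a set \<Rightarrow> 'a set) set" where
  "complete_d p R A g a =
    (\<lambda>n. kahler_d (mod_ppow p R n) (mod_ppow p A n) (mod_ppow_map p A g n) (a n))"

text \<open>Pullback of differentials along a ring endomorphism of \<open>padic_completion p A\<close> that maps the
  image of \<open>R\<close> into itself.\<close>

definition pullback ::
    "nat \<Rightarrow> ('r, 'm) ring_scheme \<Rightarrow> ('a, 'n) ring_scheme \<Rightarrow> ('r \<Rightarrow> 'a) \<Rightarrow>
     ((nat \<Rightarrow> 'a set) \<Rightarrow> (nat \<Rightarrow> 'a set)) \<Rightarrow>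
     (nat \<Rightarrow> ('a set \<Rightarrow> 'a set) set) \<Rightarrow> nat \<Rightarrow> ('a set \<Rightarrow> 'a set) set" where
  "pullback p R A g \<Phi> w =
    (\<lambda>n. kahler_map (mod_ppow p A n) (mod_ppow p R n) (mod_ppow p A n) (mod_ppow_map p A g n)
           (completion_endo_mod p A \<Phi> n) (w n))"


section \<open>The affine Weierstrass curve\<close>

text \<open>\<open>R[x,y]\<close> is \<open>UP (UP R)\<close>, with \<open>x\<close> the inner and \<open>y\<close> the outer variable.\<close>

definition const_xy :: "('r, 'm) ring_scheme \<Rightarrow> 'r \<Rightarrow> nat \<Rightarrow> nat \<Rightarrow> 'r" where
  "const_xy R r = up_ring.monom (UP (UP R)) (up_ring.monom (UP R) r 0) 0"

definition var_x :: "('r, 'm) ring_scheme \<Rightarrow> nat \<Rightarrow> nat \<Rightarrow> 'r" where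
  "var_x R = up_ring.monom (UP (UP R)) (up_ring.monom (UP R) \<one>\<^bsub>R\<^esub> 1) 0"

definition var_y :: "('r, 'm) ring_scheme \<Rightarrow> nat \<Rightarrow> nat \<Rightarrow> 'r" where
  "var_y R = up_ring.monom (UP (UP R)) \<one>\<^bsub>UP R\<^esub> 1"

definition weierstrass_ideal :: "('r, 'm) ring_scheme \<Rightarrow> 'r \<Rightarrow> 'r \<Rightarrow> (nat \<Rightarrow> nat \<Rightarrow> 'r) set" where
  "weierstrass_ideal R a b =
    PIdl\<^bsub>UP (UP R)\<^esub>
      (var_y R [^]\<^bsub>UP (UP R)\<^esub> (2::nat) \<ominus>\<^bsub>UP (UP R)\<^esub>
        (var_x R [^]\<^bsub>UP (UP R)\<^esub> (3::nat) \<oplus>\<^bsub>UP (UP R)\<^esub>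
         const_xy R a \<otimes>\<^bsub>UP (UP R)\<^esub> var_x R \<oplus>\<^bsub>UP (UP R)\<^esub> const_xy R b))"

definition weierstrass_ring :: "('r, 'm) ring_scheme \<Rightarrow> 'r \<Rightarrow> 'r \<Rightarrow> (nat \<Rightarrow> nat \<Rightarrow> 'r) set ring" where
  "weierstrass_ring R a b = UP (UP R) Quot weierstrass_ideal R a b"

definition weierstrass_class ::
    "('r, 'm) ring_scheme \<Rightarrow> 'r \<Rightarrow> 'r \<Rightarrow> (nat \<Rightarrow> nat \<Rightarrow> 'r) \<Rightarrow> (nat \<Rightarrow> nat \<Rightarrow> 'r) set" where
  "weierstrass_class R a b f = weierstrass_ideal R a b +>\<^bsub>UP (UP R)\<^esub> f"


section \<open>The base rings\<close>

text \<open>Polynomials over the rationals in variables indexed by \<open>nat\<close>; \<open>z\<^sub>4\<^sup>(\<^sup>i\<^sup>)\<close> is the variable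
  with index \<open>2i\<close> and \<open>z\<^sub>6\<^sup>(\<^sup>i\<^sup>)\<close> the one with index \<open>2i+1\<close>. All base rings are subrings of the
  field of fractions.\<close>

type_synonym zpoly = "(nat \<Rightarrow>\<^sub>0 nat) \<Rightarrow>\<^sub>0 rat"

definition z4 :: "nat \<Rightarrow> zpoly" where
  "z4 i = Poly_Mapping.single (Poly_Mapping.single (2 * i) 1) 1"

definition z6 :: "nat \<Rightarrow> zpoly" where
  "z6 i = Poly_Mapping.single (Poly_Mapping.single (2 * i + 1) 1) 1"

definition Delta :: zpoly where
  "Delta = 4 * z4 0 ^ 3 + 27 * z6 0 ^ 2"

definition Hasse :: "nat \<Rightarrow> zpoly" where
  "Hasse p = Polynomial.coeff ([:z6 0, z4 0, 0, 1:] ^ ((p - 1) div 2)) (p - 1)"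

definition Z_loc :: "nat \<Rightarrow> rat set" where
  "Z_loc p = {of_int a / of_int b | a b. \<not> int p dvd b}"

text \<open>\<open>Z\<^sub>(\<^sub>p\<^sub>)[z\<^sub>4, z\<^sub>6, \<dots>, z\<^sub>4\<^sup>(\<^sup>r\<^sup>), z\<^sub>6\<^sup>(\<^sup>r\<^sup>)]\<close>\<close>

definition Z_loc_polys :: "nat \<Rightarrow> nat \<Rightarrow> zpoly set" where
  "Z_loc_polys p r =
    {P. (\<forall>m. Poly_Mapping.lookup P m \<in> Z_loc p) \<and>
        (\<forall>m\<in>Poly_Mapping.keys P. Poly_Mapping.keys m \<subseteq> {..2 * r + 1})}"

text \<open>The carriers of \<open>M\<^sup>r\<close> (so that \<open>r = 0\<close> gives \<open>Z\<^sub>(\<^sub>p\<^sub>)[z\<^sub>4, z\<^sub>6, 1/(\<Delta> \<Sigma>)]\<close>) and the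
  ring \<open>M\<^sup>\<infinity>\<close>, for nonzero \<open>\<Sigma>\<close> in \<open>Z\<^sub>(\<^sub>p\<^sub>)[z\<^sub>4, z\<^sub>6]\<close>.\<close>

definition M_carrier :: "nat \<Rightarrow> zpoly \<Rightarrow> nat \<Rightarrow> zpoly fract set" where
  "M_carrier p \<Sigma> r = {to_fract P / to_fract (Delta * \<Sigma>) ^ k | P k. P \<in> Z_loc_polys p r}"

definition M_inf :: "nat \<Rightarrow> zpoly \<Rightarrow> zpoly fract ring" where
  "M_inf p \<Sigma> =
    \<lparr>carrier = (\<Union>r. M_carrier p \<Sigma> r), mult = (*), one = 1, zero = 0, add = (+)\<rparr>"

definition S_ring :: "nat \<Rightarrow> zpoly \<Rightarrow> (nat \<Rightarrow> zpoly fract set) ring" where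
  "S_ring p \<Sigma> = padic_completion p (M_inf p \<Sigma>)"

definition S_of :: "nat \<Rightarrow> zpoly \<Rightarrow> zpoly \<Rightarrow> nat \<Rightarrow> zpoly fract set" where
  "S_of p \<Sigma> P = to_completion p (M_inf p \<Sigma>) (to_fract P)"

text \<open>Extensionality only pins down the irrelevant values outside the carrier.\<close>

definition univ_frob ::
    "nat \<Rightarrow> zpoly \<Rightarrow> (nat \<Rightarrow> zpoly fract set) \<Rightarrow> (nat \<Rightarrow> zpoly fract set)" where
  "univ_frob p \<Sigma> =
    (THE \<phi>. \<phi> \<in> ring_hom (S_ring p \<Sigma>) (S_ring p \<Sigma>) \<and> \<phi> \<in> extensional (carrier (S_ring p \<Sigma>)) \<and>
       (\<forall>i. \<phi> (S_of p \<Sigma> (z4 i)) =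
              S_of p \<Sigma> (z4 i) [^]\<^bsub>S_ring p \<Sigma>\<^esub> p \<oplus>\<^bsub>S_ring p \<Sigma>\<^esub>
              [p] \<cdot>\<^bsub>S_ring p \<Sigma>\<^esub> S_of p \<Sigma> (z4 (Suc i))) \<and>
       (\<forall>i. \<phi> (S_of p \<Sigma> (z6 i)) =
              S_of p \<Sigma> (z6 i) [^]\<^bsub>S_ring p \<Sigma>\<^esub> p \<oplus>\<^bsub>S_ring p \<Sigma>\<^esub>
              [p] \<cdot>\<^bsub>S_ring p \<Sigma>\<^esub> S_of p \<Sigma> (z6 (Suc i))))"


section \<open>Frobenius lifts on the completed curve\<close>

type_synonym E_elt = "(nat \<Rightarrow> nat \<Rightarrow> nat \<Rightarrow> zpoly fract set) set"

definition E_ring :: "nat \<Rightarrow> zpoly \<Rightarrow> E_elt ring" where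
  "E_ring p \<Sigma> = weierstrass_ring (S_ring p \<Sigma>) (S_of p \<Sigma> (z4 0)) (S_of p \<Sigma> (z6 0))"

definition E_class :: "nat \<Rightarrow> zpoly \<Rightarrow> (nat \<Rightarrow> nat \<Rightarrow> nat \<Rightarrow> zpoly fract set) \<Rightarrow> E_elt" where
  "E_class p \<Sigma> = weierstrass_class (S_ring p \<Sigma>) (S_of p \<Sigma> (z4 0)) (S_of p \<Sigma> (z6 0))"

definition E_const :: "nat \<Rightarrow> zpoly \<Rightarrow> (nat \<Rightarrow> zpoly fract set) \<Rightarrow> E_elt" where
  "E_const p \<Sigma> s = E_class p \<Sigma> (const_xy (S_ring p \<Sigma>) s)"

definition Ehat :: "nat \<Rightarrow> zpoly \<Rightarrow> (nat \<Rightarrow> E_elt set) ring" where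
  "Ehat p \<Sigma> = padic_completion p (E_ring p \<Sigma>)"

definition Ehat_const :: "nat \<Rightarrow> zpoly \<Rightarrow> (nat \<Rightarrow> zpoly fract set) \<Rightarrow> nat \<Rightarrow> E_elt set" where
  "Ehat_const p \<Sigma> s = to_completion p (E_ring p \<Sigma>) (E_const p \<Sigma> s)"

definition Ehat_x :: "nat \<Rightarrow> zpoly \<Rightarrow> nat \<Rightarrow> E_elt set" where
  "Ehat_x p \<Sigma> = to_completion p (E_ring p \<Sigma>) (E_class p \<Sigma> (var_x (S_ring p \<Sigma>)))"

definition Ehat_y :: "nat \<Rightarrow> zpoly \<Rightarrow> nat \<Rightarrow> E_elt set" where
  "Ehat_y p \<Sigma> = to_completion p (E_ring p \<Sigma>) (E_class p \<Sigma> (var_y (S_ring p \<Sigma>)))"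

definition frobenius_lift ::
    "nat \<Rightarrow> zpoly \<Rightarrow> ((nat \<Rightarrow> E_elt set) \<Rightarrow> (nat \<Rightarrow> E_elt set)) \<Rightarrow> bool" where
  "frobenius_lift p \<Sigma> \<Phi> \<longleftrightarrow>
    \<Phi> \<in> ring_hom (Ehat p \<Sigma>) (Ehat p \<Sigma>) \<and>
    (\<forall>s\<in>carrier (S_ring p \<Sigma>). \<Phi> (Ehat_const p \<Sigma> s) = Ehat_const p \<Sigma> (univ_frob p \<Sigma> s)) \<and>
    (\<forall>f\<in>carrier (Ehat p \<Sigma>).
       \<Phi> f \<ominus>\<^bsub>Ehat p \<Sigma>\<^esub> f [^]\<^bsub>Ehat p \<Sigma>\<^esub> p \<in> ppow_ideal p (Ehat p \<Sigma>) 1)"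

definition Omega ::
    "nat \<Rightarrow> zpoly \<Rightarrow> (nat \<Rightarrow> E_elt set, nat \<Rightarrow> (E_elt set \<Rightarrow> E_elt set) set) module" where
  "Omega p \<Sigma> = complete_kahler p (S_ring p \<Sigma>) (E_ring p \<Sigma>) (E_const p \<Sigma>)"

text \<open>\<open>dx/y\<close> is regular on the whole affine curve although \<open>y\<close> is not invertible there: it is the
  differential \<open>w\<close> with \<open>y w = dx\<close>.\<close>

definition omega :: "nat \<Rightarrow> zpoly \<Rightarrow> nat \<Rightarrow> (E_elt set \<Rightarrow> E_elt set) set" where
  "omega p \<Sigma> =
    (THE w. w \<in> carrier (Omega p \<Sigma>) \<and>
       Ehat_y p \<Sigma> \<odot>\<^bsub>Omega p \<Sigma>\<^esub> w =
         complete_d p (S_ring p \<Sigma>) (E_ring p \<Sigma>) (E_const p \<Sigma>) (Ehat_x p \<Sigma>))"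

text \<open>\<open>\<eta>\<close> is \<open>(1/p) \<Phi>\<^sup>* \<omega>\<close>; it is unique for \<open>\<Sigma> = Hasse p\<close>, where the module has no \<open>p\<close>-torsion.\<close>

definition lie_invariant_mod ::
    "nat \<Rightarrow> zpoly \<Rightarrow> ((nat \<Rightarrow> E_elt set) \<Rightarrow> (nat \<Rightarrow> E_elt set)) \<Rightarrow> nat \<Rightarrow>
     (nat \<Rightarrow> zpoly fract set) \<Rightarrow> bool" where
  "lie_invariant_mod p \<Sigma> \<Phi> m l \<longleftrightarrow>
    (\<exists>\<eta>\<in>carrier (Omega p \<Sigma>).
       [p] \<cdot>\<^bsub>Omega p \<Sigma>\<^esub> \<eta> =
         pullback p (S_ring p \<Sigma>) (E_ring p \<Sigma>) (E_const p \<Sigma>) \<Phi> (omega p \<Sigma>) \<and>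
       (\<exists>\<theta>\<in>carrier (Omega p \<Sigma>).
          \<eta> \<ominus>\<^bsub>Omega p \<Sigma>\<^esub> Ehat_const p \<Sigma> l \<odot>\<^bsub>Omega p \<Sigma>\<^esub> omega p \<Sigma> = [(p ^ m)] \<cdot>\<^bsub>Omega p \<Sigma>\<^esub> \<theta>))"

end

theory Submission
  imports Defs
begin

text \<open>
  Write \<open>f = x\<^sup>3 + z\<^sub>4 x + z\<^sub>6\<close>. A lift is determined by \<open>\<Phi>(x) = X = x\<^sup>p + p u\<close> and
  \<open>\<Phi>(y) = V y\<close> with \<open>V = f\<^sup>m + p v\<close>, \<open>m = (p-1)/2\<close>, subject to \<open>f\<^sup>\<phi>(X) = f V\<^sup>2\<close>. Lie invariance
  modulo \<open>p\<close> with eigenvalue \<open>1/H\<close> amounts to \<open>u' = f\<^sup>m/H - x\<^bsup>p-1\<^esup>\<close> modulo \<open>p\<close>, and the right-hand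
  side has an antiderivative exactly because its coefficient of \<open>x\<^bsup>p-1\<^esup>\<close> vanishes. This leaves \<open>u\<close>
  free up to a \<open>c\<close> with \<open>c' = 0\<close> modulo \<open>p\<close>, and that freedom suffices to solve the equation modulo
  \<open>p\<^sup>2\<close>: if \<open>f\<^sup>k\<close> divides \<open>W'\<close> modulo \<open>p\<close>, \<open>k < p\<close>, then \<open>W\<close> is congruent to such a \<open>c\<close> modulo
  \<open>f\<^bsup>k+1\<^esup>\<close>. Hensel's method, with \<open>r f + s f' = 1\<close>, then gives an exact solution.

  The completed rings are presented by a subring of a type: modulo \<open>p\<^sup>n\<close> the ring \<open>M\<^sup>\<infinity>\<close> agrees with a
  localisation \<open>L\<close> inside the field of fractions on which \<open>\<phi>\<close> is defined without completing, and the
  curve with \<open>L[x] \<oplus> L[x] y\<close>. The derivation \<open>x \<mapsto> y\<close>, \<open>y \<mapsto> f'/2\<close> identifies the differentials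
  with the functions, \<open>\<omega>\<close> corresponding to \<open>1\<close>.
\<close>

section \<open>Congruences in subrings\<close>

text \<open>Along \<open>X = x ^ p + p u\<close> the form \<open>dx/y\<close> pulls back to
  \<open>p (x ^ (p - 1) + u') dx / (V y)\<close>, and \<open>V\<close> is \<open>f ^ m\<close>
  modulo \<open>p\<close>; this is where the condition on \<open>u'\<close> comes from. The obstacle
  is that \<open>u\<close> and \<open>v\<close> must be polynomials. Modulo \<open>p ^ 2\<close> the
  equation is linear in both; it prescribes \<open>u\<close> modulo \<open>f ^ (m + 1)\<close>,
  while Lie invariance prescribes its derivative. The two demands are compatible because
  differentiating the congruence between \<open>f\<^sup>\<phi>(x ^ p)\<close> and
  \<open>f ^ p\<close> determines the derivative of its error term exactly. All later corrections of
  \<open>u\<close> are divisible by \<open>p\<close> and leave \<open>u'\<close> unchanged modulo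
  \<open>p\<close>, so no further condition arises.

  The detour through \<open>L\<close> has two causes: the image of \<open>\<Delta> H\<close> under
  \<open>\<phi>\<close> is a power of \<open>\<Delta> H\<close> only up to a multiple of
  \<open>p\<close>, and the elements of the completions are sequences of cosets, in which polynomial
  identities cannot be computed directly.\<close>

locale subring_set =
  fixes R :: "'a :: comm_ring_1 set"
  assumes one_mem [simp, intro]: "1 \<in> R"
    and add_mem [simp, intro]: "a \<in> R \<Longrightarrow> b \<in> R \<Longrightarrow> a + b \<in> R"
    and mult_mem [simp, intro]: "a \<in> R \<Longrightarrow> b \<in> R \<Longrightarrow> a * b \<in> R"
    and uminus_mem [simp, intro]: "a \<in> R \<Longrightarrow> - a \<in> R"
begin

lemma diff_mem [simp, intro]: "a \<in> R \<Longrightarrow> b \<in> R \<Longrightarrow> a - b \<in> R"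
  using add_mem[of a "- b"] by simp

lemma zero_mem [simp, intro]: "0 \<in> R"
  using diff_mem[of 1 1] by simp

lemma of_nat_mem [simp, intro]: "of_nat n \<in> R"
  by (induction n) auto

lemma numeral_mem [simp, intro]: "numeral n \<in> R"
  using of_nat_mem[of "numeral n"] by simp

lemma of_int_mem [simp, intro]: "of_int n \<in> R"
  by (cases n) (auto simp del: of_nat_Suc)

lemma power_mem [simp, intro]: "a \<in> R \<Longrightarrow> a ^ n \<in> R"
  by (induction n) auto

lemma sum_mem [intro]: "(\<And>i. i \<in> I \<Longrightarrow> f i \<in> R) \<Longrightarrow> sum f I \<in> R"
  by (induction I rule: infinite_finite_induct) auto

text \<open>The quotient must lie in \<open>R\<close>: in the fraction field used later
  \<open>p\<close> is invertible, so divisibility in the whole type would say nothing.\<close>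

definition cg :: "nat \<Rightarrow> 'a \<Rightarrow> 'a \<Rightarrow> bool" where
  "cg q a b \<longleftrightarrow> (\<exists>c\<in>R. a - b = of_nat q * c)"

lemma cgI: "c \<in> R \<Longrightarrow> a = b + of_nat q * c \<Longrightarrow> cg q a b"
  unfolding cg_def by auto

lemma cgE: assumes "cg q a b" obtains c where "c \<in> R" "a = b + of_nat q * c"
  using assms unfolding cg_def by (metis add.commute diff_add_cancel)

lemma cg_refl [simp, intro]: "cg q a a"
  by (rule cgI[of 0]) auto

lemma cg_sym: "cg q a b \<Longrightarrow> cg q b a"
  by (erule cgE, rule_tac c = "- c" in cgI) auto

lemma cg_trans [trans]: "cg q a b \<Longrightarrow> cg q b c \<Longrightarrow> cg q a c"
  unfolding cg_def by (metis (no_types, lifting) add_mem diff_add_cancel add_diff_eq distrib_left)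

lemma cg_eq_trans [trans]: "cg q a b \<Longrightarrow> b = c \<Longrightarrow> cg q a c"
  by simp

lemma eq_cg_trans [trans]: "a = b \<Longrightarrow> cg q b c \<Longrightarrow> cg q a c"
  by simp

lemma cg_add: "cg q a b \<Longrightarrow> cg q c d \<Longrightarrow> cg q (a + c) (b + d)"
  unfolding cg_def by (metis (no_types, lifting) add_mem add_diff_add distrib_left)

lemma cg_uminus: "cg q a b \<Longrightarrow> cg q (- a) (- b)"
  by (erule cgE, rule_tac c = "- c" in cgI) (auto simp: algebra_simps)

lemma cg_diff: "cg q a b \<Longrightarrow> cg q c d \<Longrightarrow> cg q (a - c) (b - d)"
  using cg_add[OF _ cg_uminus, of q a b c d] by simp

lemma cg_mult_left: "x \<in> R \<Longrightarrow> cg q a b \<Longrightarrow> cg q (x * a) (x * b)"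
  by (erule cgE, rule_tac c = "x * c" in cgI) (auto simp: algebra_simps)

lemma cg_mult_right: "x \<in> R \<Longrightarrow> cg q a b \<Longrightarrow> cg q (a * x) (b * x)"
  using cg_mult_left[of x q a b] by (simp add: mult.commute)

lemma cg_mult: "b \<in> R \<Longrightarrow> c \<in> R \<Longrightarrow> cg q a b \<Longrightarrow> cg q c d \<Longrightarrow> cg q (a * c) (b * d)"
  by (rule cg_trans[OF cg_mult_right cg_mult_left])

lemma cg_mem: "cg q a b \<Longrightarrow> b \<in> R \<Longrightarrow> a \<in> R"
  by (erule cgE) auto

lemma cg_mem': "cg q a b \<Longrightarrow> a \<in> R \<Longrightarrow> b \<in> R"
  using cg_mem cg_sym by blast

lemma cg_power: "a \<in> R \<Longrightarrow> cg q a b \<Longrightarrow> cg q (a ^ n) (b ^ n)"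
proof (induction n)
  case (Suc n)
  then have "b \<in> R" using cg_mem' by blast
  then show ?case using Suc cg_mult[of b "a ^ n" q a "b ^ n"] by simp
qed simp

lemma cg_dvd: "cg q a b \<Longrightarrow> k dvd q \<Longrightarrow> cg k a b"
  by (elim cgE dvdE, rule_tac c = "of_nat ka * c" in cgI) (auto simp: algebra_simps)

lemma cg_le: "cg (q ^ n) a b \<Longrightarrow> k \<le> n \<Longrightarrow> cg (q ^ k) a b"
  using cg_dvd le_imp_power_dvd by blast

lemma cg_0_mult: "x \<in> R \<Longrightarrow> cg q (of_nat q * x) 0"
  by (rule cgI[of x]) auto

lemma cg_frobenius_add:
  assumes p: "prime p" and "a \<in> R" "b \<in> R"
  shows "cg p ((a + b) ^ p) (a ^ p + b ^ p)"
proof -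
  define t where "t k = of_nat (p choose k) * a ^ k * b ^ (p - k)" for k
  have "p > 0" using p prime_gt_0_nat by blast
  have *: "\<exists>c\<in>R. t k = of_nat p * c" if "k \<in> {1..<p}" for k
  proof -
    have "p dvd (p choose k)" using p that by (intro dvd_choose_prime) auto
    then obtain j where "p choose k = p * j" by (elim dvdE)
    then have "t k = of_nat p * (of_nat j * a ^ k * b ^ (p - k))"
      unfolding t_def by (simp add: algebra_simps)
    then show ?thesis using assms by (intro bexI[of _ "of_nat j * a ^ k * b ^ (p - k)"]) auto
  qed
  then obtain c where c: "\<And>k. k \<in> {1..<p} \<Longrightarrow> c k \<in> R \<and> t k = of_nat p * c k"
    by metis
  have "(a + b) ^ p = (\<Sum>k\<le>p. t k)"
    unfolding t_def by (rule binomial_ring)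
  also have "{..p} = insert 0 (insert p {1..<p})"
    using \<open>p > 0\<close> by auto
  also have "sum t \<dots> = t 0 + (t p + sum t {1..<p})"
    using \<open>p > 0\<close> by (subst sum.insert) auto
  also have "sum t {1..<p} = (\<Sum>k\<in>{1..<p}. of_nat p * c k)"
    by (rule sum.cong) (use c in auto)
  also have "\<dots> = of_nat p * sum c {1..<p}"
    by (simp add: sum_distrib_left)
  also have "t 0 = b ^ p" by (simp add: t_def)
  also have "t p = a ^ p" by (simp add: t_def)
  finally show ?thesis
    using c by (intro cgI[of "sum c {1..<p}"]) auto
qed

lemma cg_frobenius_of_nat:
  assumes p: "prime p" shows "cg p (of_nat n ^ p) (of_nat n)"
proof (induction n)
  case 0
  then show ?case using prime_gt_0_nat[OF p] by (simp add: power_0_left)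
next
  case (Suc n)
  have "cg p ((of_nat n + 1) ^ p) (of_nat n ^ p + 1 ^ p)"
    using p by (rule cg_frobenius_add) auto
  also have "cg p \<dots> (of_nat n + 1)"
    using Suc by (auto intro: cg_add)
  finally show ?case by (simp add: add.commute)
qed

end

subsection \<open>Polynomials with coefficients in a subring\<close>

definition polys_over :: "'a :: comm_ring_1 set \<Rightarrow> 'a poly set" where
  "polys_over R = {P. \<forall>i. Polynomial.coeff P i \<in> R}"

lemma polys_overI: "(\<And>i. Polynomial.coeff P i \<in> R) \<Longrightarrow> P \<in> polys_over R"
  and polys_overD: "P \<in> polys_over R \<Longrightarrow> Polynomial.coeff P i \<in> R"
  by (auto simp: polys_over_def)

locale coeff_subring = subring_set R for R :: "'a :: idom set"
begin

lemma pCons_mem [simp]: "pCons c P \<in> polys_over R \<longleftrightarrow> c \<in> R \<and> P \<in> polys_over R"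
proof
  assume *: "pCons c P \<in> polys_over R"
  show "c \<in> R \<and> P \<in> polys_over R"
    using polys_overD[OF *, of 0] polys_overD[OF *, of "Suc _"] by (auto intro: polys_overI)
next
  assume "c \<in> R \<and> P \<in> polys_over R"
  then show "pCons c P \<in> polys_over R"
    by (auto intro!: polys_overI simp: coeff_pCons polys_overD split: nat.split)
qed

lemma polys_zero_mem [simp]: "0 \<in> polys_over R"
  by (auto intro: polys_overI)

lemma smult_mem [simp, intro]: "c \<in> R \<Longrightarrow> P \<in> polys_over R \<Longrightarrow> Polynomial.smult c P \<in> polys_over R"
  by (auto intro!: polys_overI simp: polys_overD)

sublocale LX: subring_set "polys_over R"
proof
  show "1 \<in> polys_over R" by (simp add: one_pCons)
next
  fix a b assume "a \<in> polys_over R" "b \<in> polys_over R"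
  then show "a * b \<in> polys_over R"
    by (auto intro!: polys_overI sum_mem mult_mem simp: coeff_mult polys_overD)
qed (auto intro!: polys_overI simp: polys_overD)

lemma pderiv_mem [simp, intro]: "P \<in> polys_over R \<Longrightarrow> pderiv P \<in> polys_over R"
  by (auto intro!: polys_overI simp: coeff_pderiv polys_overD simp del: of_nat_Suc)

lemma pcompose_mem [simp, intro]:
  "P \<in> polys_over R \<Longrightarrow> Q \<in> polys_over R \<Longrightarrow> pcompose P Q \<in> polys_over R"
  by (induction P) (auto simp: pcompose_pCons)

lemma cg_pderiv: "LX.cg q P Q \<Longrightarrow> LX.cg q (pderiv P) (pderiv Q)"
  by (erule LX.cgE, rule_tac c = "pderiv c" in LX.cgI)
     (auto simp: pderiv_add pderiv_mult pderiv_of_nat)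

lemma cg_pcompose:
  assumes "P \<in> polys_over R" "X \<in> polys_over R" "LX.cg q X Y"
  shows "LX.cg q (pcompose P X) (pcompose P Y)"
  using assms(1)
proof (induction P)
  case (pCons c P)
  have "Y \<in> polys_over R" using assms LX.cg_mem' by blast
  then show ?case using pCons assms
    by (auto simp: pcompose_pCons intro!: LX.cg_add LX.cg_mult)
qed simp

lemma cg_poly_iff:
  "LX.cg q P Q \<longleftrightarrow> (\<forall>i. cg q (Polynomial.coeff P i) (Polynomial.coeff Q i))" (is "?l \<longleftrightarrow> ?r")
proof
  assume ?l
  then obtain c where "c \<in> polys_over R" "P = Q + of_nat q * c" by (elim LX.cgE)
  then show ?r
    by (auto intro!: cgI[of "Polynomial.coeff c _"] simp: polys_overD of_nat_poly)
next
  assume r: ?r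
  then have "\<forall>i. \<exists>c. c \<in> R \<and> Polynomial.coeff P i - Polynomial.coeff Q i = of_nat q * c"
    unfolding cg_def by blast
  then obtain c where c: "\<And>i. c i \<in> R"
      "\<And>i. Polynomial.coeff P i - Polynomial.coeff Q i = of_nat q * c i"
    by metis
  \<comment> \<open>The chosen quotients need not vanish at large indices, for instance if
    \<open>q = 0\<close>. Both polynomials do, so cutting off at \<open>N\<close> is
    harmless.\<close>
  define N where "N = max (Polynomial.degree P) (Polynomial.degree Q)"
  define d where "d = (\<Sum>i\<le>N. Polynomial.monom (c i) i)"
  have d: "Polynomial.coeff d i = (if i \<le> N then c i else 0)" for i
    by (simp add: d_def coeff_sum)
  have "Polynomial.coeff P i = Polynomial.coeff Q i + of_nat q * Polynomial.coeff d i" for i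
  proof (cases "i \<le> N")
    case True
    then show ?thesis using c(2)[of i] d[of i] by (simp add: algebra_simps)
  next
    case False
    then show ?thesis using d[of i] by (simp add: N_def coeff_eq_0)
  qed
  then have "P = Q + of_nat q * d"
    by (simp add: poly_eq_iff of_nat_poly)
  moreover have "d \<in> polys_over R"
    by (rule polys_overI) (simp add: d c)
  ultimately show ?l
    by (auto intro: LX.cgI)
qed

text \<open>The highest coefficient of \<open>Q\<close> that is nonzero modulo \<open>q\<close>
  reappears in \<open>G * Q\<close>, shifted by the degree of \<open>G\<close>, because
  \<open>G\<close> is monic; \<open>T\<close> has nothing there. With \<open>T = 0\<close> this
  cancels \<open>G\<close>; in general it says that only the zero multiple of \<open>G\<close> can
  be congruent to a polynomial of lower degree.\<close>

lemma monic_cancel: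
  assumes G: "lead_coeff G = 1" "G \<in> polys_over R" and Q: "Q \<in> polys_over R"
    and cg: "LX.cg q (G * Q) T" and T: "\<And>j. j \<ge> Polynomial.degree G \<Longrightarrow> Polynomial.coeff T j = 0"
  shows "LX.cg q Q 0"
proof (rule ccontr)
  assume "\<not> LX.cg q Q 0"
  define S where "S = {i. \<not> cg q (Polynomial.coeff Q i) 0}"
  have "S \<noteq> {}" using \<open>\<not> LX.cg q Q 0\<close> by (auto simp: S_def cg_poly_iff)
  have "S \<subseteq> {..Polynomial.degree Q}"
  proof
    fix i assume "i \<in> S"
    then have "Polynomial.coeff Q i \<noteq> 0" unfolding S_def by auto
    then show "i \<in> {..Polynomial.degree Q}" using le_degree by auto
  qed
  then have "finite S" using finite_subset by blast
  define i where "i = Max S"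
  have i: "i \<in> S" using \<open>finite S\<close> \<open>S \<noteq> {}\<close> by (simp add: i_def)
  have gt: "cg q (Polynomial.coeff Q j) 0" if "j > i" for j
  proof (rule ccontr)
    assume "\<not> cg q (Polynomial.coeff Q j) 0"
    then have "j \<in> S" by (simp add: S_def)
    then show False using Max_ge[OF \<open>finite S\<close>] that by (fastforce simp: i_def)
  qed
  define d where "d = Polynomial.degree G"
  \<comment> \<open>The summands of the coefficient of \<open>G * Q\<close> at \<open>i + d\<close>.
    For \<open>k < d\<close> the factor from \<open>Q\<close> lies above \<open>i\<close>, for
    \<open>k > d\<close> the factor from \<open>G\<close> is zero, so only \<open>t d\<close>
    survives modulo \<open>q\<close>.\<close>
  define t where "t k = Polynomial.coeff G k * Polynomial.coeff Q (i + d - k)" for k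
  have t0: "cg q (t k) 0" if "k \<noteq> d" for k
  proof (cases "k > d")
    case True
    then show ?thesis by (simp add: t_def d_def coeff_eq_0)
  next
    case False
    then have "cg q (Polynomial.coeff Q (i + d - k)) 0" using that by (intro gt) auto
    then show ?thesis using cg_mult_left[OF polys_overD[OF G(2)]] by (fastforce simp: t_def)
  qed
  have "cg q (sum t A) 0" if "d \<notin> A" "finite A" for A
    using that(2,1)
  proof (induction A rule: finite_induct)
    case (insert k A)
    then have "cg q (t k) 0" by (intro t0) auto
    then have "cg q (t k + sum t A) (0 + 0)" using insert by (intro cg_add) auto
    then show ?case using insert by simp
  qed simp
  then have 1: "cg q (t d + sum t ({..i+d} - {d})) (Polynomial.coeff Q i + 0)"
    using G(1) by (intro cg_add) (auto simp: t_def d_def)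
  have 2: "Polynomial.coeff (G * Q) (i + d) = t d + sum t ({..i+d} - {d})"
    unfolding coeff_mult t_def[symmetric] by (rule sum.remove) auto
  have 3: "cg q (Polynomial.coeff (G * Q) (i + d)) 0"
    using cg[unfolded cg_poly_iff, rule_format, of "i + d"] T[of "i + d"] by (simp add: d_def)
  have "cg q (Polynomial.coeff Q i + 0) 0"
    by (rule cg_trans[OF cg_sym[OF 1] 3[unfolded 2]])
  then have "cg q (Polynomial.coeff Q i) 0" by simp
  then show False using i by (simp add: S_def)
qed

text \<open>Dividing by a monic polynomial requires no inverses, so quotient and remainder stay over
  \<open>R\<close>. The induction runs over a bound beyond which the coefficients of
  \<open>W\<close> vanish.\<close>

lemma monic_division:
  assumes G: "lead_coeff G = 1" "G \<in> polys_over R" and W: "W \<in> polys_over R"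
  obtains Q T where "Q \<in> polys_over R" "T \<in> polys_over R" "W = G * Q + T"
    "\<And>j. j \<ge> Polynomial.degree G \<Longrightarrow> Polynomial.coeff T j = 0"
proof -
  define d where "d = Polynomial.degree G"
  have "\<exists>Q\<in>polys_over R. \<exists>T\<in>polys_over R. W = G * Q + T \<and> (\<forall>j\<ge>d. Polynomial.coeff T j = 0)"
    if "\<forall>j\<ge>N+d. Polynomial.coeff W j = 0" "W \<in> polys_over R" for N W
    using that
  proof (induction N arbitrary: W)
    case 0
    then show ?case by (intro bexI[of _ 0] bexI[of _ W]) auto
  next
    case (Suc N)
    define c where "c = Polynomial.coeff W (N + d)"
    have c: "Polynomial.monom c N \<in> polys_over R"
      using Suc.prems(2) by (auto intro!: polys_overI simp: c_def polys_overD)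
    define V where "V = W - Polynomial.monom c N * G"
    have "Polynomial.coeff V j = 0" if "j \<ge> N + d" for j
    proof (cases "j = N + d")
      case True
      then show ?thesis using G by (simp add: V_def coeff_monom_mult c_def d_def)
    next
      case False
      then show ?thesis using that Suc.prems by (simp add: V_def coeff_monom_mult d_def coeff_eq_0)
    qed
    moreover have "V \<in> polys_over R" using c G Suc.prems by (auto simp: V_def)
    ultimately obtain Q T where QT: "Q \<in> polys_over R" "T \<in> polys_over R" "V = G * Q + T"
        "\<forall>j\<ge>d. Polynomial.coeff T j = 0"
      using Suc.IH by blast
    then have "W = G * (Q + Polynomial.monom c N) + T"
      by (simp add: V_def algebra_simps)
    then show ?case using QT c by blast
  qed
  moreover have "\<forall>j\<ge>Suc (Polynomial.degree W) + d. Polynomial.coeff W j = 0"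
    by (auto intro: coeff_eq_0)
  ultimately have "\<exists>Q\<in>polys_over R. \<exists>T\<in>polys_over R. W = G * Q + T \<and> (\<forall>j\<ge>d. Polynomial.coeff T j = 0)"
    using W by blast
  then show ?thesis using that unfolding d_def by blast
qed

text \<open>Each derivative lowers the exponent of \<open>F\<close> by at most one. The term of
  lowest exponent arises by differentiating the power of \<open>F\<close> every time, hence the
  falling factorial; everything else goes into \<open>T\<close>.\<close>

lemma higher_pderiv_power_mult:
  assumes F: "F \<in> polys_over R" and Q: "Q \<in> polys_over R" and "j \<le> k"
  shows "\<exists>T\<in>polys_over R. (pderiv ^^ j) (F ^ k * Q) =
    of_nat (\<Prod>i<j. k - i) * F ^ (k - j) * pderiv F ^ j * Q + F ^ Suc (k - j) * T"
  using \<open>j \<le> k\<close>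
proof (induction j)
  case 0
  then show ?case by (intro bexI[of _ 0]) auto
next
  case (Suc j)
  then obtain T where T: "T \<in> polys_over R" and eq: "(pderiv ^^ j) (F ^ k * Q) =
      of_nat (\<Prod>i<j. k - i) * F ^ (k - j) * pderiv F ^ j * Q + F ^ Suc (k - j) * T"
    by auto
  define c :: nat where "c = (\<Prod>i<j. k - i)"
  define n where "n = k - Suc j"
  have n: "k - j = Suc n" using Suc.prems by (simp add: n_def)
  define A where "A = pderiv F ^ j * Q"
  have A: "A \<in> polys_over R" using F Q by (auto simp: A_def)
  have pow: "pderiv (F ^ Suc i) = of_nat (Suc i) * F ^ i * pderiv F" for i
    unfolding pderiv_power_Suc by (simp add: of_nat_poly)
  have "(pderiv ^^ Suc j) (F ^ k * Q) = pderiv (of_nat c * F ^ Suc n * A + F ^ Suc (Suc n) * T)"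
    using eq by (simp add: c_def A_def n mult.assoc)
  also have "\<dots> = of_nat c * (of_nat (Suc n) * F ^ n * pderiv F) * A + of_nat c * F ^ Suc n * pderiv A +
      ((of_nat (Suc (Suc n)) * F ^ Suc n * pderiv F) * T + F ^ Suc (Suc n) * pderiv T)"
    unfolding pderiv_add pderiv_mult pow pderiv_of_nat by (simp add: algebra_simps)
  also have "\<dots> = of_nat (c * Suc n) * F ^ n * pderiv F ^ Suc j * Q +
      F ^ Suc n * (of_nat c * pderiv A + of_nat (Suc (Suc n)) * pderiv F * T + F * pderiv T)"
    by (simp add: A_def algebra_simps)
  also have "c * Suc n = (\<Prod>i<Suc j. k - i)"
    by (simp add: c_def n)
  finally have eq': "(pderiv ^^ Suc j) (F ^ k * Q) =
    of_nat (\<Prod>i<Suc j. k - i) * F ^ (k - Suc j) * pderiv F ^ Suc j * Q + F ^ Suc (k - Suc j) *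
      (of_nat c * pderiv A + of_nat (Suc (Suc n)) * pderiv F * T + F * pderiv T)"
    unfolding n_def .
  have "of_nat c * pderiv A + of_nat (Suc (Suc n)) * pderiv F * T + F * pderiv T \<in> polys_over R"
    using F T A by (auto simp del: of_nat_Suc)
  with eq' show ?case by blast
qed

end

section \<open>The equation for a Frobenius lift\<close>

text \<open>\<open>L\<close> plays the base ring before completion and \<open>h\<close> the inverse
  of the Hasse invariant. The ambient field has characteristic zero, so factors \<open>p\<close> can
  be cancelled exactly, while congruences are taken in \<open>L\<close>.\<close>

locale frobenius_curve = coeff_subring L for L :: "'k :: field_char_0 set" +
  fixes p :: nat and phi :: "'k \<Rightarrow> 'k" and a b h :: 'k
  assumes prime: "prime p" and p_gt_3: "p > 3"
    and inverse_of_nat_mem: "\<And>n. \<not> p dvd n \<Longrightarrow> inverse (of_nat n) \<in> L"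
    and a_mem: "a \<in> L" and b_mem: "b \<in> L"
    and disc_nonzero: "4 * a ^ 3 + 27 * b ^ 2 \<noteq> 0"
    and inverse_disc_mem: "inverse (4 * a ^ 3 + 27 * b ^ 2) \<in> L"
    and phi_add: "\<And>u v. phi (u + v) = phi u + phi v"
    and phi_mult: "\<And>u v. phi (u * v) = phi u * phi v"
    and phi_1: "phi 1 = 1"
    and phi_mem: "\<And>l. l \<in> L \<Longrightarrow> phi l \<in> L"
    and phi_frob: "\<And>l. l \<in> L \<Longrightarrow> cg p (phi l) (l ^ p)"
    and h_mem: "h \<in> L"
    and h_hasse: "h * Polynomial.coeff ([:b, a, 0, 1:] ^ ((p - 1) div 2)) (p - 1) = 1"
begin

abbreviation LX where "LX \<equiv> polys_over L"

definition F where "F = [:b, a, 0, 1:]"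
definition m where "m = (p - 1) div 2"
definition half where "half = [:inverse 2 :: 'k:]"
text \<open>\<open>4 * a ^ 3 + 27 * b ^ 2\<close> is the resultant of the cubic and its derivative;
  \<open>s\<close> and \<open>r\<close> are the cofactors in its expression by the two, divided by
  it.\<close>

definition s where
  "s = Polynomial.smult (inverse (4 * a ^ 3 + 27 * b ^ 2)) [:4 * a ^ 2, - 9 * b, 6 * a:]"
definition r where
  "r = Polynomial.smult (inverse (4 * a ^ 3 + 27 * b ^ 2)) [:27 * b, - 18 * a:]"
abbreviation x where "x \<equiv> [:0, 1 :: 'k:]"

lemma p_odd: "p = 2 * m + 1"
proof -
  have "odd p" using prime p_gt_3 prime_odd_nat by auto
  then show ?thesis unfolding m_def by (auto elim: oddE)
qed

lemma inverse_2_mem [simp]: "inverse 2 \<in> L"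
proof -
  have "\<not> p dvd 2" using p_gt_3 by (auto dest: dvd_imp_le)
  then show ?thesis using inverse_of_nat_mem[of 2] by simp
qed

lemma half_mem [simp, intro]: "half \<in> LX"
  unfolding half_def using inverse_2_mem by (simp only: pCons_mem polys_zero_mem simp_thms)

lemma half: "2 * half = 1"
  by (simp add: half_def numeral_poly one_pCons)

lemma F_mem [simp, intro]: "F \<in> LX"
  using a_mem b_mem by (simp add: F_def)

lemma F_pow_monic: "lead_coeff (F ^ k) = 1" and degree_F_pow: "Polynomial.degree (F ^ k) = 3 * k"
proof -
  have "lead_coeff F = 1" "Polynomial.degree F = 3" "F \<noteq> 0" by (auto simp: F_def)
  then show "lead_coeff (F ^ k) = 1" "Polynomial.degree (F ^ k) = 3 * k"
    unfolding lead_coeff_power by (auto simp: degree_power_eq)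
qed

lemma pderiv_F: "pderiv F = [:a, 0, 3:]"
  by (simp add: F_def pderiv_pCons)

lemma dF_mem [simp, intro]: "pderiv F \<in> LX"
  by auto

lemma s_mem [simp, intro]: "s \<in> LX" and r_mem [simp, intro]: "r \<in> LX"
  using a_mem b_mem inverse_disc_mem by (auto simp: s_def r_def)

lemma x_mem [simp, intro]: "x \<in> LX"
  by simp

lemma bezout: "r * F + s * pderiv F = 1"
proof -
  define d where "d = 4 * a ^ 3 + 27 * b ^ 2"
  have "r * F + s * pderiv F = Polynomial.smult (inverse d)
      ([:27 * b, - 18 * a:] * F + [:4 * a ^ 2, - 9 * b, 6 * a:] * pderiv F)"
    unfolding r_def s_def d_def[symmetric] by (simp only: smult_add_right mult_smult_left)
  also have "[:27 * b, - 18 * a:] * F + [:4 * a ^ 2, - 9 * b, 6 * a:] * pderiv F = [:d:]"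
    unfolding pderiv_F unfolding F_def d_def
    by (simp add: algebra_simps power2_eq_square power3_eq_cube)
  also have "Polynomial.smult (inverse d) [:d:] = 1"
    using disc_nonzero by (simp add: d_def one_pCons)
  finally show ?thesis .
qed

lemma s_dF: "s * pderiv F = 1 - r * F"
  using bezout by (simp add: algebra_simps)

section \<open>Exact division by powers of \<open>p\<close>, and derivatives modulo
  \<open>p\<close>\<close>

lemma p_pow_cancel: "of_nat (p ^ n) * (u :: 'k poly) = of_nat (p ^ n) * v \<Longrightarrow> u = v"
proof -
  have "of_nat (p ^ n) \<noteq> (0 :: 'k poly)"
    using prime_gt_0_nat[OF prime] by (simp add: of_nat_poly)
  then show "of_nat (p ^ n) * u = of_nat (p ^ n) * v \<Longrightarrow> u = v"
    using mult_left_cancel by blast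
qed

lemma cg_cancel:
  assumes "LX.cg (p ^ (n + k)) (of_nat (p ^ n) * u) (of_nat (p ^ n) * v)"
  shows "LX.cg (p ^ k) u v"
proof -
  obtain c where c: "c \<in> LX" "of_nat (p ^ n) * u = of_nat (p ^ n) * v + of_nat (p ^ (n + k)) * c"
    using assms by (elim LX.cgE)
  then have "of_nat (p ^ n) * u = of_nat (p ^ n) * (v + of_nat (p ^ k) * c)"
    by (simp add: power_add algebra_simps)
  then have "u = v + of_nat (p ^ k) * c" by (rule p_pow_cancel)
  with c show ?thesis by (auto intro: LX.cgI)
qed

text \<open>Each coefficient of a \<open>p\<close>-th derivative carries a product of
  \<open>p\<close> consecutive integers.\<close>

lemma higher_pderiv_p: "c \<in> LX \<Longrightarrow> LX.cg p ((pderiv ^^ p) c) 0"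
proof -
  assume c: "c \<in> LX"
  have "cg p (Polynomial.coeff ((pderiv ^^ p) c) n) 0" for n
  proof -
    have "pochhammer (of_nat (Suc n)) p = (of_nat (pochhammer (Suc n) p) :: 'k)"
      by (rule pochhammer_of_nat)
    moreover have "p dvd pochhammer (Suc n) p"
    proof -
      have "pochhammer (Suc n) p = (\<Prod>i<p. Suc n + i)"
        by (simp add: pochhammer_prod lessThan_atLeast0)
      moreover have "\<exists>i<p. p dvd Suc n + i"
      proof -
        \<comment> \<open>The distance from \<open>n + 1\<close> to the first multiple of
          \<open>p\<close> not below it, namely \<open>p * (n div p) + p\<close>.\<close>
        define i where "i = p - 1 - n mod p"
        have "n mod p < p" using prime_gt_0_nat[OF prime] by simp
        then have "Suc n + i = p * (n div p) + p"
          using mult_div_mod_eq[of p n] unfolding i_def by linarith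
        then have "p dvd Suc n + i" by simp
        moreover have "i < p" using prime_gt_0_nat[OF prime] by (simp add: i_def)
        ultimately show ?thesis by blast
      qed
      ultimately show ?thesis
        using dvd_prodI[of "{..<p}" _ "\<lambda>i. Suc n + i"] by (metis dvd_trans finite_lessThan lessThan_iff)
    qed
    then obtain k where "pochhammer (Suc n) p = p * k" by (elim dvdE)
    ultimately show ?thesis
      using c by (intro cgI[of "of_nat k * Polynomial.coeff c (n + p)"])
        (auto simp: coeff_higher_pderiv polys_overD simp del: of_nat_Suc)
  qed
  then show ?thesis by (simp add: cg_poly_iff)
qed

text \<open>The \<open>(p-1)\<close>-st derivative kills \<open>c'\<close> modulo \<open>p\<close> and maps \<open>F\<^bsup>p-1\<^esup> q\<close> to
  \<open>(p-1)! F'\<^bsup>p-1\<^esup> q\<close> modulo \<open>F\<close>.\<close>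

lemma exact_imp_dvd:
  assumes c: "c \<in> LX" and q: "q \<in> LX" and cg: "LX.cg p (pderiv c) (F ^ (p - 1) * q)"
  shows "\<exists>t\<in>LX. LX.cg p q (F * t)"
proof -
  define N where "N = (\<Prod>i<p - 1. p - 1 - i)"
  have "\<not> p dvd N"
    unfolding N_def using prime prime_gt_0_nat[OF prime]
    by (auto simp: prime_dvd_prod_iff dest: dvd_imp_le)
  then have inv: "inverse (of_nat N) \<in> L" by (rule inverse_of_nat_mem)
  have "N \<noteq> 0" using \<open>\<not> p dvd N\<close> by (metis dvd_0_right)
  define iN where "iN = [:inverse (of_nat N) :: 'k:]"
  have iN: "iN \<in> LX" "of_nat N * iN = 1"
    using inv \<open>N \<noteq> 0\<close> by (auto simp: iN_def of_nat_poly one_pCons)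
  obtain T where T: "T \<in> LX" "(pderiv ^^ (p - 1)) (F ^ (p - 1) * q) =
      of_nat N * pderiv F ^ (p - 1) * q + F * T"
    using higher_pderiv_power_mult[OF F_mem q, of "p - 1" "p - 1"] unfolding N_def by auto
  have hi: "LX.cg p ((pderiv ^^ n) A) ((pderiv ^^ n) B)" if "LX.cg p A B" for A B n
    using that by (induction n) (auto intro: cg_pderiv)
  have "(pderiv ^^ (p - 1)) (pderiv c) = (pderiv ^^ p) c"
    using prime_gt_0_nat[OF prime] by (metis Suc_pred' comp_apply funpow_Suc_right)
  then have "LX.cg p ((pderiv ^^ p) c) (of_nat N * pderiv F ^ (p - 1) * q + F * T)"
    using hi[OF cg, of "p - 1"] T by simp
  then have "LX.cg p 0 (of_nat N * pderiv F ^ (p - 1) * q + F * T)"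
    using LX.cg_trans LX.cg_sym higher_pderiv_p[OF c] by blast
  \<comment> \<open>\<open>iN\<close> removes the factorial, and \<open>s ^ (p - 1)\<close> inverts
    \<open>pderiv F ^ (p - 1)\<close> modulo \<open>F\<close>, since \<open>s * pderiv F\<close> is
    \<open>1 - r * F\<close>.\<close>
  then have "LX.cg p (iN * s ^ (p - 1) * 0)
      (iN * s ^ (p - 1) * (of_nat N * pderiv F ^ (p - 1) * q + F * T))"
    using iN by (intro LX.cg_mult_left) auto
  also have "iN * s ^ (p - 1) * (of_nat N * pderiv F ^ (p - 1) * q + F * T) =
     (of_nat N * iN) * (s * pderiv F) ^ (p - 1) * q + F * (iN * s ^ (p - 1) * T)"
    by (simp add: algebra_simps power_mult_distrib)
  also have "\<dots> = (1 - r * F) ^ (p - 1) * q + F * (iN * s ^ (p - 1) * T)"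
    by (simp only: s_dF iN mult_1)
  finally have *: "LX.cg p 0 ((1 - r * F) ^ (p - 1) * q + F * (iN * s ^ (p - 1) * T))"
    by simp
  have "\<exists>t\<in>LX. (1 - r * F) ^ n = 1 + F * t" for n
  proof (induction n)
    case (Suc n)
    then obtain t where t: "t \<in> LX" "(1 - r * F) ^ n = 1 + F * t" by blast
    then have "(1 - r * F) ^ Suc n = 1 + F * (t - r * (1 + F * t))"
      by (simp add: algebra_simps)
    then show ?case using t by (intro bexI[of _ "t - r * (1 + F * t)"]) auto
  qed (auto intro: bexI[of _ 0])
  then obtain t where t: "t \<in> LX" "(1 - r * F) ^ (p - 1) = 1 + F * t" by blast
  have "LX.cg p (q - 0) (q - ((1 - r * F) ^ (p - 1) * q + F * (iN * s ^ (p - 1) * T)))"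
    using * by (rule LX.cg_diff[OF LX.cg_refl])
  then have "LX.cg p q (F * - (t * q + iN * s ^ (p - 1) * T))"
    unfolding t by (simp add: algebra_simps)
  then show ?thesis using t q iN T by blast
qed

text \<open>First make the derivative divisible by \<open>F\<^bsup>p-1\<^esup>\<close>, then reduce modulo \<open>F\<^sup>p\<close>, which does not
  change derivatives modulo \<open>p\<close>; the degree then forces the derivative to vanish.\<close>

lemma approximate_by_constant:
  assumes W: "W \<in> LX" and k: "k \<le> p - 1" and q: "q \<in> LX"
    and cg: "LX.cg p (pderiv W) (F ^ k * q)"
  shows "\<exists>c\<in>LX. \<exists>t\<in>LX. LX.cg p (pderiv c) 0 \<and> LX.cg p (W - c) (F ^ Suc k * t)"
proof -
  \<comment> \<open>Only multiples of \<open>F ^ Suc k\<close> are subtracted from \<open>W\<close>,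
    while the exponent of \<open>F\<close> in the derivative climbs from \<open>k\<close> to
    \<open>p - 1\<close>.\<close>
  have "\<exists>n\<in>LX. \<exists>g\<in>LX. \<exists>t\<in>LX. LX.cg p (pderiv n) (F ^ i * g) \<and> W - n = F ^ Suc k * t"
    if "k \<le> i" "i \<le> p - 1" for i
    using that
  proof (induction i rule: dec_induct)
    case base
    then show ?case using cg W q by (intro bexI[of _ W] bexI[of _ q] bexI[of _ 0]) auto
  next
    case (step i)
    then obtain n g t where n: "n \<in> LX" "g \<in> LX" "t \<in> LX" "LX.cg p (pderiv n) (F ^ i * g)"
        "W - n = F ^ Suc k * t" by auto
    have "\<not> p dvd Suc i" using step by (auto dest: dvd_imp_le)
    define ci where "ci = [:inverse (of_nat (Suc i)) :: 'k:]"
    have ci: "ci \<in> LX" "of_nat (Suc i) * ci = 1"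
      using inverse_of_nat_mem[OF \<open>\<not> p dvd Suc i\<close>] unfolding ci_def
      by (auto simp: of_nat_poly one_pCons simp del: of_nat_Suc)
    \<comment> \<open>Differentiating \<open>F ^ Suc i * w\<close> brings down \<open>Suc i\<close>
      and \<open>pderiv F\<close>; \<open>ci\<close> and \<open>s\<close> undo this, so the
      subtraction cancels \<open>F ^ i * g\<close> up to a multiple of \<open>F ^ Suc i\<close>. The
      climb must stop at exponent \<open>p - 1\<close>, where the factor \<open>Suc i\<close> would
      be \<open>p\<close>.\<close>
    define w where "w = ci * g * s"
    have w: "w \<in> LX" using ci n by (auto simp: w_def)
    have "pderiv (n - F ^ Suc i * w) =
        pderiv n - (of_nat (Suc i) * F ^ i * pderiv F * w + F ^ Suc i * pderiv w)"
      unfolding pderiv_diff pderiv_mult pderiv_power_Suc by (simp add: of_nat_poly mult.commute)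
    also have "\<dots> = pderiv n - ((of_nat (Suc i) * ci) * F ^ i * (s * pderiv F) * g + F ^ Suc i * pderiv w)"
      by (simp add: w_def algebra_simps)
    also have "\<dots> = pderiv n - (F ^ i * (1 - r * F) * g + F ^ Suc i * pderiv w)"
      by (simp only: s_dF ci mult_1)
    also have "LX.cg p \<dots> (F ^ i * g - (F ^ i * (1 - r * F) * g + F ^ Suc i * pderiv w))"
      using n by (intro LX.cg_diff) auto
    also have "\<dots> = F ^ Suc i * (r * g - pderiv w)"
      by (simp add: algebra_simps)
    finally have "LX.cg p (pderiv (n - F ^ Suc i * w)) (F ^ Suc i * (r * g - pderiv w))" .
    moreover have "W - (n - F ^ Suc i * w) = F ^ Suc k * (t + F ^ (i - k) * w)"
    proof -
      have "F ^ Suc i = F ^ Suc k * F ^ (i - k)"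
        using step(1) by (simp flip: power_add)
      then show ?thesis using n(5) by (simp add: algebra_simps)
    qed
    ultimately show ?case using n w
      by (intro bexI[of _ "n - F ^ Suc i * w"] bexI[of _ "r * g - pderiv w"]
           bexI[of _ "t + F ^ (i - k) * w"]) auto
  qed
  from this[OF k order.refl] obtain n g t where n: "n \<in> LX" "g \<in> LX" "t \<in> LX"
      "LX.cg p (pderiv n) (F ^ (p - 1) * g)" "W - n = F ^ Suc k * t" by auto
  obtain Q c where c: "Q \<in> LX" "c \<in> LX" "n = F ^ p * Q + c"
      "\<And>j. j \<ge> 3 * p \<Longrightarrow> Polynomial.coeff c j = 0"
    using monic_division[OF F_pow_monic[of p], of n] n(1) unfolding degree_F_pow by auto
  have p1: "p = Suc (p - 1)" using prime_gt_0_nat[OF prime] by simp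
  have dFp: "pderiv (F ^ p) = of_nat p * (F ^ (p - 1) * pderiv F)"
    by (subst p1, subst pderiv_power_Suc) (use p1 in \<open>simp add: of_nat_poly\<close>)
  have "pderiv c = pderiv n - (of_nat p * (F ^ (p - 1) * pderiv F) * Q + F ^ p * pderiv Q)"
    unfolding c(3) pderiv_add pderiv_mult dFp by (simp add: algebra_simps)
  also have "LX.cg p \<dots> (F ^ (p - 1) * g - (0 + F ^ p * pderiv Q))"
    using n c by (intro LX.cg_diff LX.cg_add) (auto intro!: LX.cg_0_mult simp: mult.assoc)
  also have "\<dots> = F ^ (p - 1) * (g - F * pderiv Q)"
    by (subst (2) p1) (simp add: algebra_simps)
  finally have dc: "LX.cg p (pderiv c) (F ^ (p - 1) * (g - F * pderiv Q))" .
  \<comment> \<open>The last factor \<open>F\<close> cannot be gained by integration; it is supplied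
    by exactness. Modulo \<open>p\<close> now \<open>F ^ p\<close> divides \<open>pderiv c\<close>,
    whose degree is below \<open>3 * p\<close>.\<close>
  then obtain u where u: "u \<in> LX" "LX.cg p (g - F * pderiv Q) (F * u)"
    using exact_imp_dvd[OF c(2) _ dc] n c by auto
  note dc
  also have "LX.cg p (F ^ (p - 1) * (g - F * pderiv Q)) (F ^ (p - 1) * (F * u))"
    using u by (intro LX.cg_mult_left) auto
  also have "F ^ (p - 1) * (F * u) = F ^ p * u"
    by (subst (2) p1) simp
  finally have dc': "LX.cg p (pderiv c) (F ^ p * u)" .
  have "LX.cg p u 0"
  proof (rule monic_cancel[OF F_pow_monic _ u(1)])
    show "LX.cg p (F ^ p * u) (pderiv c)" using dc' by (rule LX.cg_sym)
    show "Polynomial.coeff (pderiv c) j = 0" if "j \<ge> Polynomial.degree (F ^ p)" for j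
      using c(4)[of "Suc j"] that by (simp add: coeff_pderiv degree_F_pow)
  qed auto
  then have "LX.cg p (F ^ p * u) (F ^ p * 0)" by (intro LX.cg_mult_left) auto
  then have "LX.cg p (pderiv c) 0" using dc' LX.cg_trans by simp
  moreover have "W - c = F ^ Suc k * (t + F ^ (p - 1 - k) * Q)"
  proof -
    have "F ^ p = F ^ Suc k * F ^ (p - 1 - k)"
      unfolding power_add[symmetric] using k p1 by (intro arg_cong[of _ _ "\<lambda>i. F ^ i"]) linarith
    then show ?thesis using n(5) c(3) by (simp add: algebra_simps)
  qed
  ultimately show ?thesis using n c by (intro bexI[of _ c] bexI[of _ "t + F ^ (p - 1 - k) * Q"]) auto
qed

section \<open>Evaluation twisted by \<open>phi\<close>\<close>

lemma phi_0 [simp]: "phi 0 = 0"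
  using phi_add[of 0 0] by simp

lemma phi_uminus: "phi (- u) = - phi u"
  using phi_add[of u "- u"] by (simp add: eq_neg_iff_add_eq_0 add.commute)

lemma phi_of_nat [simp]: "phi (of_nat n) = of_nat n"
  by (induction n) (auto simp: phi_add phi_1)

lemma phi_sum: "phi (sum f A) = (\<Sum>i\<in>A. phi (f i))"
  by (induction A rule: infinite_finite_induct) (auto simp: phi_add)

text \<open>\<open>ev P X\<close> is \<open>P\<^sup>\<phi>(X)\<close>.\<close>

definition ev :: "'k poly \<Rightarrow> 'k poly \<Rightarrow> 'k poly" where
  "ev P X = pcompose (map_poly phi P) X"

lemma ev_add: "ev (P + Q) X = ev P X + ev Q X"
proof -
  have "map_poly phi (P + Q) = map_poly phi P + map_poly phi Q"
    by (auto simp: poly_eq_iff coeff_map_poly phi_add)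
  then show ?thesis by (simp add: ev_def pcompose_add)
qed

lemma ev_mult: "ev (P * Q) X = ev P X * ev Q X"
proof -
  have "map_poly phi (P * Q) = map_poly phi P * map_poly phi Q"
    by (auto simp: poly_eq_iff coeff_map_poly coeff_mult phi_sum phi_mult)
  then show ?thesis by (simp add: ev_def pcompose_mult)
qed

lemma ev_0 [simp]: "ev 0 X = 0"
  by (simp add: ev_def)

lemma ev_pCons: "ev (pCons c P) X = [:phi c:] + X * ev P X"
  by (cases "c = 0 \<and> P = 0") (auto simp: ev_def map_poly_pCons pcompose_pCons)

lemma ev_1 [simp]: "ev 1 X = 1"
  by (simp add: one_pCons ev_pCons phi_1)

lemma ev_of_nat [simp]: "ev (of_nat n) X = of_nat n"
  by (induction n) (auto simp: ev_add)

lemma ev_uminus: "ev (- P) X = - ev P X"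
  using ev_add[of P "- P" X] by (simp add: eq_neg_iff_add_eq_0 add.commute)

lemma ev_mem [simp, intro]: "P \<in> LX \<Longrightarrow> X \<in> LX \<Longrightarrow> ev P X \<in> LX"
  by (induction P) (auto simp: ev_pCons phi_mem)

lemma ev_cg_left: "LX.cg q P Q \<Longrightarrow> X \<in> LX \<Longrightarrow> LX.cg q (ev P X) (ev Q X)"
  by (erule LX.cgE, rule_tac c = "ev c X" in LX.cgI) (auto simp: ev_add ev_mult)

lemma ev_cg_right: "P \<in> LX \<Longrightarrow> X \<in> LX \<Longrightarrow> LX.cg q X Y \<Longrightarrow> LX.cg q (ev P X) (ev P Y)"
  unfolding ev_def by (rule cg_pcompose) (auto intro!: polys_overI simp: coeff_map_poly polys_overD phi_mem)

lemma pderiv_ev: "pderiv (ev P X) = ev (pderiv P) X * pderiv X"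
proof -
  have "pderiv (map_poly phi P) = map_poly phi (pderiv P)"
    by (simp add: poly_eq_iff coeff_map_poly coeff_pderiv phi_mult del: of_nat_Suc)
  then show ?thesis by (simp add: ev_def pderiv_pcompose)
qed

text \<open>Horner induction: \<open>phi_frob\<close> treats the constant coefficient, and the
  \<open>p\<close>-th power is additive modulo \<open>p\<close>.\<close>

lemma ev_frob: "P \<in> LX \<Longrightarrow> LX.cg p (ev P (x ^ p)) (P ^ p)"
proof (induction P)
  case 0
  then show ?case using prime_gt_0_nat[OF prime] by (simp add: power_0_left)
next
  case (pCons c P)
  then have c: "c \<in> L" "P \<in> LX" by auto
  have "LX.cg p [:phi c:] [:c ^ p:]"
    using phi_frob[OF c(1)] by (auto simp: cg_poly_iff coeff_pCons split: nat.split)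
  moreover have "[:c ^ p:] = [:c:] ^ p" by (simp add: poly_const_pow)
  ultimately have "LX.cg p ([:phi c:] + x ^ p * ev P (x ^ p)) ([:c:] ^ p + x ^ p * P ^ p)"
    using pCons c by (intro LX.cg_add LX.cg_mult_left) auto
  moreover have "LX.cg p (([:c:] + x * P) ^ p) ([:c:] ^ p + (x * P) ^ p)"
    using prime c by (intro LX.cg_frobenius_add) auto
  moreover have "pCons c P = [:c:] + x * P" by simp
  ultimately show ?case
    unfolding ev_pCons power_mult_distrib by (metis LX.cg_sym LX.cg_trans)
qed

lemma ev_F: "ev F X = X ^ 3 + [:phi a:] * X + [:phi b:]"
  by (simp add: F_def ev_pCons phi_1 power3_eq_cube algebra_simps flip: one_pCons)

lemma phi_3: "phi 3 = 3"
  using phi_of_nat[of 3] by simp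

lemma ev_dF: "ev (pderiv F) X = 3 * X ^ 2 + [:phi a:]"
  unfolding pderiv_F by (simp add: ev_pCons phi_3 power2_eq_square numeral_poly)

text \<open>Exact, because \<open>F\<close> is a cubic; it has no quadratic term, so the second and
  third Taylor coefficients at \<open>X\<close> are \<open>3 * X\<close> and
  \<open>1\<close>.\<close>

lemma ev_F_taylor: "ev F (X + e) = ev F X + ev (pderiv F) X * e + e ^ 2 * (3 * X + e)"
  unfolding ev_F ev_dF by (simp add: algebra_simps power2_eq_square power3_eq_cube smult_add_right)

lemma ev_bezout: "ev r X * ev F X + ev s X * ev (pderiv F) X = 1"
  unfolding ev_mult[symmetric] ev_add[symmetric] bezout by simp

section \<open>Solving the equation for the lift\<close>

lemma pderiv_power_p: "pderiv (A ^ p) = of_nat p * (A ^ (p - 1) * pderiv A)"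
proof -
  have p1: "p = Suc (p - 1)" using prime_gt_0_nat[OF prime] by simp
  show ?thesis
    by (subst p1, subst pderiv_power_Suc) (use p1 in \<open>simp add: of_nat_poly\<close>)
qed

lemma F_pow_p: "F ^ p = F ^ Suc m * F ^ m" "F ^ (p - 1) = F ^ m * F ^ m"
proof -
  have "p = Suc m + m" "p - 1 = m + m" using p_odd by auto
  then show "F ^ p = F ^ Suc m * F ^ m" "F ^ (p - 1) = F ^ m * F ^ m"
    unfolding power_add[symmetric] by argo+
qed

text \<open>For \<open>X\<close> congruent to \<open>x ^ p\<close> the polynomial
  \<open>ev (pderiv F) X\<close> is \<open>pderiv F ^ p\<close> modulo \<open>p\<close>; this
  identity inverts it modulo \<open>F ^ p\<close>.\<close>

lemma bezout_frob: "LX.cg p (r ^ p * F ^ p + s ^ p * pderiv F ^ p) 1"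
proof -
  have "LX.cg p ((r * F + s * pderiv F) ^ p) ((r * F) ^ p + (s * pderiv F) ^ p)"
    using prime by (intro LX.cg_frobenius_add) auto
  then show ?thesis unfolding bezout by (auto simp: power_mult_distrib intro: LX.cg_sym)
qed

text \<open>\<open>h\<close> normalises the coefficient of \<open>x ^ (p - 1)\<close> in
  \<open>F ^ m\<close> to one, so it cancels exactly and not merely modulo \<open>p\<close>. All
  other denominators of the integration are prime to \<open>p\<close>.\<close>

lemma antiderivative:
  "\<exists>u\<in>LX. pderiv u = [:h:] * F ^ m - x ^ (p - 1)"
proof -
  define g where "g = [:h:] * F ^ m - x ^ (p - 1)"
  have g: "g \<in> LX" using h_mem unfolding g_def by auto
  define u where "u = (\<Sum>j\<le>Polynomial.degree g.
    Polynomial.monom (Polynomial.coeff g j * inverse (of_nat (Suc j))) (Suc j))"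
  have p1: "p - 1 = 2 * m" using p_odd by simp
  have xp: "x ^ (p - 1) = Polynomial.monom 1 (p - 1)"
    by (simp add: monom_altdef)
  have g0: "Polynomial.coeff g (p - 1) = 0"
  proof -
    have "Polynomial.coeff (x ^ (p - 1)) (p - 1) = 1" by (subst xp) simp
    then show ?thesis using h_hasse by (simp add: g_def F_def m_def)
  qed
  have "Polynomial.degree ([:h:] * F ^ m) \<le> 3 * m"
    using degree_F_pow[of m] by (simp add: degree_smult_le)
  moreover have "Polynomial.degree (x ^ (p - 1)) \<le> 3 * m"
    unfolding xp using p1 by (simp add: degree_monom_eq)
  ultimately have deg: "Polynomial.degree g \<le> 3 * m"
    unfolding g_def by (rule degree_diff_le)
  have "Polynomial.coeff g j * inverse (of_nat (Suc j)) \<in> L" if "j \<le> Polynomial.degree g" for j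
  proof (cases "j = p - 1")
    case True
    then show ?thesis using g0 by simp
  next
    case False
    have "\<not> p dvd Suc j"
    proof
      assume "p dvd Suc j"
      then obtain k where k: "Suc j = p * k" by (elim dvdE)
      have "k \<noteq> 0" using k by (intro notI) simp
      \<comment> \<open>\<open>k = 1\<close> would be the excluded index \<open>p - 1\<close>, and
        \<open>k \<ge> 2\<close> would need \<open>j + 1 \<ge> 2 * p\<close>, beyond the degree
        bound \<open>3 * m\<close>.\<close>
      moreover have "k \<noteq> 1" using k False by auto
      ultimately have "p * 2 \<le> p * k" by (intro mult_le_mono) auto
      then show False using k that deg p_odd by linarith
    qed
    then show ?thesis using inverse_of_nat_mem g by (intro mult_mem) (auto simp: polys_overD simp del: of_nat_Suc)
  qed
  then have "u \<in> LX"
    unfolding u_def by (intro LX.sum_mem polys_overI) auto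
  moreover have "pderiv u = (\<Sum>j\<le>Polynomial.degree g. Polynomial.monom (Polynomial.coeff g j) j)"
    unfolding u_def higher_pderiv_sum[of 1, simplified] pderiv_monom
    by (intro sum.cong refl arg_cong2[of _ _ _ _ Polynomial.monom]) (auto simp del: of_nat_Suc)
  ultimately show ?thesis
    unfolding poly_as_sum_of_monoms g_def by blast
qed

text \<open>Write \<open>ev F (x ^ p) = F ^ p + p * G\<close> and
  \<open>E = ev (pderiv F) (x ^ p)\<close>. Modulo \<open>p ^ 2\<close> the equation amounts to
  \<open>G + E * u = 2 * F ^ (m + 1) * v\<close> modulo \<open>p\<close>. Since \<open>s ^ p\<close>
  inverts \<open>E\<close> modulo \<open>F ^ p\<close> and \<open>p\<close>, a solution
  \<open>v\<close> exists once \<open>F ^ (m + 1)\<close> divides \<open>u + G * s ^ p\<close>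
  modulo \<open>p\<close>. With \<open>u = u0 - c\<close> this asks \<open>c\<close> to approximate
  \<open>u0 + G * s ^ p\<close>.\<close>

lemma first_solution:
  obtains u v where "u \<in> LX" "v \<in> LX"
    "LX.cg (p ^ 2) (ev F (x ^ p + of_nat p * u)) (F * (F ^ m + of_nat p * v) ^ 2)"
    "LX.cg p (x ^ (p - 1) + pderiv u) ([:h:] * F ^ m)"
proof -
  obtain u0 where u0: "u0 \<in> LX" "pderiv u0 = [:h:] * F ^ m - x ^ (p - 1)"
    using antiderivative by blast
  define E where "E = ev (pderiv F) (x ^ p)"
  have E: "E \<in> LX" "LX.cg p E (pderiv F ^ p)"
    unfolding E_def using ev_frob[of "pderiv F"] by auto
  have "LX.cg p (r ^ p * F ^ p + s ^ p * E) (r ^ p * F ^ p + s ^ p * pderiv F ^ p)"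
    using E by (intro LX.cg_add LX.cg_mult_left) auto
  then have "LX.cg p (r ^ p * F ^ p + s ^ p * E) 1"
    using bezout_frob by (rule LX.cg_trans)
  then obtain e where e: "e \<in> LX" "r ^ p * F ^ p + s ^ p * E = 1 + of_nat p * e"
    by (elim LX.cgE)
  obtain G where G: "G \<in> LX" "ev F (x ^ p) = F ^ p + of_nat p * G"
    using ev_frob[of F] by (auto elim: LX.cgE)
  \<comment> \<open>Both sides of \<open>G(2)\<close> are differentiated; each derivative carries a
    factor \<open>p\<close>, and cancelling it determines \<open>pderiv G\<close> exactly.\<close>
  have "pderiv (ev F (x ^ p)) = of_nat p * (E * x ^ (p - 1))"
    unfolding pderiv_ev E_def pderiv_power_p by (simp add: pderiv_pCons algebra_simps)
  moreover have "pderiv (F ^ p + of_nat p * G) =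
      of_nat p * (F ^ (p - 1) * pderiv F + pderiv G)"
    unfolding pderiv_add pderiv_mult pderiv_power_p pderiv_of_nat by (simp add: algebra_simps)
  ultimately have "of_nat (p ^ 1) * (E * x ^ (p - 1)) = of_nat (p ^ 1) * (F ^ (p - 1) * pderiv F + pderiv G)"
    unfolding G(2) power_one_right by metis
  then have "E * x ^ (p - 1) = F ^ (p - 1) * pderiv F + pderiv G"
    by (rule p_pow_cancel)
  then have dG: "pderiv G = E * x ^ (p - 1) - F ^ (p - 1) * pderiv F" by (simp add: algebra_simps)
  define W where "W = u0 + G * s ^ p"
  have W: "W \<in> LX" using u0 G by (auto simp: W_def)
  \<comment> \<open>In \<open>pderiv W\<close> the term \<open>- x ^ (p - 1)\<close> from
    \<open>u0\<close> cancels against \<open>s ^ p * E * x ^ (p - 1)\<close> from \<open>G\<close>;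
    what remains modulo \<open>p\<close> is divisible by \<open>F ^ m\<close>.\<close>
  define Q where "Q = [:h:] - x ^ (p - 1) * r ^ p * F ^ Suc m - s ^ p * F ^ m * pderiv F"
  have Q: "Q \<in> LX" using h_mem unfolding Q_def by (auto simp del: power_Suc)
  have "pderiv W = F ^ m * Q + of_nat p * (e * x ^ (p - 1) + G * (s ^ (p - 1) * pderiv s))"
  proof -
    have "s ^ p * E = 1 + of_nat p * e - r ^ p * F ^ p"
      using e(2) by (simp add: algebra_simps)
    then have "s ^ p * E * x ^ (p - 1) = (1 + of_nat p * e - r ^ p * F ^ p) * x ^ (p - 1)"
      by simp
    then show ?thesis
      unfolding W_def pderiv_add pderiv_mult pderiv_power_p u0(2) dG Q_def F_pow_p
      by (simp add: algebra_simps)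
  qed
  then have "LX.cg p (pderiv W) (F ^ m * Q)"
    by (rule LX.cgI[rotated]) (use e G in auto)
  then obtain c t where c: "c \<in> LX" "t \<in> LX" "LX.cg p (pderiv c) 0" "LX.cg p (W - c) (F ^ Suc m * t)"
    using approximate_by_constant[OF W _ Q, of m] p_odd by fastforce
  obtain d where d: "d \<in> LX" "W - c = F ^ Suc m * t + of_nat p * d"
    using c(4) by (elim LX.cgE)
  define u where "u = u0 - c"
  \<comment> \<open>Read off from \<open>G + E * u\<close>, where the parts
    \<open>E * F ^ Suc m * t\<close> and \<open>G * r ^ p * F ^ p\<close> both contain
    \<open>F ^ Suc m\<close>.\<close>
  define v where "v = half * (E * t + G * r ^ p * F ^ m)"
  have uv: "u \<in> LX" "v \<in> LX" using u0 c E G by (auto simp: u_def v_def)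
  have v2: "2 * v = E * t + G * r ^ p * F ^ m"
    using half by (simp add: v_def mult.assoc[symmetric])
  have main: "G + E * u = 2 * F ^ Suc m * v + of_nat p * (E * d - G * e)"
  proof -
    have "u = F ^ Suc m * t + of_nat p * d - G * s ^ p"
      using d(2) unfolding u_def W_def by (simp add: algebra_simps)
    then have "G + E * u = G + E * (F ^ Suc m * t + of_nat p * d - G * s ^ p)"
      by (rule arg_cong)
    also have "\<dots> = E * (F ^ Suc m * t + of_nat p * d) + G * (1 - s ^ p * E)"
      by (simp add: algebra_simps)
    also have "1 - s ^ p * E = r ^ p * F ^ p - of_nat p * e"
      using e(2) by (simp add: algebra_simps)
    also have "E * (F ^ Suc m * t + of_nat p * d) + G * (r ^ p * F ^ p - of_nat p * e) =
       F ^ Suc m * (2 * v) + of_nat p * (E * d - G * e)"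
      unfolding v2 F_pow_p by (simp add: algebra_simps)
    finally show ?thesis by (simp add: algebra_simps)
  qed
  have "ev F (x ^ p + of_nat p * u) = F ^ p + of_nat p * (G + E * u) +
      (of_nat p * u) ^ 2 * (3 * x ^ p + of_nat p * u)"
    unfolding ev_F_taylor G(2) E_def by (simp add: algebra_simps)
  also have "\<dots> = F * (F ^ m + of_nat p * v) ^ 2 + of_nat (p ^ 2) *
      (E * d - G * e + u ^ 2 * (3 * x ^ p + of_nat p * u) - v ^ 2 * F)"
    unfolding main F_pow_p by (simp add: algebra_simps power2_eq_square)
  finally have 1: "LX.cg (p ^ 2) (ev F (x ^ p + of_nat p * u)) (F * (F ^ m + of_nat p * v) ^ 2)"
    by (rule LX.cgI[rotated]) (use uv E d G e in auto)
  have "LX.cg p ([:h:] * F ^ m - pderiv c) ([:h:] * F ^ m - 0)"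
    using c by (intro LX.cg_diff) auto
  then have 2: "LX.cg p (x ^ (p - 1) + pderiv u) ([:h:] * F ^ m)"
    by (simp add: u_def pderiv_diff u0(2) algebra_simps)
  show ?thesis using that[OF uv 1 2] .
qed

text \<open>The defect \<open>e\<close> is split by \<open>bezout_frob\<close>: the part with
  \<open>pderiv F ^ p\<close> is absorbed by changing \<open>u\<close>, the part with
  \<open>F ^ p = F ^ Suc m * F ^ m\<close> by changing \<open>v\<close>, whose linear effect is
  \<open>2 * F * V\<close> with \<open>V\<close> congruent to \<open>F ^ m\<close>.\<close>

lemma hensel_step:
  assumes u: "u \<in> LX" and v: "v \<in> LX" and
    cg: "LX.cg (p ^ (n + 2)) (ev F (x ^ p + of_nat p * u)) (F * (F ^ m + of_nat p * v) ^ 2)"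
  shows "\<exists>u'\<in>LX. \<exists>v'\<in>LX. LX.cg (p ^ Suc n) u' u \<and> LX.cg (p ^ Suc n) v' v \<and>
    LX.cg (p ^ (Suc n + 2)) (ev F (x ^ p + of_nat p * u')) (F * (F ^ m + of_nat p * v') ^ 2)"
proof -
  define X where "X = x ^ p + of_nat p * u"
  define V where "V = F ^ m + of_nat p * v"
  have XV: "X \<in> LX" "V \<in> LX" using u v by (auto simp: X_def V_def)
  define N where "N = n + 2"
  obtain e where e: "e \<in> LX" "ev F X = F * V ^ 2 + of_nat (p ^ N) * e"
    using cg unfolding X_def[symmetric] V_def[symmetric] N_def by (elim LX.cgE)
  have "LX.cg p X (x ^ p)" using u by (auto intro: LX.cgI simp: X_def)
  then have "LX.cg p (ev (pderiv F) X) (ev (pderiv F) (x ^ p))"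
    using XV by (intro ev_cg_right) auto
  also have "LX.cg p \<dots> (pderiv F ^ p)" by (rule ev_frob) auto
  finally obtain e1 where e1: "e1 \<in> LX" "ev (pderiv F) X = pderiv F ^ p + of_nat p * e1"
    by (elim LX.cgE)
  obtain e2 where e2: "e2 \<in> LX" "r ^ p * F ^ p + s ^ p * pderiv F ^ p = 1 + of_nat p * e2"
    using bezout_frob by (elim LX.cgE)
  define A where "A = - (s ^ p * e)"
  define B where "B = half * (r ^ p * F ^ m * e)"
  have AB: "A \<in> LX" "B \<in> LX" using e by (auto simp: A_def B_def)
  have B2: "2 * B = r ^ p * F ^ m * e" using half by (simp add: B_def mult.assoc[symmetric])
  have "e + ev (pderiv F) X * A - F * V * (2 * B) =
      e * (1 - (r ^ p * F ^ p + s ^ p * pderiv F ^ p)) +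
      of_nat p * (e1 * A - F * v * (2 * B))"
    unfolding e1(2) A_def B2 V_def F_pow_p by (simp add: algebra_simps)
  also have "\<dots> = of_nat p * (e1 * A - F * v * (2 * B) - e * e2)"
    unfolding e2 by (simp add: algebra_simps)
  finally have main: "e + ev (pderiv F) X * A =
      F * V * (2 * B) + of_nat p * (e1 * A - F * v * (2 * B) - e * e2)"
    by (simp add: algebra_simps)
  define P where "P = (of_nat (p ^ N) :: 'k poly)"
  have P: "P \<in> LX" unfolding P_def by (rule LX.of_nat_mem)
  \<comment> \<open>So \<open>P * A\<close> is \<open>p\<close> times an increment of
    \<open>u\<close>, and \<open>P * P\<close> is a multiple of \<open>p ^ Suc N\<close>, which
    disposes of the quadratic terms.\<close>
  have PP: "P = of_nat p * of_nat (p ^ Suc n)" by (simp add: P_def N_def)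
  have PN: "of_nat (p ^ Suc N) = of_nat p * P" by (simp add: P_def)
  have "ev F (X + P * A) = F * V ^ 2 + P * (e + ev (pderiv F) X * A) + P ^ 2 * (A ^ 2 * (3 * X + P * A))"
    unfolding ev_F_taylor e(2) P_def[symmetric] by (simp add: algebra_simps power_mult_distrib)
  also have "\<dots> = F * (V + P * B) ^ 2 + P * of_nat p * (e1 * A - F * v * (2 * B) - e * e2) +
      P * P * (A ^ 2 * (3 * X + P * A) - F * B ^ 2)"
    unfolding main by (simp add: algebra_simps power2_eq_square)
  also have "\<dots> = F * (V + P * B) ^ 2 + of_nat (p ^ Suc N) * ((e1 * A - F * v * (2 * B) - e * e2) +
      of_nat (p ^ Suc n) * (A ^ 2 * (3 * X + P * A) - F * B ^ 2))"
    unfolding PN by (subst (3) PP) (simp only: algebra_simps)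
  finally have "LX.cg (p ^ Suc N) (ev F (X + P * A)) (F * (V + P * B) ^ 2)"
    by (rule LX.cgI[rotated]) (use P AB XV e e1 e2 v in auto)
  moreover have "X + P * A = x ^ p + of_nat p * (u + of_nat (p ^ Suc n) * A)"
    unfolding PP X_def by (simp add: algebra_simps)
  moreover have "V + P * B = F ^ m + of_nat p * (v + of_nat (p ^ Suc n) * B)"
    unfolding PP V_def by (simp add: algebra_simps)
  ultimately have "LX.cg (p ^ (Suc n + 2)) (ev F (x ^ p + of_nat p * (u + of_nat (p ^ Suc n) * A)))
      (F * (F ^ m + of_nat p * (v + of_nat (p ^ Suc n) * B)) ^ 2)"
    by (simp add: N_def)
  moreover have "LX.cg (p ^ Suc n) (u + of_nat (p ^ Suc n) * A) u"
      "LX.cg (p ^ Suc n) (v + of_nat (p ^ Suc n) * B) v"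
    using AB by (auto intro: LX.cgI)
  ultimately show ?thesis using u v AB
    by (intro bexI[of _ "u + of_nat (p ^ Suc n) * A"] bexI[of _ "v + of_nat (p ^ Suc n) * B"])
       (auto simp del: of_nat_power)
qed

section \<open>The eigenvalue of the lift\<close>

text \<open>\<open>eigen u v\<close> is the coefficient of \<open>\<omega>\<close> in \<open>\<Phi>\<^sup>*\<omega>/p\<close>, computed from \<open>\<omega> = r y dx + 2 s dy\<close>.\<close>

definition velX where "velX u = x ^ (p - 1) + pderiv u"
definition velV where "velV v = F ^ m * pderiv F + 2 * pderiv v * F + v * pderiv F"
definition eigen where
  "eigen u v = ev r (x ^ p + of_nat p * u) * (F ^ m + of_nat p * v) * F * velX u +
    ev s (x ^ p + of_nat p * u) * velV v"

lemma vel_mem [simp, intro]: "u \<in> LX \<Longrightarrow> velX u \<in> LX" "u \<in> LX \<Longrightarrow> velV u \<in> LX"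
  by (auto simp: velX_def velV_def)

lemma eigen_mem [simp, intro]: "u \<in> LX \<Longrightarrow> v \<in> LX \<Longrightarrow> eigen u v \<in> LX"
  by (auto simp: eigen_def)

lemma pderiv_X: "pderiv (x ^ p + of_nat p * u) = of_nat p * velX u"
  unfolding velX_def pderiv_add pderiv_mult pderiv_power_p pderiv_of_nat
  by (simp add: pderiv_pCons algebra_simps)

text \<open>The left side is twice the derivative of \<open>V y\<close> along
  \<open>x \<mapsto> y\<close>, \<open>y \<mapsto> F'/2\<close>. It is divisible by \<open>p\<close>
  because the power \<open>F ^ m\<close> contributes the factor
  \<open>2 * m + 1 = p\<close>.\<close>

lemma pderiv_V:
  "2 * pderiv (F ^ m + of_nat p * v) * F + (F ^ m + of_nat p * v) * pderiv F = of_nat p * velV v"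
proof -
  obtain k where k: "m = Suc k" using p_odd p_gt_3 by (cases m) auto
  have "pderiv (F ^ m) * F = of_nat m * F ^ m * pderiv F"
    unfolding k pderiv_power_Suc by (simp add: of_nat_poly algebra_simps)
  then have "2 * pderiv (F ^ m + of_nat p * v) * F + (F ^ m + of_nat p * v) * pderiv F =
      (2 * of_nat m + 1) * F ^ m * pderiv F + of_nat p * (2 * pderiv v * F + v * pderiv F)"
    unfolding pderiv_add pderiv_mult pderiv_of_nat by (simp add: algebra_simps)
  also have "2 * of_nat m + 1 = (of_nat p :: 'k poly)"
    by (subst (2) p_odd) simp
  finally show ?thesis by (simp add: velV_def algebra_simps)
qed

text \<open>Differentiating the equation and cancelling one \<open>p\<close>, whence
  \<open>Suc n\<close> in place of \<open>n + 2\<close>, gives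
  \<open>ev (pderiv F) X * velX u = V * velV v\<close>. Together with the equation itself this lets
  the two summands of \<open>eigen\<close> combine through \<open>ev_bezout\<close>. The conclusions
  are the statement that the lift multiplies the invariant derivation by
  \<open>p * eigen u v\<close>, checked on \<open>x\<close> and on \<open>y\<close>.\<close>

lemma eigen:
  assumes u: "u \<in> LX" and v: "v \<in> LX" and
    cg: "LX.cg (p ^ (n + 2)) (ev F (x ^ p + of_nat p * u)) (F * (F ^ m + of_nat p * v) ^ 2)"
  shows "LX.cg (p ^ Suc n) (eigen u v * (F ^ m + of_nat p * v)) (velX u)"
    and "LX.cg (p ^ Suc n) (eigen u v * ev (pderiv F) (x ^ p + of_nat p * u)) (velV v)"
proof -
  define X where "X = x ^ p + of_nat p * u"
  define V where "V = F ^ m + of_nat p * v"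
  have XV: "X \<in> LX" "V \<in> LX" using u v by (auto simp: X_def V_def)
  have cg': "LX.cg (p ^ (n + 2)) (ev F X) (F * V ^ 2)"
    using cg by (simp add: X_def V_def)
  then have FX: "LX.cg (p ^ Suc n) (F * V ^ 2) (ev F X)"
    by (intro LX.cg_sym[OF LX.cg_le[OF cg']]) auto
  have "LX.cg (p ^ (n + 2)) (pderiv (ev F X)) (pderiv (F * V ^ 2))"
    using cg' by (rule cg_pderiv)
  moreover have "pderiv (ev F X) = of_nat (p ^ 1) * (ev (pderiv F) X * velX u)"
    unfolding pderiv_ev X_def pderiv_X by (simp add: algebra_simps)
  moreover have "pderiv (F * V ^ 2) = V * (2 * pderiv V * F + V * pderiv F)"
    by (simp add: pderiv_mult power2_eq_square algebra_simps)
  moreover have "\<dots> = of_nat (p ^ 1) * (V * velV v)"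
    unfolding V_def pderiv_V by (simp add: algebra_simps)
  ultimately have "LX.cg (p ^ (1 + Suc n)) (of_nat (p ^ 1) * (ev (pderiv F) X * velX u))
      (of_nat (p ^ 1) * (V * velV v))"
    by simp
  then have vel: "LX.cg (p ^ Suc n) (ev (pderiv F) X * velX u) (V * velV v)"
    by (rule cg_cancel)
  have "eigen u v * V = ev r X * velX u * (F * V ^ 2) + ev s X * (V * velV v)"
    unfolding eigen_def X_def[symmetric] V_def[symmetric] by (simp add: algebra_simps power2_eq_square)
  also have "LX.cg (p ^ Suc n) \<dots> (ev r X * velX u * ev F X + ev s X * (ev (pderiv F) X * velX u))"
    using FX LX.cg_sym[OF vel] u v XV by (intro LX.cg_add LX.cg_mult_left) auto
  also have "\<dots> = (ev r X * ev F X + ev s X * ev (pderiv F) X) * velX u"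
    by (simp add: algebra_simps)
  finally show "LX.cg (p ^ Suc n) (eigen u v * (F ^ m + of_nat p * v)) (velX u)"
    unfolding ev_bezout V_def by simp
  have "eigen u v * ev (pderiv F) X =
      ev r X * V * F * (ev (pderiv F) X * velX u) + ev s X * ev (pderiv F) X * velV v"
    unfolding eigen_def X_def[symmetric] V_def[symmetric] by (simp add: algebra_simps power2_eq_square)
  also have "LX.cg (p ^ Suc n) \<dots> (ev r X * V * F * (V * velV v) + ev s X * ev (pderiv F) X * velV v)"
    using vel u v XV by (intro LX.cg_add LX.cg_mult_left) auto
  also have "\<dots> = ev r X * velV v * (F * V ^ 2) + ev s X * ev (pderiv F) X * velV v"
    by (simp add: algebra_simps power2_eq_square)
  also have "LX.cg (p ^ Suc n) \<dots> (ev r X * velV v * ev F X + ev s X * ev (pderiv F) X * velV v)"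
    using FX u v XV by (intro LX.cg_add LX.cg_mult_left) auto
  also have "\<dots> = (ev r X * ev F X + ev s X * ev (pderiv F) X) * velV v"
    by (simp add: algebra_simps)
  finally show "LX.cg (p ^ Suc n) (eigen u v * ev (pderiv F) (x ^ p + of_nat p * u)) (velV v)"
    unfolding ev_bezout X_def by simp
qed

text \<open>Modulo \<open>p\<close> the factor \<open>V\<close> is the monic polynomial
  \<open>F ^ m\<close>, which can be cancelled.\<close>

lemma eigen_mod_p:
  assumes u: "u \<in> LX" and v: "v \<in> LX" and
    cg: "LX.cg (p ^ (n + 2)) (ev F (x ^ p + of_nat p * u)) (F * (F ^ m + of_nat p * v) ^ 2)"
    and vel: "LX.cg p (velX u) ([:h:] * F ^ m)"
  shows "LX.cg p (eigen u v) [:h:]"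
proof -
  have "LX.cg p (F ^ m) (F ^ m + of_nat p * v)"
    using v by (intro LX.cg_sym[OF LX.cgI]) auto
  then have "LX.cg p (eigen u v * F ^ m) (eigen u v * (F ^ m + of_nat p * v))"
    using u v by (intro LX.cg_mult_left) auto
  also have "LX.cg p \<dots> (velX u)"
    using LX.cg_dvd[OF eigen(1)[OF u v cg], of p] by simp
  also note vel
  finally have "LX.cg p (eigen u v * F ^ m - [:h:] * F ^ m) ([:h:] * F ^ m - [:h:] * F ^ m)"
    by (intro LX.cg_diff) auto
  then have "LX.cg p (F ^ m * (eigen u v - [:h:])) 0"
    by (simp add: algebra_simps)
  moreover have "eigen u v - [:h:] \<in> LX" using u v h_mem by auto
  ultimately have "LX.cg p (eigen u v - [:h:]) 0"
    by (rule_tac monic_cancel[OF F_pow_monic[of m], where T = 0]) auto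
  then have "LX.cg p (eigen u v - [:h:] + [:h:]) (0 + [:h:])"
    by (rule LX.cg_add) (rule LX.cg_refl)
  then show ?thesis by (simp only: diff_add_cancel add_0)
qed

lemma eigen_cong:
  assumes u: "u \<in> LX" "u' \<in> LX" and v: "v \<in> LX" "v' \<in> LX"
    and cg: "LX.cg q u u'" "LX.cg q v v'"
  shows "LX.cg q (eigen u v) (eigen u' v')"
proof -
  have "LX.cg q (velX u) (velX u')" "LX.cg q (velV v) (velV v')"
    unfolding velX_def velV_def using u v
    by (auto intro!: LX.cg_add LX.cg_mult cg_pderiv cg)
  moreover have "LX.cg q (x ^ p + of_nat p * u) (x ^ p + of_nat p * u')"
      "LX.cg q (F ^ m + of_nat p * v) (F ^ m + of_nat p * v')"
    using u v by (auto intro!: LX.cg_add LX.cg_mult cg)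
  moreover from this have "LX.cg q (ev P (x ^ p + of_nat p * u)) (ev P (x ^ p + of_nat p * u'))"
      if "P \<in> LX" for P
    using u that by (intro ev_cg_right) auto
  ultimately show ?thesis
    unfolding eigen_def using u v
    by (intro LX.cg_add[OF LX.cg_mult[OF _ _ LX.cg_mult[OF _ _ LX.cg_mult]] LX.cg_mult]) auto
qed

lemma frobenius_data:
  obtains u v :: "nat \<Rightarrow> 'k poly" where
    "\<And>n. u n \<in> LX" "\<And>n. v n \<in> LX"
    "\<And>n. LX.cg (p ^ n) (u (Suc n)) (u n)" "\<And>n. LX.cg (p ^ n) (v (Suc n)) (v n)"
    "\<And>n. LX.cg (p ^ (n + 2)) (ev F (x ^ p + of_nat p * u n)) (F * (F ^ m + of_nat p * v n) ^ 2)"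
    "\<And>n. LX.cg p (eigen (u n) (v n)) [:h:]"
proof -
  obtain u0 v0 where uv0: "u0 \<in> LX" "v0 \<in> LX"
    "LX.cg (p ^ 2) (ev F (x ^ p + of_nat p * u0)) (F * (F ^ m + of_nat p * v0) ^ 2)"
    "LX.cg p (x ^ (p - 1) + pderiv u0) ([:h:] * F ^ m)"
    by (rule first_solution)
  define P where "P = (\<lambda>n (u, v). u \<in> LX \<and> v \<in> LX \<and>
    LX.cg (p ^ (n + 2)) (ev F (x ^ p + of_nat p * u)) (F * (F ^ m + of_nat p * v) ^ 2) \<and>
    LX.cg p (velX u) ([:h:] * F ^ m))"
  define Q where "Q = (\<lambda>n (u, v) (u', v'). LX.cg (p ^ Suc n) u' u \<and> LX.cg (p ^ Suc n) v' v)"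
  have "\<exists>f. \<forall>n. P n (f n) \<and> Q n (f n) (f (Suc n))"
  proof (rule dependent_nat_choice)
    show "\<exists>w. P 0 w" using uv0 by (intro exI[of _ "(u0, v0)"]) (auto simp: P_def velX_def numeral_2_eq_2)
  next
    fix w n assume "P n w"
    then obtain u v where w: "w = (u, v)" and uv: "u \<in> LX" "v \<in> LX"
      "LX.cg (p ^ (n + 2)) (ev F (x ^ p + of_nat p * u)) (F * (F ^ m + of_nat p * v) ^ 2)"
      "LX.cg p (velX u) ([:h:] * F ^ m)"
      by (auto simp: P_def)
    obtain u' v' where uv': "u' \<in> LX" "v' \<in> LX" "LX.cg (p ^ Suc n) u' u" "LX.cg (p ^ Suc n) v' v"
      "LX.cg (p ^ (Suc n + 2)) (ev F (x ^ p + of_nat p * u')) (F * (F ^ m + of_nat p * v') ^ 2)"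
      using hensel_step[OF uv(1-3)] by blast
    \<comment> \<open>Already the first Hensel correction is divisible by \<open>p\<close>, so the
      condition on \<open>velX\<close> persists.\<close>
    have "LX.cg p u' u" by (rule LX.cg_dvd[OF uv'(3)]) simp
    then have "LX.cg p (velX u') (velX u)"
      unfolding velX_def by (intro LX.cg_add cg_pderiv) auto
    then have "LX.cg p (velX u') ([:h:] * F ^ m)" using uv(4) by (rule LX.cg_trans)
    then show "\<exists>w'. P (Suc n) w' \<and> Q n w w'"
      using uv' by (intro exI[of _ "(u', v')"]) (auto simp: P_def Q_def w)
  qed
  then obtain f where f: "\<And>n. P n (f n)" "\<And>n. Q n (f n) (f (Suc n))" by blast
  have 1: "fst (f n) \<in> LX" "snd (f n) \<in> LX"
    "LX.cg (p ^ (n + 2)) (ev F (x ^ p + of_nat p * fst (f n))) (F * (F ^ m + of_nat p * snd (f n)) ^ 2)"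
    "LX.cg p (velX (fst (f n))) ([:h:] * F ^ m)" for n
    using f(1)[of n] by (auto simp: P_def split: prod.splits)
  have 2: "LX.cg (p ^ n) (fst (f (Suc n))) (fst (f n))" "LX.cg (p ^ n) (snd (f (Suc n))) (snd (f n))" for n
    using f(2)[of n] LX.cg_le[of p "Suc n" _ _ n] by (auto simp: Q_def split: prod.splits)
  show ?thesis
    using 1 2 eigen_mod_p[OF 1(1,2,3,4)] by (rule_tac that[of "\<lambda>n. fst (f n)" "\<lambda>n. snd (f n)"]) auto
qed

end

section \<open>Completions presented by a subring of a commutative ring type\<close>

lemma (in cring) mem_ppow_ideal: "a \<in> ppow_ideal p R n \<longleftrightarrow> (\<exists>c\<in>carrier R. a = [(p ^ n)] \<cdot> c)"
proof -
  have "c \<otimes> [(p ^ n)] \<cdot> \<one> = [(p ^ n)] \<cdot> c" if "c \<in> carrier R" for c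
    using that by (simp add: add_pow_rdistr)
  then have "{c \<otimes> [(p ^ n)] \<cdot> \<one> | c. c \<in> carrier R} = {[(p ^ n)] \<cdot> c | c. c \<in> carrier R}"
    by (intro Collect_cong) metis
  then show ?thesis unfolding ppow_ideal_def cgenideal_def by (simp only:) blast
qed

lemma (in cring) ppow_ideal_ideal: "ideal (ppow_ideal p R n) R"
  unfolding ppow_ideal_def by (intro cgenideal_ideal) auto

lemma (in cring) ppow_proj_coset:
  assumes a: "a \<in> carrier R"
  shows "ppow_proj p R n (ppow_ideal p R (Suc n) +> a) = ppow_ideal p R n +> a"
proof -
  interpret I: ideal "ppow_ideal p R n" R by (rule ppow_ideal_ideal)
  interpret J: ideal "ppow_ideal p R (Suc n)" R by (rule ppow_ideal_ideal)
  have JI: "j \<in> ppow_ideal p R n" if j: "j \<in> ppow_ideal p R (Suc n)" for j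
  proof -
    obtain c where c: "c \<in> carrier R" "j = [(p ^ Suc n)] \<cdot> c" using j unfolding mem_ppow_ideal by blast
    have "[(p ^ n)] \<cdot> ([p] \<cdot> c) = [(p * p ^ n)] \<cdot> c" by (rule add.nat_pow_pow[OF c(1)])
    then have "j = [(p ^ n)] \<cdot> ([p] \<cdot> c)" using c(2) by simp
    then show ?thesis using add.nat_pow_closed[OF c(1), of p] unfolding mem_ppow_ideal by blast
  qed
  show ?thesis
  proof
    show "ppow_proj p R n (ppow_ideal p R (Suc n) +> a) \<subseteq> ppow_ideal p R n +> a"
    proof
      fix y assume "y \<in> ppow_proj p R n (ppow_ideal p R (Suc n) +> a)"
      then obtain i j where ij: "i \<in> ppow_ideal p R n" "j \<in> ppow_ideal p R (Suc n)" "y = i \<oplus> (j \<oplus> a)"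
        unfolding ppow_proj_def set_add_def' a_r_coset_def' by blast
      then have "y = (i \<oplus> j) \<oplus> a"
        using a_assoc[OF I.a_Hcarr[OF ij(1)] J.a_Hcarr[OF ij(2)] a] by simp
      then show "y \<in> ppow_ideal p R n +> a"
        unfolding a_r_coset_def' using I.a_closed[OF ij(1) JI[OF ij(2)]] by blast
    qed
    show "ppow_ideal p R n +> a \<subseteq> ppow_proj p R n (ppow_ideal p R (Suc n) +> a)"
    proof
      fix y assume "y \<in> ppow_ideal p R n +> a"
      then obtain i where "i \<in> ppow_ideal p R n" "y = i \<oplus> a" unfolding a_r_coset_def' by blast
      moreover have "\<zero> \<oplus> a = a" using a by simp
      moreover have "\<zero> \<oplus> a \<in> ppow_ideal p R (Suc n) +> a"
        using J.zero_closed unfolding a_r_coset_def' by blast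
      ultimately have "y = i \<oplus> (\<zero> \<oplus> a)" "\<zero> \<oplus> a \<in> ppow_ideal p R (Suc n) +> a" "i \<in> ppow_ideal p R n"
        by simp_all
      then show "y \<in> ppow_proj p R n (ppow_ideal p R (Suc n) +> a)"
        unfolding ppow_proj_def set_add_def' by blast
    qed
  qed
qed

text \<open>\<open>\<pi> n\<close> identifies \<open>B / p ^ n B\<close> with
  \<open>A / p ^ n A\<close> level by level, and no map between \<open>B\<close> and
  \<open>A\<close> is asked for. Two situations have to fit: for the base \<open>B\<close> contains
  \<open>A\<close>, for the curve \<open>B\<close> maps into \<open>A\<close>.\<close>

locale presentation = subring_set B + A: cring A
  for B :: "'b :: comm_ring_1 set" and A :: "('a, 'm) ring_scheme" (structure) +
  fixes p :: nat and \<pi> :: "nat \<Rightarrow> 'b \<Rightarrow> 'a set"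
  assumes pi_surj: "carrier (mod_ppow p A n) = \<pi> n ` B"
    and pi_add: "a \<in> B \<Longrightarrow> b \<in> B \<Longrightarrow> \<pi> n (a + b) = \<pi> n a \<oplus>\<^bsub>mod_ppow p A n\<^esub> \<pi> n b"
    and pi_mult: "a \<in> B \<Longrightarrow> b \<in> B \<Longrightarrow> \<pi> n (a * b) = \<pi> n a \<otimes>\<^bsub>mod_ppow p A n\<^esub> \<pi> n b"
    and pi_one: "\<pi> n 1 = \<one>\<^bsub>mod_ppow p A n\<^esub>"
    and pi_eq: "a \<in> B \<Longrightarrow> b \<in> B \<Longrightarrow> \<pi> n a = \<pi> n b \<longleftrightarrow> cg (p ^ n) a b"
    and pi_proj: "b \<in> B \<Longrightarrow> ppow_proj p A n (\<pi> (Suc n) b) = \<pi> n b"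
    and p_torsion_free: "of_nat p * a = of_nat p * (b :: 'b) \<Longrightarrow> a = b"
begin

section \<open>Elements of the completion as limits of coherent sequences\<close>

abbreviation C where "C \<equiv> padic_completion p A"

lemma level_cring: "cring (mod_ppow p A n)"
  by (rule ideal.quotient_is_cring[OF A.ppow_ideal_ideal A.is_cring])

lemma pi_closed [simp, intro]: "b \<in> B \<Longrightarrow> \<pi> n b \<in> carrier (mod_ppow p A n)"
  using pi_surj by auto

lemma pi_zero: "\<pi> n 0 = \<zero>\<^bsub>mod_ppow p A n\<^esub>"
proof -
  interpret R: cring "mod_ppow p A n" by (rule level_cring)
  show ?thesis using pi_add[of 0 0 n]
    by (metis R.add.l_cancel_one' add_0 pi_closed zero_mem)
qed

definition coherent :: "(nat \<Rightarrow> 'b) \<Rightarrow> bool" where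
  "coherent b \<longleftrightarrow> (\<forall>n. b n \<in> B \<and> cg (p ^ n) (b (Suc n)) (b n))"

definition lim :: "(nat \<Rightarrow> 'b) \<Rightarrow> nat \<Rightarrow> 'a set" where
  "lim b = (\<lambda>n. \<pi> n (b n))"

lemma coherentD: "coherent b \<Longrightarrow> b n \<in> B" "coherent b \<Longrightarrow> cg (p ^ n) (b (Suc n)) (b n)"
  by (auto simp: coherent_def)

lemma coherent_const [simp, intro]: "b \<in> B \<Longrightarrow> coherent (\<lambda>_. b)"
  by (auto simp: coherent_def)

lemma coherent_ops [simp, intro]:
  assumes "coherent b" "coherent c"
  shows "coherent (\<lambda>n. b n + c n)" "coherent (\<lambda>n. b n * c n)" "coherent (\<lambda>n. - b n)"
    "coherent (\<lambda>n. b n - c n)"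
  using assms by (auto simp: coherent_def intro: cg_add cg_mult cg_uminus cg_diff)

lemma coherent_le: assumes "coherent b" "n \<le> k" shows "cg (p ^ n) (b k) (b n)"
  using assms(2)
proof (induction k rule: dec_induct)
  case (step k)
  have "cg (p ^ n) (b (Suc k)) (b k)"
    using coherentD(2)[OF \<open>coherent b\<close>, of k] step.hyps by (intro cg_le[of p k _ _ n]) auto
  then show ?case using step.IH by (rule cg_trans)
qed simp

lemma lim_closed [simp, intro]: "coherent b \<Longrightarrow> lim b \<in> carrier C"
  unfolding padic_completion_def lim_def
  by (auto simp: coherent_def pi_proj pi_eq)

lemma lim_exhaust:
  assumes "f \<in> carrier C" obtains b where "coherent b" "f = lim b"
proof -
  have f: "f n \<in> \<pi> n ` B" "ppow_proj p A n (f (Suc n)) = f n" for n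
    using assms unfolding padic_completion_def pi_surj by auto
  then have "\<forall>n. \<exists>b. b \<in> B \<and> f n = \<pi> n b" by blast
  then obtain b where b: "\<And>n. b n \<in> B" "\<And>n. f n = \<pi> n (b n)" by metis
  have "\<pi> n (b (Suc n)) = \<pi> n (b n)" for n
    using f(2)[of n] b by (simp add: pi_proj)
  then have "coherent b" using b by (auto simp: coherent_def pi_eq)
  moreover have "f = lim b" using b by (auto simp: lim_def)
  ultimately show ?thesis using that by blast
qed

lemma lim_eq: "coherent b \<Longrightarrow> coherent c \<Longrightarrow> lim b = lim c \<longleftrightarrow> (\<forall>n. cg (p ^ n) (b n) (c n))"
  by (auto simp: lim_def fun_eq_iff pi_eq coherentD)

lemma lim_add: "coherent b \<Longrightarrow> coherent c \<Longrightarrow> lim b \<oplus>\<^bsub>C\<^esub> lim c = lim (\<lambda>n. b n + c n)"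
  by (auto simp: lim_def padic_completion_def pi_add coherentD)

lemma lim_mult: "coherent b \<Longrightarrow> coherent c \<Longrightarrow> lim b \<otimes>\<^bsub>C\<^esub> lim c = lim (\<lambda>n. b n * c n)"
  by (auto simp: lim_def padic_completion_def pi_mult coherentD)

lemma lim_one: "\<one>\<^bsub>C\<^esub> = lim (\<lambda>_. 1)"
  by (auto simp: lim_def padic_completion_def pi_one)

lemma lim_zero: "\<zero>\<^bsub>C\<^esub> = lim (\<lambda>_. 0)"
  by (auto simp: lim_def padic_completion_def pi_zero)

lemma completion_cring: "cring C"
proof (rule cringI[OF abelian_groupI comm_monoidI])
  fix f assume "f \<in> carrier C"
  then obtain b where b: "coherent b" "f = lim b" by (rule lim_exhaust)
  then have "lim (\<lambda>n. - b n) \<oplus>\<^bsub>C\<^esub> f = \<zero>\<^bsub>C\<^esub>"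
    by (simp add: lim_add lim_zero)
  then show "\<exists>g\<in>carrier C. g \<oplus>\<^bsub>C\<^esub> f = \<zero>\<^bsub>C\<^esub>" using b by blast
qed (auto elim!: lim_exhaust simp: lim_add lim_mult lim_one lim_zero algebra_simps)

sublocale C: cring C
  by (rule completion_cring)

lemma lim_uminus: "coherent b \<Longrightarrow> \<ominus>\<^bsub>C\<^esub> lim b = lim (\<lambda>n. - b n)"
  by (rule C.minus_equality) (auto simp: lim_add lim_zero)

lemma lim_minus: "coherent b \<Longrightarrow> coherent c \<Longrightarrow> lim b \<ominus>\<^bsub>C\<^esub> lim c = lim (\<lambda>n. b n - c n)"
  by (simp add: a_minus_def lim_uminus lim_add)

lemma coherent_power [simp, intro]: "coherent b \<Longrightarrow> coherent (\<lambda>n. b n ^ k)"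
  by (induction k) auto

lemma lim_power: "coherent b \<Longrightarrow> lim b [^]\<^bsub>C\<^esub> k = lim (\<lambda>n. b n ^ k)"
  by (induction k) (auto simp: lim_one lim_mult mult.commute)

lemma coherent_of_nat [simp, intro]: "coherent b \<Longrightarrow> coherent (\<lambda>n. of_nat k * b n)"
  using coherent_ops(2)[of "\<lambda>_. of_nat k" b] by auto

lemma lim_add_pow: "coherent b \<Longrightarrow> [k] \<cdot>\<^bsub>C\<^esub> lim b = lim (\<lambda>n. of_nat k * b n)" for k :: nat
proof (induction k)
  case 0
  then show ?case by (simp add: lim_zero)
next
  case (Suc k)
  then show ?case by (simp add: lim_add algebra_simps)
qed

text \<open>The quotient is the sequence \<open>b (k + n) / p ^ k\<close>: dividing costs
  \<open>k\<close> levels of precision, so the index is shifted. The condition on \<open>b k\<close>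
  suffices because later terms agree with it modulo \<open>p ^ k\<close>.\<close>

lemma divide_by_ppow:
  assumes b: "coherent b" and cg: "cg (p ^ k) (b k) 0"
  shows "\<exists>c. coherent c \<and> lim b = [(p ^ k)] \<cdot>\<^bsub>C\<^esub> lim c"
proof -
  have cancel: "of_nat (p ^ k) * u = of_nat (p ^ k) * v \<Longrightarrow> u = v" for u v :: 'b
    by (induction k) (auto simp: mult.assoc intro: p_torsion_free)
  have "\<exists>c\<in>B. b (k + n) = of_nat (p ^ k) * c" for n
  proof -
    have "cg (p ^ k) (b (k + n)) 0" using coherent_le[OF b, of k "k + n"] cg by (meson cg_trans le_add1)
    then show ?thesis by (elim cgE) (metis add_0)
  qed
  then obtain c where c: "\<And>n. c n \<in> B" "\<And>n. b (k + n) = of_nat (p ^ k) * c n" by metis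
  have "cg (p ^ n) (c (Suc n)) (c n)" for n
  proof -
    obtain d where d: "d \<in> B" "b (k + Suc n) = b (k + n) + of_nat (p ^ (k + n)) * d"
      using coherentD(2)[OF b, of "k + n"] by (auto elim: cgE)
    then have "of_nat (p ^ k) * c (Suc n) = of_nat (p ^ k) * (c n + of_nat (p ^ n) * d)"
      unfolding c by (simp add: algebra_simps power_add)
    then have "c (Suc n) = c n + of_nat (p ^ n) * d" by (rule cancel)
    then show ?thesis using d by (auto intro: cgI)
  qed
  then have coh: "coherent c" using c by (auto simp: coherent_def)
  have "cg (p ^ n) (b n) (of_nat (p ^ k) * c n)" for n
    using coherent_le[OF b, of n "k + n"] unfolding c by (auto intro: cg_sym)
  then have "lim b = lim (\<lambda>n. of_nat (p ^ k) * c n)"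
    using b coh by (subst lim_eq) auto
  then show ?thesis using coh by (auto simp: lim_add_pow simp del: of_nat_power)
qed

lemma mem_ppow_ideal_completion:
  assumes b: "coherent b" and cg: "cg (p ^ k) (b k) 0"
  shows "lim b \<in> ppow_ideal p C k"
proof -
  obtain c where c: "coherent c" "lim b = [(p ^ k)] \<cdot>\<^bsub>C\<^esub> lim c"
    using divide_by_ppow[OF assms] by blast
  have "[(p ^ k)] \<cdot>\<^bsub>C\<^esub> lim c = lim c \<otimes>\<^bsub>C\<^esub> ([(p ^ k)] \<cdot>\<^bsub>C\<^esub> \<one>\<^bsub>C\<^esub>)"
    using c(1) by (simp add: C.add_pow_rdistr)
  then show ?thesis using c(1) unfolding c(2) ppow_ideal_def cgenideal_def
    by (intro CollectI exI[of _ "lim c"]) auto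
qed

text \<open>Each \<open>\<Psi> n\<close> has to be a homomorphism modulo \<open>p ^ n\<close> only:
  on the curve it is built from an approximate solution of the equation, and its multiplicativity is
  known only to that precision.\<close>

definition hom_family :: "(nat \<Rightarrow> 'b \<Rightarrow> 'b) \<Rightarrow> bool" where
  "hom_family \<Psi> \<longleftrightarrow> (\<forall>n. \<forall>b\<in>B. \<Psi> n b \<in> B \<and> cg (p ^ n) (\<Psi> (Suc n) b) (\<Psi> n b) \<and>
     (\<forall>c\<in>B. cg (p ^ n) (\<Psi> n (b + c)) (\<Psi> n b + \<Psi> n c) \<and>
       cg (p ^ n) (\<Psi> n (b * c)) (\<Psi> n b * \<Psi> n c) \<and>
       (cg (p ^ n) b c \<longrightarrow> cg (p ^ n) (\<Psi> n b) (\<Psi> n c))) \<and> cg (p ^ n) (\<Psi> n 1) 1)"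

definition lim_map :: "(nat \<Rightarrow> 'b \<Rightarrow> 'b) \<Rightarrow> (nat \<Rightarrow> 'a set) \<Rightarrow> nat \<Rightarrow> 'a set" where
  "lim_map \<Psi> f = (\<lambda>n. \<pi> n (\<Psi> n (SOME b. b \<in> B \<and> \<pi> n b = f n)))"

lemma lim_map_level:
  assumes \<Psi>: "hom_family \<Psi>" and b: "b \<in> B" "f n = \<pi> n b"
  shows "lim_map \<Psi> f n = \<pi> n (\<Psi> n b)"
proof -
  define c where "c = (SOME b. b \<in> B \<and> \<pi> n b = f n)"
  have "c \<in> B \<and> \<pi> n c = f n" unfolding c_def by (rule someI[of _ b]) (use b in auto)
  then have c: "c \<in> B" "cg (p ^ n) c b" using b by (auto simp: pi_eq)
  then have "cg (p ^ n) (\<Psi> n c) (\<Psi> n b)" using \<Psi> b unfolding hom_family_def by blast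
  then show ?thesis unfolding lim_map_def c_def[symmetric]
    using \<Psi> b c by (subst pi_eq) (auto simp: hom_family_def)
qed

lemma lim_map_lim:
  assumes "hom_family \<Psi>" "coherent b"
  shows "lim_map \<Psi> (lim b) = lim (\<lambda>n. \<Psi> n (b n))"
proof
  show "lim_map \<Psi> (lim b) n = lim (\<lambda>n. \<Psi> n (b n)) n" for n
    using lim_map_level[OF assms(1), of "b n" "lim b" n] coherentD(1)[OF assms(2)] by (simp add: lim_def)
qed

lemma coherent_map:
  assumes \<Psi>: "hom_family \<Psi>" and b: "coherent b"
  shows "coherent (\<lambda>n. \<Psi> n (b n))"
proof -
  have "cg (p ^ n) (\<Psi> (Suc n) (b (Suc n))) (\<Psi> n (b n))" for n
    using \<Psi> coherentD[OF b] unfolding hom_family_def by (meson cg_trans)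
  then show ?thesis using assms by (auto simp: coherent_def hom_family_def)
qed

lemma lim_map_hom: assumes \<Psi>: "hom_family \<Psi>" shows "lim_map \<Psi> \<in> ring_hom C C"
proof (rule ring_hom_memI)
  fix f assume "f \<in> carrier C"
  then obtain b where b: "coherent b" "f = lim b" by (rule lim_exhaust)
  then show "lim_map \<Psi> f \<in> carrier C" by (simp add: lim_map_lim[OF \<Psi>] coherent_map[OF \<Psi>])
  fix g assume "g \<in> carrier C"
  then obtain c where c: "coherent c" "g = lim c" by (rule lim_exhaust)
  note coh = coherent_map[OF \<Psi> b(1)] coherent_map[OF \<Psi> c(1)]
  have B: "b n \<in> B" "c n \<in> B" for n using b c coherentD by auto
  have "lim (\<lambda>n. \<Psi> n (b n * c n)) = lim (\<lambda>n. \<Psi> n (b n) * \<Psi> n (c n))"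
    using coherent_map[OF \<Psi>, of "\<lambda>n. b n * c n"] b c coh
    by (subst lim_eq) (use \<Psi> B in \<open>auto simp: hom_family_def\<close>)
  then show "lim_map \<Psi> (f \<otimes>\<^bsub>C\<^esub> g) = lim_map \<Psi> f \<otimes>\<^bsub>C\<^esub> lim_map \<Psi> g"
    unfolding b(2) c(2) using coh b(1) c(1) by (simp add: lim_mult lim_map_lim[OF \<Psi>])
  have "lim (\<lambda>n. \<Psi> n (b n + c n)) = lim (\<lambda>n. \<Psi> n (b n) + \<Psi> n (c n))"
    using coherent_map[OF \<Psi>, of "\<lambda>n. b n + c n"] b c coh
    by (subst lim_eq) (use \<Psi> B in \<open>auto simp: hom_family_def\<close>)
  then show "lim_map \<Psi> (f \<oplus>\<^bsub>C\<^esub> g) = lim_map \<Psi> f \<oplus>\<^bsub>C\<^esub> lim_map \<Psi> g"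
    unfolding b(2) c(2) using coh b(1) c(1) by (simp add: lim_add lim_map_lim[OF \<Psi>])
next
  have "coherent (\<lambda>n. \<Psi> n 1)" using coherent_map[OF \<Psi>, of "\<lambda>_. 1"] by auto
  then show "lim_map \<Psi> \<one>\<^bsub>C\<^esub> = \<one>\<^bsub>C\<^esub>"
    using \<Psi> zero_mem by (simp add: lim_one lim_map_lim lim_eq) (auto simp: hom_family_def)
qed

text \<open>A ring endomorphism of the completion is automatically \<open>p\<close>-adically continuous.\<close>

lemma hom_level_cong:
  assumes h: "h \<in> ring_hom C C" and f: "f \<in> carrier C" and g: "g \<in> carrier C" and eq: "f n = g n"
  shows "h f n = h g n"
proof -
  obtain b where b: "coherent b" "f = lim b" using f by (rule lim_exhaust)
  obtain c where c: "coherent c" "g = lim c" using g by (rule lim_exhaust)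
  have "cg (p ^ n) (b n) (c n)" using eq b c by (simp add: lim_def pi_eq coherentD)
  then have "cg (p ^ n) (b n - c n) (c n - c n)" by (intro cg_diff) auto
  then obtain d where d: "coherent d" "lim (\<lambda>n. b n - c n) = [(p ^ n)] \<cdot>\<^bsub>C\<^esub> lim d"
    using divide_by_ppow[of "\<lambda>n. b n - c n" n] b c by auto
  interpret h: ring_hom_ring C C h
    using h C.is_cring by (simp add: ring_hom_ringI2 C.ring_axioms)
  have hd: "h (lim d) \<in> carrier C" using d by auto
  then obtain e where e: "coherent e" "h (lim d) = lim e" by (rule lim_exhaust)
  obtain e' where e': "coherent e'" "h g = lim e'" using g by (meson h.hom_closed lim_exhaust)
  have add_pow: "h ([k] \<cdot>\<^bsub>C\<^esub> lim d) = [k] \<cdot>\<^bsub>C\<^esub> h (lim d)" for k :: nat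
    using d by (induction k) auto
  have "f = g \<oplus>\<^bsub>C\<^esub> [(p ^ n)] \<cdot>\<^bsub>C\<^esub> lim d"
    unfolding d(2)[symmetric] b(2) c(2) using b c by (simp add: lim_add)
  then have "h f = h g \<oplus>\<^bsub>C\<^esub> [(p ^ n)] \<cdot>\<^bsub>C\<^esub> h (lim d)"
    using g d by (simp add: add_pow)
  also have "\<dots> = lim (\<lambda>i. e' i + of_nat (p ^ n) * e i)"
    using e e' by (simp add: lim_add_pow lim_add del: of_nat_power)
  finally have "h f n = \<pi> n (e' n + of_nat (p ^ n) * e n)" by (simp add: lim_def)
  also have "\<dots> = \<pi> n (e' n)"
    using coherentD(1)[OF e(1)] coherentD(1)[OF e'(1)]
    by (subst pi_eq) (auto intro!: cgI[of "e n"])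
  finally show ?thesis using e' by (simp add: lim_def)
qed

lemma coset_eq_pi:
  assumes b: "b \<in> B" and a: "a \<in> \<pi> n b"
  shows "ppow_ideal p A n +> a = \<pi> n b" "a \<in> carrier A"
proof -
  interpret I: ideal "ppow_ideal p A n" A by (rule A.ppow_ideal_ideal)
  have "\<pi> n b \<in> a_rcosets ppow_ideal p A n"
    using pi_closed[OF b, of n] by (simp add: FactRing_def)
  then obtain a' where a': "a' \<in> carrier A" "\<pi> n b = ppow_ideal p A n +> a'"
    by (auto simp: A_RCOSETS_def')
  show "a \<in> carrier A" using a a' A.a_r_coset_subset_G[OF I.a_subset] by blast
  show "ppow_ideal p A n +> a = \<pi> n b"
    using I.a_repr_independence'[OF _ a'(1), of a] a a' by metis
qed

lemma pi_nonempty: "b \<in> B \<Longrightarrow> \<pi> n b \<noteq> {}"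
proof -
  assume b: "b \<in> B"
  interpret I: ideal "ppow_ideal p A n" A by (rule A.ppow_ideal_ideal)
  have "\<pi> n b \<in> a_rcosets ppow_ideal p A n"
    using pi_closed[OF b, of n] by (simp add: FactRing_def)
  then show ?thesis using I.a_rcos_self by (auto simp: A_RCOSETS_def')
qed

lemma completion_endo_mod_lim_map:
  assumes \<Psi>: "hom_family \<Psi>" and b: "b \<in> B"
  shows "completion_endo_mod p A (lim_map \<Psi>) n (\<pi> n b) = \<pi> n (\<Psi> n b)"
proof -
  have "lim_map \<Psi> (to_completion p A a) n = \<pi> n (\<Psi> n b)" if "a \<in> \<pi> n b" for a
    using coset_eq_pi[OF b that] by (intro lim_map_level[OF \<Psi> b]) (simp add: to_completion_def)
  then show ?thesis unfolding completion_endo_mod_def using pi_nonempty[OF b] by blast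
qed

end

section \<open>Rings with differentials free of rank one\<close>

context cring
begin

lemma free_mod_carrier_iff:
  "u \<in> carrier (free_mod R) \<longleftrightarrow>
    (\<forall>b. u b \<in> carrier R) \<and> finite {b. u b \<noteq> \<zero>} \<and> {b. u b \<noteq> \<zero>} \<subseteq> carrier R"
  by (auto simp: free_mod_def)

lemma free_mod_carrierI:
  assumes "\<And>b. u b \<in> carrier R" "finite T" "T \<subseteq> carrier R" "\<And>b. b \<notin> T \<Longrightarrow> u b = \<zero>"
  shows "u \<in> carrier (free_mod R)"
proof -
  have "{b. u b \<noteq> \<zero>} \<subseteq> T" using assms(4) by auto
  then show ?thesis using assms finite_subset[of _ T] unfolding free_mod_carrier_iff by blast
qed

lemma free_mod_closed:
  assumes u: "u \<in> carrier (free_mod R)" and v: "v \<in> carrier (free_mod R)" and a: "a \<in> carrier R"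
  shows "(\<lambda>b. u b \<oplus> v b) \<in> carrier (free_mod R)" "(\<lambda>b. a \<otimes> u b) \<in> carrier (free_mod R)"
    "(\<lambda>b. \<ominus> u b) \<in> carrier (free_mod R)"
proof -
  note uv = u[unfolded free_mod_carrier_iff] v[unfolded free_mod_carrier_iff]
  show "(\<lambda>b. u b \<oplus> v b) \<in> carrier (free_mod R)"
    by (rule free_mod_carrierI[of _ "{b. u b \<noteq> \<zero>} \<union> {b. v b \<noteq> \<zero>}"]) (use uv in auto)
  show "(\<lambda>b. a \<otimes> u b) \<in> carrier (free_mod R)"
    by (rule free_mod_carrierI[of _ "{b. u b \<noteq> \<zero>}"]) (use uv a in auto)
  show "(\<lambda>b. \<ominus> u b) \<in> carrier (free_mod R)"
    by (rule free_mod_carrierI[of _ "{b. u b \<noteq> \<zero>}"]) (use uv in auto)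
qed

lemma free_mod_ops:
  "\<zero>\<^bsub>free_mod R\<^esub> = (\<lambda>_. \<zero>)" "u \<oplus>\<^bsub>free_mod R\<^esub> v = (\<lambda>b. u b \<oplus> v b)"
  "a \<odot>\<^bsub>free_mod R\<^esub> u = (\<lambda>b. a \<otimes> u b)"
  by (auto simp: free_mod_def)

lemma free_mod_module: "module R (free_mod R)"
proof (rule moduleI[OF cring_axioms abelian_groupI])
  show "\<exists>v\<in>carrier (free_mod R). v \<oplus>\<^bsub>free_mod R\<^esub> u = \<zero>\<^bsub>free_mod R\<^esub>"
    if "u \<in> carrier (free_mod R)" for u
    using free_mod_closed(3)[OF that that zero_closed] that
    by (intro bexI[of _ "\<lambda>b. \<ominus> u b"]) (auto simp: free_mod_ops free_mod_carrier_iff l_neg)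
  show "\<zero>\<^bsub>free_mod R\<^esub> \<in> carrier (free_mod R)"
    by (auto simp: free_mod_ops free_mod_carrier_iff)
  show "u \<oplus>\<^bsub>free_mod R\<^esub> v \<in> carrier (free_mod R)"
    if "u \<in> carrier (free_mod R)" "v \<in> carrier (free_mod R)" for u v
    unfolding free_mod_ops using free_mod_closed(1)[OF that zero_closed] .
  show "a \<odot>\<^bsub>free_mod R\<^esub> u \<in> carrier (free_mod R)"
    if "a \<in> carrier R" "u \<in> carrier (free_mod R)" for a u
    unfolding free_mod_ops using free_mod_closed(2)[OF that(2,2,1)] .
qed (auto simp: free_mod_ops free_mod_carrier_iff a_ac m_ac l_distr r_distr)

lemma free_gen_closed: "b \<in> carrier R \<Longrightarrow> free_gen R b \<in> carrier (free_mod R)"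
  by (auto simp: free_mod_carrier_iff free_gen_def)

lemma free_mod_induct [consumes 1, case_names zero step]:
  assumes u: "u \<in> carrier (free_mod R)"
    and zero: "P (\<zero>\<^bsub>free_mod R\<^esub>)"
    and step: "\<And>u a b. u \<in> carrier (free_mod R) \<Longrightarrow> a \<in> carrier R \<Longrightarrow> b \<in> carrier R \<Longrightarrow> P u \<Longrightarrow>
      P (u \<oplus>\<^bsub>free_mod R\<^esub> a \<odot>\<^bsub>free_mod R\<^esub> free_gen R b)"
  shows "P u"
proof -
  have "P u" if "finite S" "u \<in> carrier (free_mod R)" "{b. u b \<noteq> \<zero>} \<subseteq> S" for S u
    using that
  proof (induction S arbitrary: u rule: finite_induct)
    case empty
    then have "u = \<zero>\<^bsub>free_mod R\<^esub>" by (auto simp: free_mod_ops)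
    then show ?case using zero by simp
  next
    case (insert b S)
    show ?case
    proof (cases "u b = \<zero>")
      case True
      then show ?thesis using insert by (intro insert.IH) auto
    next
      case False
      then have b: "b \<in> carrier R" using insert.prems by (auto simp: free_mod_carrier_iff)
      define v where "v = u(b := \<zero>)"
      have v: "v \<in> carrier (free_mod R)"
        using insert.prems(1)[unfolded free_mod_carrier_iff]
        by (intro free_mod_carrierI[of _ "{b. u b \<noteq> \<zero>}"]) (auto simp: v_def)
      have "P v" using insert.prems by (intro insert.IH[OF v]) (auto simp: v_def)
      moreover have "u = v \<oplus>\<^bsub>free_mod R\<^esub> u b \<odot>\<^bsub>free_mod R\<^esub> free_gen R b"
        using insert.prems(1) by (auto simp: v_def free_mod_ops free_gen_def free_mod_carrier_iff fun_eq_iff)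
      ultimately show ?thesis using step[OF v _ b, of "u b"] insert.prems(1)
        by (auto simp: free_mod_carrier_iff)
    qed
  qed
  then show ?thesis using u by (auto simp: free_mod_carrier_iff)
qed

end

locale kahler_deriv = cring B for B :: "('b, 'n) ring_scheme" (structure) +
  fixes R :: "('r, 'm) ring_scheme" and g :: "'r \<Rightarrow> 'b" and D :: "'b \<Rightarrow> 'b"
  assumes D_closed [simp, intro]: "b \<in> carrier B \<Longrightarrow> D b \<in> carrier B"
    and D_add: "b \<in> carrier B \<Longrightarrow> c \<in> carrier B \<Longrightarrow> D (b \<oplus> c) = D b \<oplus> D c"
    and D_mult: "b \<in> carrier B \<Longrightarrow> c \<in> carrier B \<Longrightarrow> D (b \<otimes> c) = b \<otimes> D c \<oplus> c \<otimes> D b"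
    and g_closed: "r \<in> carrier R \<Longrightarrow> g r \<in> carrier B"
    and D_base: "r \<in> carrier R \<Longrightarrow> D (g r) = \<zero>"
begin

sublocale F: module B "free_mod B"
  by (rule free_mod_module)

abbreviation FM where "FM \<equiv> free_mod B"

text \<open>The linear extension of \<open>D\<close> to the free module, from which the map from
  differentials to \<open>B\<close> with \<open>a db \<mapsto> a D b\<close> arises.\<close>

definition Dt :: "('b \<Rightarrow> 'b) \<Rightarrow> 'b" where
  "Dt u = (\<Oplus>b\<in>{b. u b \<noteq> \<zero>}. u b \<otimes> D b)"

lemma Dt_superset:
  assumes "u \<in> carrier FM" "finite S" "{b. u b \<noteq> \<zero>} \<subseteq> S" "S \<subseteq> carrier B"
  shows "Dt u = (\<Oplus>b\<in>S. u b \<otimes> D b)"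
  unfolding Dt_def
  using assms by (intro add.finprod_mono_neutral_cong_left) (auto simp: free_mod_carrier_iff)

lemma Dt_closed [simp, intro]: "u \<in> carrier FM \<Longrightarrow> Dt u \<in> carrier B"
  unfolding Dt_def by (intro finsum_closed) (auto simp: free_mod_carrier_iff)

lemma Dt_add:
  assumes u: "u \<in> carrier FM" and v: "v \<in> carrier FM"
  shows "Dt (u \<oplus>\<^bsub>FM\<^esub> v) = Dt u \<oplus> Dt v"
proof -
  define S where "S = {b. u b \<noteq> \<zero>} \<union> {b. v b \<noteq> \<zero>}"
  have S: "finite S" "S \<subseteq> carrier B" using u v by (auto simp: S_def free_mod_carrier_iff)
  have uv: "u b \<in> carrier B" "v b \<in> carrier B" for b using u v by (auto simp: free_mod_carrier_iff)
  have "Dt (u \<oplus>\<^bsub>FM\<^esub> v) = (\<Oplus>b\<in>S. (u b \<oplus> v b) \<otimes> D b)"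
    using S F.M.a_closed[OF u v] by (subst Dt_superset[of _ S]) (auto simp: S_def free_mod_ops)
  also have "\<dots> = (\<Oplus>b\<in>S. u b \<otimes> D b \<oplus> v b \<otimes> D b)"
    using uv S by (intro finsum_cong') (auto simp: l_distr)
  also have "\<dots> = (\<Oplus>b\<in>S. u b \<otimes> D b) \<oplus> (\<Oplus>b\<in>S. v b \<otimes> D b)"
    using uv S by (intro finsum_addf) auto
  also have "\<dots> = Dt u \<oplus> Dt v"
    using u v S by (subst (1 2) Dt_superset[of _ S]) (auto simp: S_def)
  finally show ?thesis .
qed

lemma Dt_smult:
  assumes a: "a \<in> carrier B" and u: "u \<in> carrier FM"
  shows "Dt (a \<odot>\<^bsub>FM\<^esub> u) = a \<otimes> Dt u"
proof -
  define S where "S = {b. u b \<noteq> \<zero>}"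
  have S: "finite S" "S \<subseteq> carrier B" using u by (auto simp: S_def free_mod_carrier_iff)
  have u': "u b \<in> carrier B" for b using u by (auto simp: free_mod_carrier_iff)
  have "Dt (a \<odot>\<^bsub>FM\<^esub> u) = (\<Oplus>b\<in>S. (a \<otimes> u b) \<otimes> D b)"
    using S F.smult_closed[OF a u] a by (subst Dt_superset[of _ S]) (auto simp: S_def free_mod_ops)
  also have "\<dots> = (\<Oplus>b\<in>S. a \<otimes> (u b \<otimes> D b))"
    using u' S a by (intro finsum_cong') (auto simp: m_assoc)
  also have "\<dots> = a \<otimes> (\<Oplus>b\<in>S. u b \<otimes> D b)"
    using u' S a by (intro finsum_rdistr[symmetric]) auto
  finally show ?thesis by (simp add: Dt_def S_def)
qed

lemma Dt_zero: "Dt \<zero>\<^bsub>FM\<^esub> = \<zero>"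
  by (simp add: Dt_def free_mod_ops)

lemma Dt_uminus: "u \<in> carrier FM \<Longrightarrow> Dt (\<ominus>\<^bsub>FM\<^esub> u) = \<ominus> Dt u"
  using Dt_add[of "\<ominus>\<^bsub>FM\<^esub> u" u] by (intro minus_equality[symmetric]) (auto simp: F.M.l_neg Dt_zero)

lemma Dt_minus: "u \<in> carrier FM \<Longrightarrow> v \<in> carrier FM \<Longrightarrow> Dt (u \<ominus>\<^bsub>FM\<^esub> v) = Dt u \<ominus> Dt v"
  by (simp add: a_minus_def Dt_add Dt_uminus)

lemma Dt_gen: "b \<in> carrier B \<Longrightarrow> Dt (free_gen B b) = D b"
  using free_gen_closed[of b]
  by (subst Dt_superset[of _ "{b}"]) (auto simp: free_gen_def)

end

text \<open>A derivation and a differential dual to it: if every \<open>db\<close> is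
  \<open>D b\<close> times \<open>w\<close> modulo the relations, the differentials are free on the
  class of \<open>w\<close>. The condition \<open>span\<close> ranges over all submodules
  \<open>N\<close> because \<open>kahler_submod\<close> is their intersection.\<close>

locale kahler_line = kahler_deriv B R g D
  for B :: "('b, 'n) ring_scheme" (structure) and R :: "('r, 'm) ring_scheme" and g D +
  fixes w :: "'b \<Rightarrow> 'b"
  assumes w_closed [simp, intro]: "w \<in> carrier (free_mod B)"
    and Dt_w: "Dt w = \<one>"
    and span: "submodule N B (free_mod B) \<Longrightarrow> kahler_rels R B g \<subseteq> N \<Longrightarrow> b \<in> carrier B \<Longrightarrow>
      free_gen B b \<ominus>\<^bsub>free_mod B\<^esub> D b \<odot>\<^bsub>free_mod B\<^esub> w \<in> N"
begin

text \<open>The cosets of the relations turn out to be the fibres of \<open>Dt\<close>;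
  \<open>fib c\<close> is \<open>c\<close> times the class of \<open>w\<close>.\<close>

definition fib :: "'b \<Rightarrow> ('b \<Rightarrow> 'b) set" where
  "fib c = {u \<in> carrier FM. Dt u = c}"

lemma fib_zero_submodule: "submodule (fib \<zero>) B FM"
  by (rule F.submoduleI) (auto simp: fib_def Dt_zero Dt_uminus Dt_add Dt_smult)

lemma rels_subset: "kahler_rels R B g \<subseteq> fib \<zero>"
proof
  fix u assume "u \<in> kahler_rels R B g"
  then consider b c where "b \<in> carrier B" "c \<in> carrier B"
      "u = free_gen B (b \<oplus> c) \<ominus>\<^bsub>FM\<^esub> (free_gen B b \<oplus>\<^bsub>FM\<^esub> free_gen B c)"
    | b c where "b \<in> carrier B" "c \<in> carrier B"
      "u = free_gen B (b \<otimes> c) \<ominus>\<^bsub>FM\<^esub>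
         (b \<odot>\<^bsub>FM\<^esub> free_gen B c \<oplus>\<^bsub>FM\<^esub> c \<odot>\<^bsub>FM\<^esub> free_gen B b)"
    | r where "r \<in> carrier R" "u = free_gen B (g r)"
    unfolding kahler_rels_def by blast
  then show "u \<in> fib \<zero>"
  proof cases
    case 1
    then show ?thesis
      by (simp add: fib_def free_gen_closed Dt_minus Dt_add Dt_gen D_add) (simp add: a_minus_def r_neg)
  next
    case 2
    then show ?thesis
      by (simp add: fib_def free_gen_closed Dt_minus Dt_add Dt_smult Dt_gen D_mult) (simp add: a_minus_def r_neg)
  next
    case 3
    then show ?thesis by (auto simp: fib_def free_gen_closed g_closed Dt_gen D_base)
  qed
qed

lemma reduce_mod_rels:
  assumes N: "submodule N B FM" "kahler_rels R B g \<subseteq> N" and u: "u \<in> carrier FM"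
  shows "u \<ominus>\<^bsub>FM\<^esub> Dt u \<odot>\<^bsub>FM\<^esub> w \<in> N"
  using u
proof (induction rule: free_mod_induct)
  interpret N: submodule N B FM by (rule N)
  case zero
  have "\<zero>\<^bsub>FM\<^esub> \<ominus>\<^bsub>FM\<^esub> \<zero> \<odot>\<^bsub>FM\<^esub> w = \<zero>\<^bsub>FM\<^esub>" by (simp add: F.M.r_neg a_minus_def)
  then show ?case using N.one_closed unfolding Dt_zero by simp
next
  interpret N: submodule N B FM by (rule N)
  case (step u a b)
  have gen: "free_gen B b \<in> carrier FM" using step by (simp add: free_gen_closed)
  define v where "v = free_gen B b \<ominus>\<^bsub>FM\<^esub> D b \<odot>\<^bsub>FM\<^esub> w"
  have v: "v \<in> N" "v \<in> carrier FM" unfolding v_def using span[OF N, of b] step gen by auto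
  have "u \<oplus>\<^bsub>FM\<^esub> a \<odot>\<^bsub>FM\<^esub> free_gen B b \<ominus>\<^bsub>FM\<^esub>
      Dt (u \<oplus>\<^bsub>FM\<^esub> a \<odot>\<^bsub>FM\<^esub> free_gen B b) \<odot>\<^bsub>FM\<^esub> w =
      (u \<ominus>\<^bsub>FM\<^esub> Dt u \<odot>\<^bsub>FM\<^esub> w) \<oplus>\<^bsub>FM\<^esub> a \<odot>\<^bsub>FM\<^esub> v"
  proof -
    have "Dt (u \<oplus>\<^bsub>FM\<^esub> a \<odot>\<^bsub>FM\<^esub> free_gen B b) = Dt u \<oplus> a \<otimes> D b"
      using step gen by (simp add: Dt_add Dt_smult Dt_gen)
    then show ?thesis using step gen
      by (simp add: v_def a_minus_def F.smult_l_distr F.smult_r_distr F.smult_assoc1 F.M.minus_add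
          F.M.a_ac F.smult_r_minus)
  qed
  then show ?case
    using N.m_closed[OF step(4) N.smult_closed[OF step(2) v(1)]] by simp
qed

text \<open>The fibre over zero contains the relations since \<open>D\<close> is a derivation.
  Conversely, an element killed by \<open>Dt\<close> is left unchanged by the reduction in
  \<open>reduce_mod_rels\<close>, hence lies in every admissible \<open>N\<close>.\<close>

lemma kahler_submod_eq: "kahler_submod R B g = fib \<zero>"
proof
  show "kahler_submod R B g \<subseteq> fib \<zero>"
    unfolding kahler_submod_def using fib_zero_submodule rels_subset by blast
  show "fib \<zero> \<subseteq> kahler_submod R B g"
  proof
    fix u assume "u \<in> fib \<zero>"
    then have u: "u \<in> carrier FM" "Dt u = \<zero>" by (auto simp: fib_def)
    have m0: "\<ominus>\<^bsub>FM\<^esub> \<zero>\<^bsub>FM\<^esub> = \<zero>\<^bsub>FM\<^esub>" by (rule F.M.minus_equality) auto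
    have "u \<in> N" if "submodule N B FM" "kahler_rels R B g \<subseteq> N" for N
      using reduce_mod_rels[OF that u(1)] u by (simp add: a_minus_def m0)
    then show "u \<in> kahler_submod R B g" by (auto simp: kahler_submod_def)
  qed
qed

lemma fib_witness: "c \<in> carrier B \<Longrightarrow> c \<odot>\<^bsub>FM\<^esub> w \<in> fib c"
  by (simp add: fib_def Dt_smult Dt_w)

lemma fib_inj: "c \<in> carrier B \<Longrightarrow> fib c = fib d \<Longrightarrow> c = d"
proof -
  assume c: "c \<in> carrier B" and "fib c = fib d"
  then have "c \<odot>\<^bsub>FM\<^esub> w \<in> fib d" using fib_witness[OF c] by simp
  then show "c = d" using c by (simp add: fib_def Dt_smult Dt_w)
qed

text \<open>Stated for a nonempty part \<open>U\<close> of a fibre, because scalar multiplication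
  and \<open>kahler_map\<close> add the relations to an image that need not be a whole
  fibre.\<close>

lemma fib_add_subset:
  assumes "c \<in> carrier B" "d \<in> carrier B" "U \<subseteq> fib d" "U \<noteq> {}"
  shows "fib c <+>\<^bsub>FM\<^esub> U = fib (c \<oplus> d)"
proof
  show "fib c <+>\<^bsub>FM\<^esub> U \<subseteq> fib (c \<oplus> d)"
    using assms by (auto simp: set_add_def' fib_def Dt_add)
  show "fib (c \<oplus> d) \<subseteq> fib c <+>\<^bsub>FM\<^esub> U"
  proof
    fix u assume "u \<in> fib (c \<oplus> d)"
    then have u: "u \<in> carrier FM" "Dt u = c \<oplus> d" by (auto simp: fib_def)
    obtain v where v: "v \<in> U" "v \<in> carrier FM" "Dt v = d" using assms by (auto simp: fib_def)
    have "Dt (u \<ominus>\<^bsub>FM\<^esub> v) = c"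
      using u v assms(1,2) by (simp add: Dt_minus) (simp add: a_minus_def a_assoc r_neg)
    then have "u \<ominus>\<^bsub>FM\<^esub> v \<in> fib c"
      using u v by (simp add: fib_def)
    moreover have "u = (u \<ominus>\<^bsub>FM\<^esub> v) \<oplus>\<^bsub>FM\<^esub> v"
      using u v by (simp add: a_minus_def F.M.a_assoc F.M.l_neg)
    ultimately show "u \<in> fib c <+>\<^bsub>FM\<^esub> U" using v unfolding set_add_def' by blast
  qed
qed

lemma kahler_coset: "u \<in> carrier FM \<Longrightarrow> fib \<zero> +>\<^bsub>FM\<^esub> u = fib (Dt u)"
proof -
  assume u: "u \<in> carrier FM"
  have "fib \<zero> +>\<^bsub>FM\<^esub> u = fib \<zero> <+>\<^bsub>FM\<^esub> {u}"
    by (auto simp: a_r_coset_def' set_add_def')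
  also have "\<dots> = fib (\<zero> \<oplus> Dt u)"
    using u by (intro fib_add_subset) (auto simp: fib_def)
  finally show ?thesis using u by simp
qed

lemma kahler_carrier: "carrier (kahler R B g) = fib ` carrier B"
proof -
  have "carrier (kahler R B g) = (\<lambda>u. fib (Dt u)) ` carrier FM"
    unfolding kahler_def quot_module_def kahler_submod_eq A_RCOSETS_def'
    using kahler_coset by auto
  moreover have "Dt ` carrier FM = carrier B"
  proof
    show "carrier B \<subseteq> Dt ` carrier FM"
    proof
      fix c assume "c \<in> carrier B"
      then show "c \<in> Dt ` carrier FM" using fib_witness[of c]
        by (intro rev_image_eqI[of "c \<odot>\<^bsub>FM\<^esub> w"]) (auto simp: fib_def)
    qed
  qed auto
  ultimately show ?thesis by (metis image_image)
qed

lemma kahler_add: "c \<in> carrier B \<Longrightarrow> d \<in> carrier B \<Longrightarrow> fib c \<oplus>\<^bsub>kahler R B g\<^esub> fib d = fib (c \<oplus> d)"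
  unfolding kahler_def quot_module_def using fib_add_subset[of c d "fib d"] fib_witness[of d] by auto

lemma kahler_smult:
  assumes "a \<in> carrier B" "c \<in> carrier B"
  shows "a \<odot>\<^bsub>kahler R B g\<^esub> fib c = fib (a \<otimes> c)"
proof -
  have "(\<lambda>u. a \<odot>\<^bsub>FM\<^esub> u) ` fib c \<subseteq> fib (a \<otimes> c)" using assms by (auto simp: fib_def Dt_smult)
  then show ?thesis
    using fib_add_subset[of \<zero> "a \<otimes> c" "(\<lambda>u. a \<odot>\<^bsub>FM\<^esub> u) ` fib c"] fib_witness[of c] assms
    by (auto simp: kahler_def quot_module_def kahler_submod_eq)
qed

lemma kahler_zero: "\<zero>\<^bsub>kahler R B g\<^esub> = fib \<zero>"
  by (simp add: kahler_def quot_module_def kahler_submod_eq)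

lemma kahler_d: "b \<in> carrier B \<Longrightarrow> kahler_d R B g b = fib (D b)"
  by (simp add: kahler_d_def kahler_submod_eq kahler_coset free_gen_closed Dt_gen)

end

text \<open>If \<open>h\<close> carries one derivation to the other up to the factor
  \<open>\<mu>\<close>, then the induced map multiplies the generator by \<open>\<mu>\<close>. For
  the projections between levels \<open>\<mu>\<close> is \<open>1\<close>; for the Frobenius lift it
  is \<open>p\<close> times the eigenvalue.\<close>

locale kahler_line_map = src: kahler_line B R g D w + tgt: kahler_line B' R' g' D' w' +
    h: ring_hom_cring B B' h
  for B :: "('b, 'n) ring_scheme" and R :: "('r, 'm) ring_scheme" and g D w
    and B' :: "('c, 'k) ring_scheme" and R' :: "('s, 'l) ring_scheme" and g' D' w' and h +
  fixes \<mu>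
  assumes mu_closed: "\<mu> \<in> carrier B'"
    and D_h: "b \<in> carrier B \<Longrightarrow> D' (h b) = \<mu> \<otimes>\<^bsub>B'\<^esub> h (D b)"
begin

lemma Dt_free_mod_map:
  assumes u: "u \<in> carrier (free_mod B)"
  shows "free_mod_map B B' h u \<in> carrier (free_mod B')"
    and "tgt.Dt (free_mod_map B B' h u) = \<mu> \<otimes>\<^bsub>B'\<^esub> h (src.Dt u)"
proof -
  define S where "S = {b. u b \<noteq> \<zero>\<^bsub>B\<^esub>}"
  have S: "finite S" "S \<subseteq> carrier B" and u': "\<And>b. u b \<in> carrier B"
    using u by (auto simp: S_def src.free_mod_carrier_iff)
  define fm where "fm = free_mod_map B B' h u"
  have fm: "fm c = (\<Oplus>\<^bsub>B'\<^esub>b\<in>{b\<in>S. h b = c}. h (u b))" for c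
    by (simp add: fm_def free_mod_map_def S_def)
  have cl: "fm c \<in> carrier B'" for c unfolding fm by (rule tgt.finsum_closed) (use u' in auto)
  have supp: "{c. fm c \<noteq> \<zero>\<^bsub>B'\<^esub>} \<subseteq> h ` S"
  proof
    fix c assume "c \<in> {c. fm c \<noteq> \<zero>\<^bsub>B'\<^esub>}"
    then have "{b\<in>S. h b = c} \<noteq> {}" unfolding fm by (auto simp del: Collect_empty_eq)
    then show "c \<in> h ` S" by auto
  qed
  have hS: "finite (h ` S)" "h ` S \<subseteq> carrier B'" using S by auto
  show fmc: "free_mod_map B B' h u \<in> carrier (free_mod B')"
    using cl supp hS finite_subset unfolding fm_def[symmetric] tgt.free_mod_carrier_iff by blast
  have "tgt.Dt fm = (\<Oplus>\<^bsub>B'\<^esub>c\<in>h ` S. fm c \<otimes>\<^bsub>B'\<^esub> D' c)"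
    using fmc hS supp unfolding fm_def by (intro tgt.Dt_superset) auto
  \<comment> \<open>Since \<open>h\<close> may identify several \<open>b\<close>, a coefficient of
    the image collects a whole fibre of \<open>h\<close> in \<open>S\<close>; the sum is regrouped
    along these disjoint fibres.\<close>
  also have "\<dots> = (\<Oplus>\<^bsub>B'\<^esub>c\<in>h ` S. \<Oplus>\<^bsub>B'\<^esub>b\<in>{b\<in>S. h b = c}. h (u b) \<otimes>\<^bsub>B'\<^esub> D' (h b))"
  proof (rule tgt.finsum_cong')
    fix c assume c: "c \<in> h ` S"
    have "fm c \<otimes>\<^bsub>B'\<^esub> D' c = (\<Oplus>\<^bsub>B'\<^esub>b\<in>{b\<in>S. h b = c}. h (u b) \<otimes>\<^bsub>B'\<^esub> D' c)"
      unfolding fm using S u' c hS by (intro tgt.finsum_ldistr) auto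
    also have "\<dots> = (\<Oplus>\<^bsub>B'\<^esub>b\<in>{b\<in>S. h b = c}. h (u b) \<otimes>\<^bsub>B'\<^esub> D' (h b))"
      using u' S by (intro tgt.finsum_cong') auto
    finally show "fm c \<otimes>\<^bsub>B'\<^esub> D' c = (\<Oplus>\<^bsub>B'\<^esub>b\<in>{b\<in>S. h b = c}. h (u b) \<otimes>\<^bsub>B'\<^esub> D' (h b))" .
  qed (use u' S in \<open>auto intro!: tgt.finsum_closed\<close>)
  also have "\<dots> = (\<Oplus>\<^bsub>B'\<^esub>b\<in>(\<Union>c\<in>h ` S. {b\<in>S. h b = c}). h (u b) \<otimes>\<^bsub>B'\<^esub> D' (h b))"
    using S u' by (intro tgt.add.finprod_UN_disjoint[symmetric]) (auto simp: pairwise_def disjnt_def)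
  also have "(\<Union>c\<in>h ` S. {b\<in>S. h b = c}) = S" by auto
  also have "(\<Oplus>\<^bsub>B'\<^esub>b\<in>S. h (u b) \<otimes>\<^bsub>B'\<^esub> D' (h b)) = (\<Oplus>\<^bsub>B'\<^esub>b\<in>S. \<mu> \<otimes>\<^bsub>B'\<^esub> h (u b \<otimes>\<^bsub>B\<^esub> D b))"
    using S u' mu_closed by (intro tgt.finsum_cong') (auto simp: D_h subset_iff tgt.m_ac)
  also have "\<dots> = \<mu> \<otimes>\<^bsub>B'\<^esub> (\<Oplus>\<^bsub>B'\<^esub>b\<in>S. h (u b \<otimes>\<^bsub>B\<^esub> D b))"
    using S u' mu_closed by (intro tgt.finsum_rdistr[symmetric]) auto
  also have "(\<Oplus>\<^bsub>B'\<^esub>b\<in>S. h (u b \<otimes>\<^bsub>B\<^esub> D b)) = h (\<Oplus>\<^bsub>B\<^esub>b\<in>S. u b \<otimes>\<^bsub>B\<^esub> D b)"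
    using S u' by (subst h.hom_finsum) (auto simp: o_def)
  finally show "tgt.Dt (free_mod_map B B' h u) = \<mu> \<otimes>\<^bsub>B'\<^esub> h (src.Dt u)"
    by (simp add: fm_def src.Dt_def S_def)
qed

lemma kahler_map_fib:
  assumes c: "c \<in> carrier B"
  shows "kahler_map B R' B' g' h (src.fib c) = tgt.fib (\<mu> \<otimes>\<^bsub>B'\<^esub> h c)"
proof -
  have "free_mod_map B B' h ` src.fib c \<subseteq> tgt.fib (\<mu> \<otimes>\<^bsub>B'\<^esub> h c)"
    using Dt_free_mod_map by (auto simp: src.fib_def tgt.fib_def)
  then show ?thesis
    unfolding kahler_map_def tgt.kahler_submod_eq
    using tgt.fib_add_subset[of "\<zero>\<^bsub>B'\<^esub>" "\<mu> \<otimes>\<^bsub>B'\<^esub> h c" "free_mod_map B B' h ` src.fib c"]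
      src.fib_witness[OF c] c mu_closed by auto
qed

end

section \<open>The base ring\<close>

instance fract :: ("{idom, ring_char_0}") field_char_0
proof
  have "of_nat n = (to_fract (of_nat n) :: 'a fract)" for n
    by (induction n) auto
  then show "inj (of_nat :: nat \<Rightarrow> 'a fract)"
    by (intro injI) simp
qed

lemma to_fract_of_nat: "to_fract (of_nat n) = of_nat n"
  by (induction n) auto

lemma to_fract_power: "to_fract (a ^ n) = to_fract a ^ n"
  by (induction n) auto

lemma fract_exhaust:
  fixes x :: "'a :: idom fract"
  obtains a b where "b \<noteq> 0" "x = to_fract a / to_fract b"
  by (cases x) (auto simp: Fract_conv_to_fract)

lemma poly_mapping_induct [case_names single zero add]:
  fixes Q :: "('a \<Rightarrow>\<^sub>0 'b :: comm_monoid_add) \<Rightarrow> bool"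
  assumes single: "\<And>m. Q (Poly_Mapping.single m (Poly_Mapping.lookup P m))"
    and zero: "Q 0" and add: "\<And>P P'. Q P \<Longrightarrow> Q P' \<Longrightarrow> Q (P + P')"
  shows "Q P"
proof -
  have "P = (\<Sum>m\<in>Poly_Mapping.keys P. Poly_Mapping.single m (Poly_Mapping.lookup P m))"
  proof (rule poly_mapping_eqI)
    fix k
    show "Poly_Mapping.lookup P k = Poly_Mapping.lookup
      (\<Sum>m\<in>Poly_Mapping.keys P. Poly_Mapping.single m (Poly_Mapping.lookup P m)) k"
      by (simp add: lookup_sum lookup_single when_def in_keys_iff)
  qed
  moreover have "Q (\<Sum>m\<in>A. Poly_Mapping.single m (Poly_Mapping.lookup P m))"
    if "finite A" "A \<subseteq> Poly_Mapping.keys P" for A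
    using that by (induction A rule: finite_induct) (auto intro: zero add single)
  ultimately show ?thesis by (metis finite_keys order_refl)
qed

text \<open>One family for \<open>z4\<close> and \<open>z6\<close>: passing from
  \<open>z\<^sup>(\<^sup>i\<^sup>)\<close> to
  \<open>z\<^sup>(\<^sup>i\<^sup>+\<^sup>1\<^sup>)\<close> shifts the index by two.\<close>

definition zvar :: "nat \<Rightarrow> zpoly" where
  "zvar i = Poly_Mapping.single (Poly_Mapping.single i 1) 1"

definition zconst :: "rat \<Rightarrow> zpoly" where
  "zconst c = Poly_Mapping.single 0 c"

lemma zconst_hom: "zconst (c + d) = zconst c + zconst d" "zconst (c * d) = zconst c * zconst d"
    "zconst 1 = 1" "zconst 0 = 0" "zconst (- c) = - zconst c"
  by (auto simp: zconst_def single_add mult_single single_uminus)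

lemma zconst_of_nat: "zconst (of_nat n) = of_nat n"
  by (induction n) (auto simp: zconst_hom)

lemma zpoly_induct [consumes 1, case_names const var add mult]:
  fixes Q :: "zpoly \<Rightarrow> bool"
  assumes P: "\<And>m. Poly_Mapping.lookup P m \<in> Z" and "0 \<in> Z" "1 \<in> Z"
    and const: "\<And>c. c \<in> Z \<Longrightarrow> Q (zconst c)" and var: "\<And>i. Q (zvar i)"
    and add: "\<And>P P'. Q P \<Longrightarrow> Q P' \<Longrightarrow> Q (P + P')" and mult: "\<And>P P'. Q P \<Longrightarrow> Q P' \<Longrightarrow> Q (P * P')"
  shows "Q P"
proof -
  have one: "Q 1" using const[OF \<open>1 \<in> Z\<close>] by (simp add: zconst_hom)
  have zero: "Q 0" using const[OF \<open>0 \<in> Z\<close>] by (simp add: zconst_hom)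
  have monom: "Q (Poly_Mapping.single m 1)" for m :: "nat \<Rightarrow>\<^sub>0 nat"
  proof (induction m rule: poly_mapping_induct)
    case (single i)
    have "Q (Poly_Mapping.single (Poly_Mapping.single i k) 1)" for k
    proof (induction k)
      case 0
      then show ?case using one by (simp add: single_zero)
    next
      case (Suc k)
      have "Poly_Mapping.single (Poly_Mapping.single i (Suc k)) (1 :: rat) =
          Poly_Mapping.single (Poly_Mapping.single i k) 1 * zvar i"
        unfolding zvar_def mult_single by (simp flip: single_add)
      then show ?case using Suc mult var by simp
    qed
    then show ?case .
  next
    case zero
    then show ?case using one by (simp add: single_one)
  next
    case (add m m')
    then show ?case using mult[OF add] by (simp add: mult_single)
  qed
  show ?thesis
  proof (induction P rule: poly_mapping_induct)
    case (single m)
    have "Poly_Mapping.single m (Poly_Mapping.lookup P m) =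
        zconst (Poly_Mapping.lookup P m) * Poly_Mapping.single m 1"
      by (simp add: zconst_def mult_single)
    then show ?case using mult const[OF P] monom by simp
  qed (auto intro: zero add)
qed

subsection \<open>Substitution homomorphisms\<close>

definition monval :: "(nat \<Rightarrow> 'c :: comm_ring_1) \<Rightarrow> (nat \<Rightarrow>\<^sub>0 nat) \<Rightarrow> 'c" where
  "monval \<sigma> m = (\<Prod>i\<in>Poly_Mapping.keys m. \<sigma> i ^ Poly_Mapping.lookup m i)"

lemma monval_superset:
  "finite S \<Longrightarrow> Poly_Mapping.keys m \<subseteq> S \<Longrightarrow> monval \<sigma> m = (\<Prod>i\<in>S. \<sigma> i ^ Poly_Mapping.lookup m i)"
  unfolding monval_def by (intro prod.mono_neutral_left) (auto simp: in_keys_iff)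

lemma monval_add: "monval \<sigma> (m + n) = monval \<sigma> m * monval \<sigma> n"
proof -
  define S where "S = Poly_Mapping.keys m \<union> Poly_Mapping.keys n"
  have S: "finite S" "Poly_Mapping.keys m \<subseteq> S" "Poly_Mapping.keys n \<subseteq> S"
    "Poly_Mapping.keys (m + n) \<subseteq> S"
    using keys_add[of m n] by (auto simp: S_def)
  show ?thesis
    unfolding monval_superset[OF S(1,2)] monval_superset[OF S(1,3)] monval_superset[OF S(1,4)]
    by (simp add: lookup_add power_add prod.distrib)
qed

locale substitution =
  fixes e :: "rat \<Rightarrow> 'c :: comm_ring_1" and \<sigma> :: "nat \<Rightarrow> 'c"
  assumes e_add: "e (c + d) = e c + e d" and e_mult: "e (c * d) = e c * e d" and e_1: "e 1 = 1"
begin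

lemma e_0: "e 0 = 0"
  using e_add[of 0 0] by simp

definition subst :: "zpoly \<Rightarrow> 'c" where
  "subst P = (\<Sum>m\<in>Poly_Mapping.keys P. e (Poly_Mapping.lookup P m) * monval \<sigma> m)"

lemma subst_superset:
  "finite S \<Longrightarrow> Poly_Mapping.keys P \<subseteq> S \<Longrightarrow>
    subst P = (\<Sum>m\<in>S. e (Poly_Mapping.lookup P m) * monval \<sigma> m)"
  unfolding subst_def by (intro sum.mono_neutral_left) (auto simp: in_keys_iff e_0)

lemma subst_add: "subst (P + Q) = subst P + subst Q"
proof -
  define S where "S = Poly_Mapping.keys P \<union> Poly_Mapping.keys Q"
  have S: "finite S" "Poly_Mapping.keys P \<subseteq> S" "Poly_Mapping.keys Q \<subseteq> S"
    "Poly_Mapping.keys (P + Q) \<subseteq> S"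
    using keys_add[of P Q] by (auto simp: S_def)
  show ?thesis
    unfolding subst_superset[OF S(1,2)] subst_superset[OF S(1,3)] subst_superset[OF S(1,4)]
    by (simp add: lookup_add e_add algebra_simps sum.distrib)
qed

lemma subst_0 [simp]: "subst 0 = 0"
  by (simp add: subst_def)

lemma subst_single: "subst (Poly_Mapping.single m c) = e c * monval \<sigma> m"
  by (subst subst_superset[of "{m}"]) auto

lemma subst_mult: "subst (P * Q) = subst P * subst Q"
proof (induction P rule: poly_mapping_induct)
  case (single m)
  show ?case
  proof (induction Q rule: poly_mapping_induct)
    case (single n)
    then show ?case by (simp add: mult_single subst_single e_mult monval_add)
  qed (auto simp: subst_add algebra_simps)
qed (auto simp: subst_add algebra_simps)

lemma subst_const: "subst (zconst c) = e c"
  by (simp add: zconst_def subst_single monval_def)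

lemma subst_var: "subst (zvar i) = \<sigma> i"
  by (simp add: zvar_def subst_single monval_def e_1)

lemma subst_1: "subst 1 = 1"
  using subst_const[of 1] by (simp add: zconst_hom e_1)

lemma subst_of_nat: "subst (of_nat n) = of_nat n"
  by (induction n) (auto simp: subst_add subst_1)

lemma subst_numeral: "subst (numeral n) = numeral n"
  using subst_of_nat[of "numeral n"] by simp

lemma subst_power: "subst (P ^ n) = subst P ^ n"
  by (induction n) (auto simp: subst_mult subst_1)

end

lemma map_poly_hom_power:
  fixes f :: "'a :: comm_ring_1 \<Rightarrow> 'b :: comm_ring_1"
  assumes add: "\<And>a b. f (a + b) = f a + f b" and mult: "\<And>a b. f (a * b) = f a * f b" and one: "f 1 = 1"
  shows "map_poly f (P ^ n) = map_poly f P ^ n"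
proof (induction n)
  have zero: "f 0 = 0" using add[of 0 0] by simp
  have sum: "f (sum g A) = (\<Sum>i\<in>A. f (g i))" for g :: "nat \<Rightarrow> 'a" and A
    by (induction A rule: infinite_finite_induct) (auto simp: zero add)
  case 0
  show ?case by (simp add: one)
  case (Suc n)
  have "map_poly f (P * P ^ n) = map_poly f P * map_poly f (P ^ n)"
    by (simp add: poly_eq_iff coeff_map_poly zero coeff_mult sum mult)
  then show ?case using Suc by simp
qed

subsection \<open>Polynomials over the localisation of the integers\<close>

lemma Z_loc_subring: "prime p \<Longrightarrow> subring_set (Z_loc p)"
proof
  assume p: "prime p"
  show "1 \<in> Z_loc p" unfolding Z_loc_def
    using p by (intro CollectI exI[of _ 1]) (auto simp: prime_nat_iff)
  fix c d assume "c \<in> Z_loc p" "d \<in> Z_loc p"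
  then obtain a b a' b' where *: "c = of_int a / of_int b" "\<not> int p dvd b"
      "d = of_int a' / of_int b'" "\<not> int p dvd b'"
    unfolding Z_loc_def by blast
  then have b: "b \<noteq> 0" "b' \<noteq> 0" by auto
  have bb: "\<not> int p dvd b * b'" using * p by (simp add: prime_dvd_mult_iff)
  have "c + d = of_int (a * b' + a' * b) / of_int (b * b')"
    using * b by (simp add: field_simps)
  then show "c + d \<in> Z_loc p" unfolding Z_loc_def using bb by blast
  have "c * d = of_int (a * a') / of_int (b * b')"
    unfolding * by simp
  then show "c * d \<in> Z_loc p" unfolding Z_loc_def using bb by blast
next
  fix c assume "c \<in> Z_loc p"
  then obtain a b where *: "c = of_int a / of_int b" "\<not> int p dvd b"
    unfolding Z_loc_def by blast
  then have "- c = of_int (- a) / of_int b" by simp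
  then show "- c \<in> Z_loc p" unfolding Z_loc_def using * by blast
qed

lemma Z_loc_inverse: "\<not> p dvd n \<Longrightarrow> inverse (of_nat n) \<in> Z_loc p"
  unfolding Z_loc_def by (intro CollectI exI[of _ 1] exI[of _ "int n"]) (auto simp: field_simps)

text \<open>For \<open>c = a / b\<close> the difference \<open>c - c ^ p\<close> has numerator
  \<open>a * b ^ p - a ^ p * b\<close>, divisible by \<open>p\<close> by Fermat for \<open>a\<close>
  and \<open>b\<close>. Oddness reduces Fermat for negative integers to natural numbers.\<close>

lemma Z_loc_frobenius:
  assumes p: "prime p" and odd: "odd p" and c: "c \<in> Z_loc p"
  shows "\<exists>d\<in>Z_loc p. c = c ^ p + of_nat p * d"
proof -
  interpret I: subring_set "UNIV :: int set" by unfold_locales auto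
  have fermat: "int p dvd a ^ p - a" for a
  proof -
    have nat: "int p dvd int n ^ p - int n" for n
      using I.cg_frobenius_of_nat[OF p, of n] unfolding I.cg_def by auto
    show ?thesis
    proof (cases a rule: int_cases2)
      case (nonneg n)
      then show ?thesis using nat by simp
    next
      case (nonpos n)
      then have "a ^ p - a = - (int n ^ p - int n)" using odd by simp
      then show ?thesis using nat by (metis dvd_minus_iff)
    qed
  qed
  obtain a b where ab: "c = of_int a / of_int b" "\<not> int p dvd b"
    using c unfolding Z_loc_def by blast
  then have "b \<noteq> 0" by auto
  have "a * b ^ p - a ^ p * b = a * (b ^ p - b) - b * (a ^ p - a)" by (simp add: algebra_simps)
  then have "int p dvd a * b ^ p - a ^ p * b" using fermat by simp
  then obtain k where k: "a * b ^ p - a ^ p * b = int p * k" by (elim dvdE)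
  have "c - c ^ p = of_int (a * b ^ p - a ^ p * b) / of_int (b * b ^ p)"
    using \<open>b \<noteq> 0\<close> by (simp add: ab field_simps)
  also have "\<dots> = of_nat p * (of_int k / of_int (b * b ^ p))" unfolding k by simp
  finally have "c = c ^ p + of_nat p * (of_int k / of_int (b * b ^ p))" by (simp add: algebra_simps)
  moreover have "\<not> int p dvd b * b ^ p"
    using ab(2) p prime_dvd_power[of "int p" b p] by (auto simp: prime_dvd_mult_iff)
  ultimately show ?thesis unfolding Z_loc_def by blast
qed

definition ZP :: "nat \<Rightarrow> zpoly set" where
  "ZP p = {P. \<forall>m. Poly_Mapping.lookup P m \<in> Z_loc p}"

lemma ZP_subring: assumes p: "prime p" shows "subring_set (ZP p)"
proof -
  interpret Z: subring_set "Z_loc p" by (rule Z_loc_subring[OF p])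
  have add: "P + Q \<in> ZP p" if "P \<in> ZP p" "Q \<in> ZP p" for P Q
    using that by (auto simp: ZP_def lookup_add)
  have zero: "0 \<in> ZP p" by (auto simp: ZP_def)
  have single: "Poly_Mapping.single m c \<in> ZP p" if "c \<in> Z_loc p" for m c
    using that by (auto simp: ZP_def lookup_single when_def)
  show ?thesis
  proof
    show "1 \<in> ZP p" using single[of 1 0] by (simp add: single_one)
    show "- P \<in> ZP p" if "P \<in> ZP p" for P using that by (auto simp: ZP_def)
    fix P Q assume P: "P \<in> ZP p" and Q: "Q \<in> ZP p"
    show "P + Q \<in> ZP p" using P Q by (rule add)
    show "P * Q \<in> ZP p"
    proof (induction P rule: poly_mapping_induct)
      case (single m)
      have c: "Poly_Mapping.lookup P m \<in> Z_loc p" using P by (auto simp: ZP_def)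
      show ?case
      proof (induction Q rule: poly_mapping_induct)
        case (single n)
        have "Poly_Mapping.lookup Q n \<in> Z_loc p" using Q by (auto simp: ZP_def)
        then show ?case using c by (simp add: mult_single \<open>\<And>m c. c \<in> Z_loc p \<Longrightarrow> Poly_Mapping.single m c \<in> ZP p\<close>)
      qed (auto simp: algebra_simps zero intro: add)
    qed (auto simp: algebra_simps zero intro: add)
  qed
qed

lemma zconst_ZP: "prime p \<Longrightarrow> c \<in> Z_loc p \<Longrightarrow> zconst c \<in> ZP p"
  using subring_set.zero_mem[OF Z_loc_subring, of p]
  by (auto simp: ZP_def zconst_def lookup_single when_def)

lemma zvar_ZP: "prime p \<Longrightarrow> zvar i \<in> ZP p"
  using subring_set.zero_mem[OF Z_loc_subring, of p] subring_set.one_mem[OF Z_loc_subring, of p]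
  by (auto simp: ZP_def zvar_def lookup_single when_def)

lemma ZP_Union: "(\<Union>r. Z_loc_polys p r) = ZP p"
proof -
  have "\<exists>r. \<forall>m\<in>Poly_Mapping.keys P. Poly_Mapping.keys m \<subseteq> {..2 * r + 1}" for P :: zpoly
  proof -
    define S where "S = (\<Union>m\<in>Poly_Mapping.keys P. Poly_Mapping.keys m)"
    have "finite S" by (auto simp: S_def)
    then obtain r where "\<forall>i\<in>S. i \<le> r" using finite_nat_set_iff_bounded_le by auto
    then have "\<forall>m\<in>Poly_Mapping.keys P. Poly_Mapping.keys m \<subseteq> {..2 * r + 1}"
      by (fastforce simp: S_def)
    then show ?thesis by blast
  qed
  then show ?thesis by (auto simp: Z_loc_polys_def ZP_def)
qed

subsection \<open>The universal Frobenius lift before completion\<close>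

locale good_prime =
  fixes p :: nat
  assumes p_prime: "prime p" and p_not_2: "p \<noteq> 2" and p_not_3: "p \<noteq> 3"
begin

lemma p_gt_3: "p > 3"
  using prime_gt_1_nat[OF p_prime] p_not_2 p_not_3 by linarith

lemma p_odd: "odd p"
  using p_prime p_gt_3 prime_odd_nat by auto

sublocale Z: subring_set "Z_loc p"
  by (rule Z_loc_subring[OF p_prime])

sublocale ZP: coeff_subring "ZP p"
  by (intro coeff_subring.intro ZP_subring p_prime)

definition lift_var :: "nat \<Rightarrow> zpoly" where
  "lift_var i = zvar i ^ p + of_nat p * zvar (i + 2)"

sublocale lift: substitution zconst lift_var
  by unfold_locales (auto simp: zconst_hom)

abbreviation phi0 :: "zpoly \<Rightarrow> zpoly" where "phi0 \<equiv> lift.subst"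

lemma phi0_frob:
  assumes "P \<in> ZP p"
  shows "phi0 P \<in> ZP p" "ZP.cg p (phi0 P) (P ^ p)"
proof -
  define Q where "Q P \<longleftrightarrow> P \<in> ZP p \<and> phi0 P \<in> ZP p \<and> ZP.cg p (phi0 P) (P ^ p)" for P
  have "Q P"
  proof (rule zpoly_induct[of P "Z_loc p"])
    show "Q (zconst c)" if c: "c \<in> Z_loc p" for c
    proof -
      obtain d where d: "d \<in> Z_loc p" "c = c ^ p + of_nat p * d"
        using Z_loc_frobenius[OF p_prime p_odd c] by blast
      have pow: "zconst (c ^ n) = zconst c ^ n" for n by (induction n) (auto simp: zconst_hom)
      have "zconst c = zconst c ^ p + of_nat p * zconst d"
        by (subst d(2)) (simp add: zconst_hom zconst_of_nat pow)
      then show ?thesis unfolding Q_def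
        using zconst_ZP[OF p_prime] d(1) c by (auto simp: lift.subst_const intro: ZP.cgI)
    qed
    show "Q (zvar i)" for i unfolding Q_def
      using zvar_ZP[OF p_prime] by (auto simp: lift.subst_var lift_var_def intro: ZP.cgI)
    fix P P' assume *: "Q P" "Q P'"
    then have "ZP.cg p ((P + P') ^ p) (P ^ p + P' ^ p)"
      using p_prime by (intro ZP.cg_frobenius_add) (auto simp: Q_def)
    moreover have "ZP.cg p (phi0 P + phi0 P') (P ^ p + P' ^ p)"
      using * by (intro ZP.cg_add) (auto simp: Q_def)
    ultimately have "ZP.cg p (phi0 P + phi0 P') ((P + P') ^ p)"
      by (metis ZP.cg_trans ZP.cg_sym)
    then show "Q (P + P')" using * by (auto simp: Q_def lift.subst_add)
    show "Q (P * P')" using * unfolding Q_def lift.subst_mult power_mult_distrib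
      by (auto intro!: ZP.cg_mult)
  qed (use assms in \<open>auto simp: ZP_def\<close>)
  then show "phi0 P \<in> ZP p" "ZP.cg p (phi0 P) (P ^ p)" by (auto simp: Q_def)
qed

text \<open>A left inverse of \<open>phi0\<close> over the rationals: \<open>z\<^sub>i\<^sub>+\<^sub>1 = (\<phi>(z\<^sub>i) - z\<^sub>i\<^sup>p) / p\<close>, and the
  image of \<open>z\<^sub>0\<close> is arbitrary.\<close>

fun unlift_var :: "nat \<Rightarrow> zpoly" where
  "unlift_var i = (if i < 2 then 0 else
     zconst (inverse (of_nat p)) * (zvar (i - 2) - unlift_var (i - 2) ^ p))"

declare unlift_var.simps [simp del]

text \<open>Needed for \<open>phi0\<close> to act on fractions: denominators must stay
  nonzero.\<close>

lemma phi0_inj: "phi0 P = phi0 Q \<Longrightarrow> P = Q"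
proof -
  interpret un: substitution zconst unlift_var by unfold_locales (auto simp: zconst_hom)
  have "un.subst (phi0 P) = P" for P
  proof (rule zpoly_induct[of P UNIV])
    fix i
    have "of_nat p * zconst (inverse (of_nat p)) = zconst (of_nat p * inverse (of_nat p))"
      by (simp add: zconst_hom zconst_of_nat)
    also have "\<dots> = 1" using p_gt_3 by (simp add: zconst_hom)
    finally have p: "of_nat p * zconst (inverse (of_nat p)) = 1" .
    have "of_nat p * unlift_var (i + 2) =
        (of_nat p * zconst (inverse (of_nat p))) * (zvar i - unlift_var i ^ p)"
      by (subst unlift_var.simps) simp
    then show "un.subst (phi0 (zvar i)) = zvar i"
      unfolding p by (simp add: lift.subst_var lift_var_def un.subst_add un.subst_mult un.subst_power
          un.subst_var un.subst_of_nat)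
  qed (auto simp: lift.subst_const un.subst_const lift.subst_add un.subst_add lift.subst_mult un.subst_mult)
  then show "phi0 P = phi0 Q \<Longrightarrow> P = Q" by metis
qed

lemma phi0_nonzero: "P \<noteq> 0 \<Longrightarrow> phi0 P \<noteq> 0"
  using phi0_inj[of P 0] by auto

definition phi :: "zpoly fract \<Rightarrow> zpoly fract" where
  "phi x = (THE y. \<exists>a b. b \<noteq> 0 \<and> x = to_fract a / to_fract b \<and> y = to_fract (phi0 a) / to_fract (phi0 b))"

lemma phi_quotient: "b \<noteq> 0 \<Longrightarrow> phi (to_fract a / to_fract b) = to_fract (phi0 a) / to_fract (phi0 b)"
  unfolding phi_def
proof (rule the_equality)
  fix y assume b: "b \<noteq> 0" and "\<exists>a' b'. b' \<noteq> 0 \<and> to_fract a / to_fract b = to_fract a' / to_fract b' \<and>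
      y = to_fract (phi0 a') / to_fract (phi0 b')"
  then obtain a' b' where *: "b' \<noteq> 0" "to_fract a / to_fract b = to_fract a' / to_fract b'"
      "y = to_fract (phi0 a') / to_fract (phi0 b')" by blast
  then have "to_fract (a * b') = to_fract (a' * b)" using b by (simp add: frac_eq_eq)
  then have "phi0 (a * b') = phi0 (a' * b)" by (simp only: to_fract_eq_iff)
  then have "to_fract (phi0 a) * to_fract (phi0 b') = to_fract (phi0 a') * to_fract (phi0 b)"
    by (simp add: lift.subst_mult flip: to_fract_mult)
  then show "y = to_fract (phi0 a) / to_fract (phi0 b)"
    using * b phi0_nonzero by (simp add: frac_eq_eq)
qed auto

lemma phi_to_fract: "phi (to_fract a) = to_fract (phi0 a)"
  using phi_quotient[of 1 a] by (simp add: lift.subst_1)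

lemma phi_hom: "phi (x + y) = phi x + phi y" "phi (x * y) = phi x * phi y" "phi 1 = 1"
proof -
  show "phi 1 = 1" using phi_to_fract[of 1] by (simp add: lift.subst_1)
  obtain a b where x: "b \<noteq> 0" "x = to_fract a / to_fract b" by (rule fract_exhaust)
  obtain c d where y: "d \<noteq> 0" "y = to_fract c / to_fract d" by (rule fract_exhaust)
  have nz: "to_fract (phi0 b) \<noteq> 0" "to_fract (phi0 d) \<noteq> 0" using x y phi0_nonzero by auto
  have "x + y = to_fract (a * d + c * b) / to_fract (b * d)" using x y by (simp add: add_frac_eq)
  then have "phi (x + y) = to_fract (phi0 (a * d + c * b)) / to_fract (phi0 (b * d))"
    using x(1) y(1) by (metis phi_quotient mult_eq_0_iff)
  then show "phi (x + y) = phi x + phi y" using x y nz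
    by (simp add: phi_quotient lift.subst_add lift.subst_mult add_frac_eq)
  have "x * y = to_fract (a * c) / to_fract (b * d)" using x y by simp
  then have "phi (x * y) = to_fract (phi0 (a * c)) / to_fract (phi0 (b * d))"
    using x(1) y(1) by (metis phi_quotient mult_eq_0_iff)
  then show "phi (x * y) = phi x * phi y" using x y
    by (simp add: phi_quotient lift.subst_mult)
qed

subsection \<open>The Hasse polynomial\<close>

abbreviation H :: zpoly where "H \<equiv> Hasse p"

definition D0 :: zpoly where "D0 = Delta * H"

lemma z_zvar: "z4 i = zvar (2 * i)" "z6 i = zvar (2 * i + 1)"
  by (auto simp: z4_def z6_def zvar_def)

lemma z_ZP: "z4 i \<in> ZP p" "z6 i \<in> ZP p"
  by (auto simp: z_zvar zvar_ZP[OF p_prime])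

lemma Delta_ZP: "Delta \<in> ZP p"
  unfolding Delta_def using z_ZP by auto

lemma H_ZP: "H \<in> ZP p"
  unfolding Hasse_def using z_ZP by (intro polys_overD ZP.LX.power_mem) auto

lemma D0_ZP: "D0 \<in> ZP p"
  unfolding D0_def using Delta_ZP H_ZP by auto

lemma coeff_mult_ge:
  fixes P Q :: "rat poly"
  assumes "\<And>i. Polynomial.coeff P i \<ge> 0" "\<And>i. Polynomial.coeff Q i \<ge> 0"
  shows "Polynomial.coeff (P * Q) (i + j) \<ge> Polynomial.coeff P i * Polynomial.coeff Q j"
proof -
  have "Polynomial.coeff P i * Polynomial.coeff Q (i + j - i) \<le>
      (\<Sum>k\<le>i + j. Polynomial.coeff P k * Polynomial.coeff Q (i + j - k))"
    using assms by (intro member_le_sum) auto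
  then show ?thesis by (simp add: coeff_mult)
qed

lemma coeff_mult_nonneg:
  fixes P Q :: "rat poly"
  assumes "\<And>i. Polynomial.coeff P i \<ge> 0" "\<And>i. Polynomial.coeff Q i \<ge> 0"
  shows "Polynomial.coeff (P * Q) i \<ge> 0"
  using assms by (auto simp: coeff_mult intro!: sum_nonneg)

text \<open>Both are evaluated at the point where all variables are \<open>1\<close>. There
  \<open>Hasse p\<close> becomes the coefficient of \<open>x ^ (2 * m)\<close> in
  \<open>(1 + x + x ^ 3) ^ m\<close>, and since no coefficient is negative it suffices to exhibit
  one contribution.\<close>

lemma H_Delta_nonzero: "H \<noteq> 0" "Delta \<noteq> 0"
proof -
  interpret ev: substitution "\<lambda>c. c" "\<lambda>_. 1 :: rat" by unfold_locales auto
  have "ev.subst Delta = 31"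
    by (simp add: Delta_def z_zvar ev.subst_add ev.subst_mult ev.subst_power ev.subst_var ev.subst_numeral)
  then show "Delta \<noteq> 0" by auto
  define g :: "rat poly" where "g = [:1, 1, 0, 1:]"
  define m where "m = (p - 1) div 2"
  have nonneg: "Polynomial.coeff (P ^ n) i \<ge> 0" if "\<And>i. Polynomial.coeff P i \<ge> 0"
    for P :: "rat poly" and n i
  proof (induction n arbitrary: i)
    case 0
    then show ?case by (simp add: coeff_1)
  next
    case (Suc n)
    then show ?case using that by (auto intro: coeff_mult_nonneg)
  qed
  have g: "Polynomial.coeff g i \<ge> 0" for i
    by (auto simp: g_def coeff_pCons split: nat.split)
  \<comment> \<open>\<open>x ^ 4\<close> is the product of \<open>x\<close> and \<open>x ^ 3\<close>
    in \<open>g ^ 2\<close>, which settles even \<open>m\<close>; for odd \<open>m\<close> one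
    factor \<open>g ^ 3\<close> contributes \<open>x ^ 6\<close>.\<close>
  have pos: "Polynomial.coeff ((g ^ 2) ^ q) (4 * q) > 0" for q
  proof (induction q)
    case (Suc q)
    have "Polynomial.coeff (g ^ 2) 4 = 2"
      by (simp add: g_def power2_eq_square numeral_eq_Suc)
    then have "0 < Polynomial.coeff (g ^ 2) 4 * Polynomial.coeff ((g ^ 2) ^ q) (4 * q)" using Suc by simp
    also have "\<dots> \<le> Polynomial.coeff (g ^ 2 * (g ^ 2) ^ q) (4 + 4 * q)"
      by (intro coeff_mult_ge nonneg g)
    finally show ?case by simp
  qed simp
  have "p = 2 * m + 1" using p_odd by (auto simp: m_def elim: oddE)
  have "Polynomial.coeff (g ^ m) (2 * m) > 0"
  proof (cases "even m")
    case True
    then obtain q where "m = 2 * q" by (elim evenE)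
    then show ?thesis using pos[of q] by (simp add: power_mult)
  next
    case False
    then obtain q where "m = 2 * q + 1" by (elim oddE)
    \<comment> \<open>The case \<open>m = 1\<close> belongs to \<open>p = 3\<close>, where the
      coefficient of \<open>x ^ 2\<close> in \<open>g\<close> is zero.\<close>
    with \<open>p = 2 * m + 1\<close> p_gt_3 obtain q' where m: "m = 2 * q' + 3" by (cases q) auto
    have "Polynomial.coeff (g ^ 3) 6 > 0"
      by (simp add: g_def power3_eq_cube numeral_eq_Suc)
    then have "0 < Polynomial.coeff (g ^ 3) 6 * Polynomial.coeff ((g ^ 2) ^ q') (4 * q')"
      using pos by simp
    also have "\<dots> \<le> Polynomial.coeff (g ^ 3 * (g ^ 2) ^ q') (6 + 4 * q')"
      by (intro coeff_mult_ge nonneg g)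
    also have "g ^ 3 * (g ^ 2) ^ q' = g ^ m"
      unfolding m by (simp add: power_mult[symmetric] power_add[symmetric] add.commute)
    also have "6 + 4 * q' = 2 * m" using m by simp
    finally show ?thesis .
  qed
  moreover have "ev.subst H = Polynomial.coeff (g ^ m) (2 * m)"
  proof -
    have "ev.subst H = Polynomial.coeff (map_poly ev.subst ([:z6 0, z4 0, 0, 1:] ^ m)) (p - 1)"
      by (simp add: Hasse_def coeff_map_poly m_def)
    also have "map_poly ev.subst ([:z6 0, z4 0, 0, 1:] ^ m) = map_poly ev.subst [:z6 0, z4 0, 0, 1:] ^ m"
      by (rule map_poly_hom_power) (auto simp: ev.subst_add ev.subst_mult ev.subst_1)
    also have "map_poly ev.subst [:z6 0, z4 0, 0, 1:] = g"
      by (simp add: map_poly_pCons g_def z_zvar ev.subst_var ev.subst_1)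
    finally show ?thesis using \<open>p = 2 * m + 1\<close> by simp
  qed
  ultimately show "H \<noteq> 0" by auto
qed

lemma D0_nonzero: "D0 \<noteq> 0"
  using H_Delta_nonzero by (simp add: D0_def)

subsection \<open>A localisation stable under the Frobenius lift\<close>

text \<open>Unlike \<open>M\<^sup>\<infinity>\<close>, the following ring is mapped into itself by \<open>phi\<close>; it has the same
  reductions modulo powers of \<open>p\<close> because the additional denominators are units modulo \<open>p\<close>.\<close>

definition denoms :: "zpoly set" where
  "denoms = {b \<in> ZP p. b \<noteq> 0 \<and> (\<exists>k. ZP.cg p b (D0 ^ k))}"

definition L :: "zpoly fract set" where
  "L = {to_fract a / to_fract b | a b. a \<in> ZP p \<and> b \<in> denoms}"

lemma denoms_mult: "b \<in> denoms \<Longrightarrow> c \<in> denoms \<Longrightarrow> b * c \<in> denoms"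
proof -
  assume "b \<in> denoms" "c \<in> denoms"
  then obtain j k where "b \<in> ZP p" "b \<noteq> 0" "c \<in> ZP p" "c \<noteq> 0"
      "ZP.cg p b (D0 ^ j)" "ZP.cg p c (D0 ^ k)" by (auto simp: denoms_def)
  moreover from this have "ZP.cg p (b * c) (D0 ^ (j + k))"
    unfolding power_add using D0_ZP by (intro ZP.cg_mult) auto
  ultimately show ?thesis unfolding denoms_def by auto
qed

lemma denoms_1: "1 \<in> denoms"
  unfolding denoms_def by (auto intro!: exI[of _ 0])

lemma denoms_power: "b \<in> denoms \<Longrightarrow> b ^ n \<in> denoms"
  by (induction n) (auto simp: denoms_1 denoms_mult)

lemma denoms_D0: "D0 \<in> denoms"
  unfolding denoms_def using D0_ZP D0_nonzero by (auto intro!: exI[of _ 1])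

text \<open>The reason for admitting denominators that are powers of \<open>D0\<close> only modulo
  \<open>p\<close>: the image of \<open>D0\<close> is congruent to \<open>D0 ^ p\<close>.\<close>

lemma denoms_phi0: "b \<in> denoms \<Longrightarrow> phi0 b \<in> denoms"
proof -
  assume "b \<in> denoms"
  then obtain k where b: "b \<in> ZP p" "b \<noteq> 0" "ZP.cg p b (D0 ^ k)" by (auto simp: denoms_def)
  have "ZP.cg p (phi0 b) (b ^ p)" by (rule phi0_frob[OF b(1)])
  also have "ZP.cg p (b ^ p) ((D0 ^ k) ^ p)" using b by (intro ZP.cg_power) auto
  finally have "ZP.cg p (phi0 b) (D0 ^ (k * p))" by (simp add: power_mult)
  then show ?thesis unfolding denoms_def using phi0_frob[OF b(1)] phi0_nonzero[OF b(2)] by blast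
qed

lemma L_I: "a \<in> ZP p \<Longrightarrow> b \<in> denoms \<Longrightarrow> to_fract a / to_fract b \<in> L"
  unfolding L_def by blast

lemma L_to_fract: "a \<in> ZP p \<Longrightarrow> to_fract a \<in> L"
  using L_I[OF _ denoms_1, of a] by simp

lemma denoms_nonzero: "b \<in> denoms \<Longrightarrow> b \<noteq> 0" and denoms_ZP: "b \<in> denoms \<Longrightarrow> b \<in> ZP p"
  by (auto simp: denoms_def)

sublocale L: coeff_subring L
proof
  show "1 \<in> L" using L_to_fract[of 1] by simp
  fix x y assume "x \<in> L" "y \<in> L"
  then obtain a b c d where *: "x = to_fract a / to_fract b" "y = to_fract c / to_fract d"
      "a \<in> ZP p" "b \<in> denoms" "c \<in> ZP p" "d \<in> denoms" unfolding L_def by blast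
  note nz = denoms_nonzero[OF *(4)] denoms_nonzero[OF *(6)]
  have "x + y = to_fract (a * d + c * b) / to_fract (b * d)" using * nz by (simp add: add_frac_eq)
  then show "x + y \<in> L" using * denoms_mult denoms_ZP by (auto intro!: L_I simp del: to_fract_mult to_fract_add)
  have "x * y = to_fract (a * c) / to_fract (b * d)" using * by simp
  then show "x * y \<in> L" using * denoms_mult by (auto intro!: L_I simp del: to_fract_mult)
next
  fix x assume "x \<in> L"
  then obtain a b where *: "x = to_fract a / to_fract b" "a \<in> ZP p" "b \<in> denoms"
    unfolding L_def by blast
  then have "- x = to_fract (- a) / to_fract b" by simp
  then show "- x \<in> L" using * by (auto intro!: L_I simp del: to_fract_uminus)
qed

lemma phi_L: "l \<in> L \<Longrightarrow> phi l \<in> L"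
  unfolding L_def using phi_quotient denoms_nonzero phi0_frob(1) denoms_phi0 by blast

lemma phi_frob: "l \<in> L \<Longrightarrow> L.cg p (phi l) (l ^ p)"
proof -
  assume "l \<in> L"
  then obtain a b where l: "l = to_fract a / to_fract b" "a \<in> ZP p" "b \<in> denoms"
    unfolding L_def by blast
  note b = denoms_nonzero[OF l(3)] denoms_ZP[OF l(3)]
  obtain a' where a': "a' \<in> ZP p" "phi0 a = a ^ p + of_nat p * a'"
    using phi0_frob(2)[OF l(2)] by (elim ZP.cgE)
  obtain b' where b': "b' \<in> ZP p" "phi0 b = b ^ p + of_nat p * b'"
    using phi0_frob(2)[OF b(2)] by (elim ZP.cgE)
  define A B A' B' where "A = to_fract a" "B = to_fract b" "A' = to_fract a'" "B' = to_fract b'"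
  have nz: "to_fract (phi0 b) \<noteq> 0" "B \<noteq> 0" using phi0_nonzero b by (auto simp: A_B_A'_B'_def)
  have pb: "to_fract (phi0 b) = B ^ p + of_nat p * B'" and pa: "to_fract (phi0 a) = A ^ p + of_nat p * A'"
    unfolding a' b' by (auto simp: A_B_A'_B'_def to_fract_power to_fract_of_nat)
  have "phi l - l ^ p = to_fract (phi0 a) / to_fract (phi0 b) - A ^ p / B ^ p"
    using b by (simp add: l phi_quotient power_divide A_B_A'_B'_def)
  also have "\<dots> = (to_fract (phi0 a) * B ^ p - A ^ p * to_fract (phi0 b)) / (to_fract (phi0 b) * B ^ p)"
    using nz by (simp add: diff_frac_eq)
  also have "to_fract (phi0 a) * B ^ p - A ^ p * to_fract (phi0 b) = of_nat p * (A' * B ^ p - A ^ p * B')"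
    unfolding pa pb by (simp add: algebra_simps)
  also have "\<dots> / (to_fract (phi0 b) * B ^ p) = of_nat p * (to_fract (a' * b ^ p - a ^ p * b') / to_fract (phi0 b * b ^ p))"
    by (simp add: A_B_A'_B'_def to_fract_power)
  finally show ?thesis unfolding L.cg_def
    using l a' b' b by (blast intro: L_I denoms_mult denoms_phi0 denoms_power)
qed

abbreviation zz4 where "zz4 \<equiv> to_fract (z4 0)"
abbreviation zz6 where "zz6 \<equiv> to_fract (z6 0)"
abbreviation Hinv where "Hinv \<equiv> inverse (to_fract H)"

lemma Hinv_eq: "Hinv = to_fract Delta / to_fract D0"
  using H_Delta_nonzero by (simp add: D0_def field_simps)

sublocale frobenius_curve L p phi zz4 zz6 Hinv
proof
  show "inverse (of_nat n) \<in> L" if n: "\<not> p dvd n" for n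
  proof -
    have n0: "n \<noteq> 0" using n by (intro notI) simp
    have "of_nat n * zconst (inverse (of_nat n)) = zconst (of_nat n * inverse (of_nat n))"
      by (simp add: zconst_hom zconst_of_nat)
    then have "of_nat n * zconst (inverse (of_nat n)) = 1" using n0 by (simp add: zconst_hom)
    then have "of_nat n * to_fract (zconst (inverse (of_nat n))) = 1"
      by (metis to_fract_of_nat to_fract_mult to_fract_1)
    then have "inverse (of_nat n) = to_fract (zconst (inverse (of_nat n)))"
      by (rule inverse_unique)
    then show ?thesis
      using L_to_fract[OF zconst_ZP[OF p_prime Z_loc_inverse[OF n]]] by simp
  qed
  have num: "to_fract (numeral k) = numeral k" for k
    using to_fract_of_nat[of "numeral k"] by simp
  have disc: "4 * zz4 ^ 3 + 27 * zz6 ^ 2 = to_fract Delta"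
    by (simp add: Delta_def to_fract_power num)
  show "4 * zz4 ^ 3 + 27 * zz6 ^ 2 \<noteq> 0" unfolding disc using H_Delta_nonzero by simp
  have "inverse (to_fract Delta) = to_fract H / to_fract D0"
    using H_Delta_nonzero by (simp add: D0_def field_simps)
  then show "inverse (4 * zz4 ^ 3 + 27 * zz6 ^ 2) \<in> L"
    unfolding disc using L_I[OF H_ZP denoms_D0] by simp
  show "Hinv \<in> L" unfolding Hinv_eq using L_I[OF Delta_ZP denoms_D0] .
  have "to_fract H = Polynomial.coeff (map_poly to_fract ([:z6 0, z4 0, 0, 1:] ^ ((p - 1) div 2))) (p - 1)"
    by (simp add: Hasse_def coeff_map_poly)
  also have "map_poly to_fract ([:z6 0, z4 0, 0, 1:] ^ ((p - 1) div 2)) =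
      map_poly to_fract [:z6 0, z4 0, 0, 1:] ^ ((p - 1) div 2)"
    by (rule map_poly_hom_power) auto
  also have "map_poly to_fract [:z6 0, z4 0, 0, 1:] = [:zz6, zz4, 0, 1:]"
    by (simp add: map_poly_pCons)
  finally show "Hinv * Polynomial.coeff ([:zz6, zz4, 0, 1:] ^ ((p - 1) div 2)) (p - 1) = 1"
    using H_Delta_nonzero by (metis left_inverse to_fract_eq_0_iff)
qed (use p_prime p_gt_3 phi_hom phi_L phi_frob z_ZP L_to_fract in auto)

section \<open>Agreement of \<open>M\<close> and \<open>L\<close> modulo powers of
  \<open>p\<close>\<close>

abbreviation MR where "MR \<equiv> M_inf p H"
abbreviation M where "M \<equiv> carrier MR"

lemma M_eq: "M = {to_fract P / to_fract D0 ^ k | P k. P \<in> ZP p}"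
proof -
  have "M = (\<Union>r. M_carrier p H r)" by (simp add: M_inf_def)
  then show ?thesis unfolding M_carrier_def ZP_Union[symmetric] D0_def by blast
qed

lemma M_I: "P \<in> ZP p \<Longrightarrow> to_fract P / to_fract D0 ^ k \<in> M"
  unfolding M_eq by blast

lemma M_to_fract: "P \<in> ZP p \<Longrightarrow> to_fract P \<in> M"
  using M_I[of P 0] by simp

lemma M_subset_L: "u \<in> M \<Longrightarrow> u \<in> L"
proof -
  assume "u \<in> M"
  then obtain P k where "P \<in> ZP p" "u = to_fract P / to_fract D0 ^ k" unfolding M_eq by blast
  then show "u \<in> L" using L_I[OF _ denoms_power[OF denoms_D0, of k], of P] by (simp add: to_fract_power)
qed

sublocale M: subring_set M
proof
  show "1 \<in> M" using M_to_fract[of 1] by simp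
  fix x y assume "x \<in> M" "y \<in> M"
  then obtain P j Q k where *: "P \<in> ZP p" "Q \<in> ZP p"
      "x = to_fract P / to_fract D0 ^ j" "y = to_fract Q / to_fract D0 ^ k"
    unfolding M_eq by blast
  have "x + y = to_fract (P * D0 ^ k + Q * D0 ^ j) / to_fract D0 ^ (j + k)"
    using * D0_nonzero by (simp add: add_frac_eq power_add to_fract_power)
  then show "x + y \<in> M" using M_I[of "P * D0 ^ k + Q * D0 ^ j"] * D0_ZP by (simp del: to_fract_add)
  have "x * y = to_fract (P * Q) / to_fract D0 ^ (j + k)"
    using * by (simp add: power_add)
  then show "x * y \<in> M" using M_I[of "P * Q"] * by (simp del: to_fract_mult)
next
  fix x assume "x \<in> M"
  then obtain P j where *: "P \<in> ZP p" "x = to_fract P / to_fract D0 ^ j" unfolding M_eq by blast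
  then show "- x \<in> M" using M_I[of "- P" j] by simp
qed

lemma MR_simps [simp]: "u \<oplus>\<^bsub>MR\<^esub> v = u + v" "u \<otimes>\<^bsub>MR\<^esub> v = u * v" "\<one>\<^bsub>MR\<^esub> = 1" "\<zero>\<^bsub>MR\<^esub> = 0"
  by (simp_all add: M_inf_def)

sublocale MR: cring MR
proof (rule cringI[OF abelian_groupI comm_monoidI])
  show "\<exists>y\<in>M. y \<oplus>\<^bsub>MR\<^esub> x = \<zero>\<^bsub>MR\<^esub>" if "x \<in> M" for x
    using that by (intro bexI[of _ "- x"]) auto
qed (auto simp: algebra_simps)

lemma MR_add_pow: "u \<in> M \<Longrightarrow> [k] \<cdot>\<^bsub>MR\<^esub> u = of_nat k * u" for k :: nat
  by (induction k) (auto simp: algebra_simps)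

lemma mem_ppow_MR: "a \<in> ppow_ideal p MR n \<longleftrightarrow> (\<exists>m\<in>M. a = of_nat (p ^ n) * m)"
  unfolding MR.mem_ppow_ideal by (auto simp: MR_add_pow)

text \<open>A denominator is \<open>D0 ^ k * (1 - w)\<close> with \<open>w\<close> divisible by
  \<open>p\<close> in \<open>M\<close>, so the geometric series for its inverse may be truncated
  after \<open>n\<close> terms.\<close>

lemma L_approx: assumes "l \<in> L" shows "\<exists>m\<in>M. L.cg (p ^ n) m l"
proof -
  obtain a b where l: "l = to_fract a / to_fract b" "a \<in> ZP p" "b \<in> denoms"
    using assms unfolding L_def by blast
  obtain k c where c: "c \<in> ZP p" "b = D0 ^ k + of_nat p * c"
    using l(3) unfolding denoms_def by (auto elim: ZP.cgE)
  define d where "d = to_fract D0 ^ k"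
  define w where "w = - (of_nat p * to_fract c / d)"
  have d: "d \<noteq> 0" using D0_nonzero by (simp add: d_def)
  have b: "to_fract b = d * (1 - w)"
    using d unfolding c(2) w_def d_def by (simp add: to_fract_power to_fract_of_nat field_simps)
  have b0: "to_fract b \<noteq> 0" using denoms_nonzero[OF l(3)] by simp
  have cd: "to_fract c / d \<in> M" "inverse d \<in> M" "to_fract a / d \<in> M"
    using M_I[OF c(1), of k] M_I[of 1 k] M_I[OF l(2), of k] by (auto simp: d_def field_simps)
  have wM: "w \<in> M"
    unfolding w_def using cd(1) M.uminus_mem[OF M.mult_mem[OF M.of_nat_mem cd(1)]] by simp
  define m where "m = to_fract a / d * (\<Sum>i<n. w ^ i)"
  have "m \<in> M" unfolding m_def using cd wM by (intro M.mult_mem M.sum_mem) auto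
  moreover have "m - l = of_nat (p ^ n) * - (l * (- (to_fract c / d)) ^ n)"
  proof -
    have "(1 - w) * (\<Sum>i<n. w ^ i) = 1 - w ^ n" by (rule one_diff_power_eq[symmetric])
    then have "m * (d * (1 - w)) = to_fract a * (1 - w ^ n)"
      using d by (simp add: m_def mult.commute)
    then have "m = to_fract a * (1 - w ^ n) / to_fract b" using b0 unfolding b[symmetric] by (simp add: eq_divide_eq)
    then have "m = l * (1 - w ^ n)" by (simp add: l(1))
    moreover have "w ^ n = of_nat (p ^ n) * (- (to_fract c / d)) ^ n"
      unfolding w_def by (metis mult_minus_right of_nat_power power_mult_distrib times_divide_eq_right)
    ultimately show ?thesis by (simp add: algebra_simps)
  qed
  moreover have "- (l * (- (to_fract c / d)) ^ n) \<in> L"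
    using assms M_subset_L[OF cd(1)] by auto
  ultimately show ?thesis unfolding L.cg_def by blast
qed

text \<open>With the denominator written as \<open>d + p * c\<close>, clearing it gives
  \<open>m = p ^ n * (a / d) - p * (c / d) * m\<close>. If \<open>p ^ j\<close> divides
  \<open>m\<close> in \<open>M\<close> and \<open>j < n\<close>, the right side is divisible by
  \<open>p ^ (j + 1)\<close>.\<close>

lemma L_saturated:
  fixes m :: "zpoly fract"
  assumes m: "m \<in> M" and cg: "L.cg (p ^ n) m 0" shows "\<exists>m'\<in>M. m = of_nat (p ^ n) * m'"
proof -
  obtain l where "l \<in> L" "m = of_nat (p ^ n) * l" using cg by (auto elim: L.cgE)
  then obtain a b where l: "m = of_nat (p ^ n) * (to_fract a / to_fract b)" "a \<in> ZP p" "b \<in> denoms"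
    unfolding L_def by blast
  obtain k c where c: "c \<in> ZP p" "b = D0 ^ k + of_nat p * c"
    using l(3) unfolding denoms_def by (auto elim: ZP.cgE)
  define d where "d = to_fract D0 ^ k"
  have d: "d \<noteq> 0" using D0_nonzero by (simp add: d_def)
  have b0: "to_fract b \<noteq> 0" using denoms_nonzero[OF l(3)] by simp
  have b: "to_fract b = d + of_nat p * to_fract c"
    unfolding c(2) d_def by (simp add: to_fract_power to_fract_of_nat)
  have cd: "to_fract c / d \<in> M" "to_fract a / d \<in> M"
    using M_I[OF c(1), of k] M_I[OF l(2), of k] by (auto simp: d_def)
  have "m * (d + of_nat p * to_fract c) = of_nat (p ^ n) * to_fract a"
    using l(1) b0 b by simp
  then have rec: "m = of_nat (p ^ n) * (to_fract a / d) - of_nat p * (to_fract c / d) * m"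
    using d by (simp add: field_simps)
  have "\<exists>m'\<in>M. m = of_nat (p ^ j) * m'" if "j \<le> n" for j
    using that
  proof (induction j)
    case 0
    then show ?case using m by auto
  next
    case (Suc j)
    then obtain m' where m': "m' \<in> M" "m = of_nat (p ^ j) * m'" by auto
    have pn: "p ^ n = p ^ Suc j * p ^ (n - Suc j)" using Suc.prems by (simp flip: power_add power_Suc)
    have "m = of_nat (p ^ n) * (to_fract a / d) - of_nat p * (to_fract c / d) * (of_nat (p ^ j) * m')"
      by (subst rec) (simp add: m'(2))
    also have "\<dots> = of_nat (p ^ Suc j) * (of_nat (p ^ (n - Suc j)) * (to_fract a / d) - to_fract c / d * m')"
      unfolding pn by (simp add: algebra_simps)
    finally show ?case using cd m'(1) by (blast intro: M.diff_mem M.mult_mem M.of_nat_mem)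
  qed
  then show ?thesis by simp
qed

text \<open>The coset corresponding to \<open>l\<close>. As \<open>l\<close> need not lie in
  \<open>M\<close>, it is described by the elements of \<open>M\<close> that approximate
  \<open>l\<close> inside \<open>L\<close>.\<close>

definition \<sigma> :: "nat \<Rightarrow> zpoly fract \<Rightarrow> zpoly fract set" where
  "\<sigma> n l = {m \<in> M. L.cg (p ^ n) m l}"

lemma sigma_coset:
  fixes m :: "zpoly fract"
  assumes m: "m \<in> M" and cg: "L.cg (p ^ n) m l" shows "\<sigma> n l = ppow_ideal p MR n +>\<^bsub>MR\<^esub> m"
proof
  show "\<sigma> n l \<subseteq> ppow_ideal p MR n +>\<^bsub>MR\<^esub> m"
  proof
    fix x assume "x \<in> \<sigma> n l"
    then have x: "x \<in> M" "L.cg (p ^ n) x l" by (auto simp: \<sigma>_def)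
    have "L.cg (p ^ n) (x - m) (l - l)" using x cg by (intro L.cg_diff)
    then have "x - m \<in> ppow_ideal p MR n" unfolding mem_ppow_MR using L_saturated[of "x - m" n] x m by auto
    moreover have "x = (x - m) + m" by simp
    ultimately show "x \<in> ppow_ideal p MR n +>\<^bsub>MR\<^esub> m" unfolding a_r_coset_def' MR_simps by blast
  qed
  show "ppow_ideal p MR n +>\<^bsub>MR\<^esub> m \<subseteq> \<sigma> n l"
  proof
    fix x assume "x \<in> ppow_ideal p MR n +>\<^bsub>MR\<^esub> m"
    then obtain i where i: "i \<in> ppow_ideal p MR n" "x = i + m"
      unfolding a_r_coset_def' MR_simps by blast
    then obtain c where c: "c \<in> M" "x = of_nat (p ^ n) * c + m"
      unfolding mem_ppow_MR by blast
    have "L.cg (p ^ n) x m" using c(2) M_subset_L[OF c(1)] by (intro L.cgI[of c]) (simp_all add: add.commute)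
    then have "L.cg (p ^ n) x l" using cg by (rule L.cg_trans)
    moreover have "x \<in> M" unfolding c(2) using c(1) m by (intro M.add_mem M.mult_mem M.of_nat_mem)
    ultimately show "x \<in> \<sigma> n l" unfolding \<sigma>_def by simp
  qed
qed

sublocale S: presentation L MR p \<sigma>
proof
  fix n
  interpret I: ideal "ppow_ideal p MR n" MR by (rule MR.ppow_ideal_ideal)
  show "carrier (mod_ppow p MR n) = \<sigma> n ` L"
  proof -
    have "carrier (mod_ppow p MR n) = (\<lambda>m. ppow_ideal p MR n +>\<^bsub>MR\<^esub> m) ` M"
      by (auto simp: FactRing_def A_RCOSETS_def')
    also have "\<dots> = \<sigma> n ` L"
    proof
      show "(\<lambda>m. ppow_ideal p MR n +>\<^bsub>MR\<^esub> m) ` M \<subseteq> \<sigma> n ` L"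
      proof
        fix y assume "y \<in> (\<lambda>m. ppow_ideal p MR n +>\<^bsub>MR\<^esub> m) ` M"
        then obtain k where "k \<in> M" "y = ppow_ideal p MR n +>\<^bsub>MR\<^esub> k" by blast
        then have "y = \<sigma> n k" "k \<in> L" using sigma_coset[of k n k] M_subset_L by auto
        then show "y \<in> \<sigma> n ` L" by blast
      qed
      show "\<sigma> n ` L \<subseteq> (\<lambda>m. ppow_ideal p MR n +>\<^bsub>MR\<^esub> m) ` M"
      proof
        fix y assume "y \<in> \<sigma> n ` L"
        then obtain l where l: "l \<in> L" "y = \<sigma> n l" by blast
        obtain k where k: "k \<in> M" "L.cg (p ^ n) k l" using L_approx[OF l(1)] by blast
        then show "y \<in> (\<lambda>m. ppow_ideal p MR n +>\<^bsub>MR\<^esub> m) ` M"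
          unfolding l(2) sigma_coset[OF k] by (intro imageI)
      qed
    qed
    finally show ?thesis .
  qed
  show "\<sigma> n 1 = \<one>\<^bsub>mod_ppow p MR n\<^esub>"
    using sigma_coset[of 1 n 1] by (simp add: FactRing_def)
  fix a b assume a: "a \<in> L" and b: "b \<in> L"
  obtain m where m: "m \<in> M" "L.cg (p ^ n) m a" using L_approx[OF a] by blast
  obtain k where k: "k \<in> M" "L.cg (p ^ n) k b" using L_approx[OF b] by blast
  have "\<sigma> n (a + b) = ppow_ideal p MR n +>\<^bsub>MR\<^esub> (m + k)"
    using m k by (intro sigma_coset L.cg_add) auto
  also have "\<dots> = \<sigma> n a \<oplus>\<^bsub>mod_ppow p MR n\<^esub> \<sigma> n b"
    using I.a_rcos_sum[of m k] m k by (simp add: sigma_coset[OF m] sigma_coset[OF k] FactRing_def)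
  finally show "\<sigma> n (a + b) = \<sigma> n a \<oplus>\<^bsub>mod_ppow p MR n\<^esub> \<sigma> n b" .
  have "\<sigma> n (a * b) = ppow_ideal p MR n +>\<^bsub>MR\<^esub> (m * k)"
    using m k a b M_subset_L by (intro sigma_coset L.cg_mult) auto
  also have "\<dots> = \<sigma> n a \<otimes>\<^bsub>mod_ppow p MR n\<^esub> \<sigma> n b"
    using I.rcoset_mult_add[of m k] m k by (simp add: sigma_coset[OF m] sigma_coset[OF k] FactRing_def)
  finally show "\<sigma> n (a * b) = \<sigma> n a \<otimes>\<^bsub>mod_ppow p MR n\<^esub> \<sigma> n b" .
  show "\<sigma> n a = \<sigma> n b \<longleftrightarrow> L.cg (p ^ n) a b"
  proof
    assume "\<sigma> n a = \<sigma> n b"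
    moreover have "m \<in> \<sigma> n a" using m by (simp add: \<sigma>_def)
    ultimately have "L.cg (p ^ n) m b" by (simp add: \<sigma>_def)
    then show "L.cg (p ^ n) a b" by (rule L.cg_trans[OF L.cg_sym[OF m(2)]])
  next
    assume ab: "L.cg (p ^ n) a b"
    show "\<sigma> n a = \<sigma> n b"
      unfolding \<sigma>_def using L.cg_trans[OF _ ab] L.cg_trans[OF _ L.cg_sym[OF ab]] by blast
  qed
next
  fix l n assume "l \<in> L"
  then obtain m where m: "m \<in> M" "L.cg (p ^ Suc n) m l" using L_approx by blast
  then have "L.cg (p ^ n) m l" using L.cg_le[OF m(2), of n] by simp
  then show "ppow_proj p MR n (\<sigma> (Suc n) l) = \<sigma> n l"
    using sigma_coset[OF m] sigma_coset[OF m(1)] MR.ppow_proj_coset[OF m(1)] by simp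
next
  show "a = b" if "of_nat p * a = of_nat p * (b :: zpoly fract)" for a b
    using that p_gt_3 by simp
qed

section \<open>The universal Frobenius lift on the completed base\<close>

abbreviation SR where "SR \<equiv> S_ring p H"

lemma SR_eq: "SR = S.C"
  by (simp add: S_ring_def)

lemma to_completion_M: "u \<in> M \<Longrightarrow> to_completion p MR u = S.lim (\<lambda>_. u)"
  unfolding to_completion_def S.lim_def by (rule ext) (rule sigma_coset[symmetric, OF _ L.cg_refl])

lemma S_of_eq: "P \<in> ZP p \<Longrightarrow> S_of p H P = S.lim (\<lambda>_. to_fract P)"
  unfolding S_of_def by (intro to_completion_M M_to_fract)

lemma phi_family: "S.hom_family (\<lambda>_. phi)"
proof -
  have "L.cg q (phi b) (phi c)" if cg: "L.cg q b c" for q b c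
  proof -
    obtain d where "d \<in> L" "b = c + of_nat q * d" using cg by (rule L.cgE)
    then show ?thesis by (intro L.cgI[of "phi d"]) (auto simp: phi_hom phi_L)
  qed
  then show ?thesis unfolding S.hom_family_def by (auto simp: phi_hom phi_L)
qed

text \<open>The elements of \<open>L\<close> on whose constant sequences \<open>h\<close> acts as
  \<open>phi\<close> form a ring containing the variables and closed under the inverses that exist
  in \<open>L\<close>, hence all of \<open>L\<close>. At level \<open>n\<close> a general element
  agrees with the constant sequence of its \<open>n\<close>-th term, so
  \<open>hom_level_cong\<close> extends the agreement to the completion.\<close>

lemma univ_frob_unique:
  assumes h: "h \<in> ring_hom S.C S.C"
    and z4: "\<And>i. h (S_of p H (z4 i)) = S_of p H (z4 i) [^]\<^bsub>S.C\<^esub> p \<oplus>\<^bsub>S.C\<^esub> [p] \<cdot>\<^bsub>S.C\<^esub> S_of p H (z4 (Suc i))"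
    and z6: "\<And>i. h (S_of p H (z6 i)) = S_of p H (z6 i) [^]\<^bsub>S.C\<^esub> p \<oplus>\<^bsub>S.C\<^esub> [p] \<cdot>\<^bsub>S.C\<^esub> S_of p H (z6 (Suc i))"
    and f: "f \<in> carrier S.C"
  shows "h f = S.lim_map (\<lambda>_. phi) f"
proof -
  interpret h: ring_hom_cring S.C S.C h
    using h by (intro ring_hom_cring.intro ring_hom_cring_axioms.intro S.C.is_cring)
  define T where "T = {l \<in> L. h (S.lim (\<lambda>_. l)) = S.lim (\<lambda>_. phi l)}"
  have T_add: "a + b \<in> T" and T_mult: "a * b \<in> T" if "a \<in> T" "b \<in> T" for a b
    using that unfolding T_def
    by (auto simp: phi_hom phi_L simp flip: S.lim_add[OF S.coherent_const S.coherent_const]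
        S.lim_mult[OF S.coherent_const S.coherent_const])
  have T_1: "1 \<in> T" unfolding T_def using h.hom_one by (auto simp: phi_hom S.lim_one)
  have T_uminus: "- a \<in> T" if "a \<in> T" for a
    using that unfolding T_def
    by (auto simp: phi_uminus phi_L simp flip: S.lim_uminus[OF S.coherent_const])
  interpret T: subring_set T
    by unfold_locales (auto intro: T_add T_mult T_1 T_uminus)
  have T_inverse: "inverse l \<in> T" if l: "l \<in> T" "l \<noteq> 0" "inverse l \<in> L" for l
  proof -
    have lL: "l \<in> L" "h (S.lim (\<lambda>_. l)) = S.lim (\<lambda>_. phi l)" using l by (auto simp: T_def)
    have "h (S.lim (\<lambda>_. inverse l)) \<otimes>\<^bsub>S.C\<^esub> h (S.lim (\<lambda>_. l)) =
        h (S.lim (\<lambda>_. inverse l) \<otimes>\<^bsub>S.C\<^esub> S.lim (\<lambda>_. l))"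
      using lL l by (intro h.hom_mult[symmetric]) auto
    also have "\<dots> = \<one>\<^bsub>S.C\<^esub>"
      using lL l h.hom_one by (simp add: S.lim_mult S.lim_one)
    finally have "h (S.lim (\<lambda>_. inverse l)) \<otimes>\<^bsub>S.C\<^esub> S.lim (\<lambda>_. phi l) = \<one>\<^bsub>S.C\<^esub>"
      unfolding lL(2) .
    moreover have "phi l * phi (inverse l) = phi (l * inverse l)" by (rule phi_hom(2)[symmetric])
    then have "phi l * phi (inverse l) = 1" using l(2) by (simp add: phi_hom(3))
    then have "S.lim (\<lambda>_. phi l) \<otimes>\<^bsub>S.C\<^esub> S.lim (\<lambda>_. phi (inverse l)) = \<one>\<^bsub>S.C\<^esub>"
      using lL l by (simp add: S.lim_mult phi_L S.lim_one)
    ultimately have "h (S.lim (\<lambda>_. inverse l)) = S.lim (\<lambda>_. phi (inverse l))"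
      by (rule S.C.inv_unique)
        (use phi_L[OF lL(1)] phi_L[OF l(3)] l(3) in \<open>simp_all add: S.coherent_const S.lim_closed\<close>)
    then show ?thesis using l(3) by (simp add: T_def)
  qed
  have T_nat: "inverse (of_nat n) \<in> T" if "\<not> p dvd n" for n
  proof -
    have "n \<noteq> 0" using that by (intro notI) simp
    then show ?thesis using inverse_of_nat_mem[OF that] by (intro T_inverse) auto
  qed
  have of_int: "to_fract (zconst (of_int a)) = of_int a" for a
    by (cases a rule: int_cases2) (auto simp: zconst_hom zconst_of_nat to_fract_of_nat)
  have T_const: "to_fract (zconst c) \<in> T" if c: "c \<in> Z_loc p" for c
  proof -
    obtain a b where ab: "c = of_int a / of_int b" "\<not> int p dvd b"
      using c unfolding Z_loc_def by blast
    then have "b \<noteq> 0" by auto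
    have "zconst c * zconst (of_int b) = zconst (of_int a)"
      using ab \<open>b \<noteq> 0\<close> by (simp flip: zconst_hom)
    then have "to_fract (zconst c) * of_int b = of_int a"
      by (metis of_int to_fract_mult)
    then have "to_fract (zconst c) = of_int a * inverse (of_int b)"
      using \<open>b \<noteq> 0\<close> by (simp add: field_simps)
    moreover have "inverse (of_int b) \<in> T"
    proof (cases b rule: int_cases2)
      case (nonneg n)
      then show ?thesis using ab T_nat[of n] by simp
    next
      case (nonpos n)
      then show ?thesis using ab T_nat[of n] T_uminus[of "inverse (of_nat n)"] by simp
    qed
    ultimately show ?thesis by auto
  qed
  have T_var: "to_fract (zvar i) \<in> T" for i
  proof -
    have zv: "zvar i \<in> ZP p" "zvar (i + 2) \<in> ZP p" using zvar_ZP[OF p_prime] by auto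
    have "h (S_of p H (zvar i)) = S_of p H (zvar i) [^]\<^bsub>S.C\<^esub> p \<oplus>\<^bsub>S.C\<^esub> [p] \<cdot>\<^bsub>S.C\<^esub> S_of p H (zvar (i + 2))"
    proof (cases "even i")
      case True
      then obtain j where "i = 2 * j" by (elim evenE)
      then show ?thesis using z4[of j] by (simp add: z_zvar)
    next
      case False
      then obtain j where "i = 2 * j + 1" by (elim oddE)
      then show ?thesis using z6[of j] by (simp add: z_zvar)
    qed
    also have "\<dots> = S.lim (\<lambda>_. to_fract (zvar i) ^ p + of_nat p * to_fract (zvar (i + 2)))"
      using zv L_to_fract by (simp add: S_of_eq S.lim_power S.lim_add_pow S.lim_add)
    also have "\<dots> = S.lim (\<lambda>_. phi (to_fract (zvar i)))"
      by (simp add: phi_to_fract lift.subst_var lift_var_def to_fract_power to_fract_of_nat)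
    finally show ?thesis using zv L_to_fract by (auto simp: T_def S_of_eq)
  qed
  have T_ZP: "to_fract P \<in> T" if "P \<in> ZP p" for P
    by (rule zpoly_induct[of P "Z_loc p"]) (use that T_const T_var in \<open>auto simp: ZP_def\<close>)
  have T_L: "l \<in> T" if lL: "l \<in> L" for l
  proof -
    obtain a b where l: "l = to_fract a / to_fract b" "a \<in> ZP p" "b \<in> denoms"
      using lL unfolding L_def by blast
    have "inverse (to_fract b) \<in> T"
      using denoms_nonzero[OF l(3)] denoms_ZP[OF l(3)] L_I[OF _ l(3), of 1]
      by (intro T_inverse T_ZP) (auto simp: field_simps)
    then show ?thesis unfolding l(1) divide_inverse using T_ZP[OF l(2)] by auto
  qed
  show ?thesis
  proof
    fix n
    obtain b where b: "S.coherent b" "f = S.lim b" using f by (rule S.lim_exhaust)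
    have bn: "b n \<in> L" using S.coherentD[OF b(1)] by simp
    have "S.lim (\<lambda>_. b n) \<in> carrier S.C" using bn by (intro S.lim_closed S.coherent_const)
    then have "h f n = h (S.lim (\<lambda>_. b n)) n"
      by (intro S.hom_level_cong[OF h f]) (simp_all add: b S.lim_def)
    also have "\<dots> = \<sigma> n (phi (b n))" using T_L[OF bn] by (simp add: T_def S.lim_def)
    also have "\<dots> = S.lim_map (\<lambda>_. phi) f n"
      by (rule S.lim_map_level[OF phi_family bn, symmetric]) (simp add: b S.lim_def)
    finally show "h f n = S.lim_map (\<lambda>_. phi) f n" .
  qed
qed

lemma univ_frob_eq: "univ_frob p H = restrict (S.lim_map (\<lambda>_. phi)) (carrier S.C)"
  unfolding univ_frob_def SR_eq
proof (rule the_equality)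
  let ?h = "restrict (S.lim_map (\<lambda>_. phi)) (carrier S.C)"
  have "?h \<in> ring_hom S.C S.C"
  proof -
    interpret h: ring_hom_cring S.C S.C "S.lim_map (\<lambda>_. phi)"
      by (intro ring_hom_cring.intro ring_hom_cring_axioms.intro S.C.is_cring S.lim_map_hom phi_family)
    show ?thesis by (rule ring_hom_memI) auto
  qed
  moreover have "?h (S_of p H (zvar i)) =
      S_of p H (zvar i) [^]\<^bsub>S.C\<^esub> p \<oplus>\<^bsub>S.C\<^esub> [p] \<cdot>\<^bsub>S.C\<^esub> S_of p H (zvar (i + 2))" for i
    using zvar_ZP[OF p_prime] L_to_fract
    by (simp add: S_of_eq S.lim_map_lim[OF phi_family] phi_to_fract lift.subst_var lift_var_def
        to_fract_power to_fract_of_nat S.lim_power S.lim_add_pow S.lim_add)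
  ultimately show "?h \<in> ring_hom S.C S.C \<and> ?h \<in> extensional (carrier S.C) \<and>
    (\<forall>i. ?h (S_of p H (z4 i)) = S_of p H (z4 i) [^]\<^bsub>S.C\<^esub> p \<oplus>\<^bsub>S.C\<^esub> [p] \<cdot>\<^bsub>S.C\<^esub> S_of p H (z4 (Suc i))) \<and>
    (\<forall>i. ?h (S_of p H (z6 i)) = S_of p H (z6 i) [^]\<^bsub>S.C\<^esub> p \<oplus>\<^bsub>S.C\<^esub> [p] \<cdot>\<^bsub>S.C\<^esub> S_of p H (z6 (Suc i)))"
    by (simp add: z_zvar)
  fix h assume "h \<in> ring_hom S.C S.C \<and> h \<in> extensional (carrier S.C) \<and>
    (\<forall>i. h (S_of p H (z4 i)) = S_of p H (z4 i) [^]\<^bsub>S.C\<^esub> p \<oplus>\<^bsub>S.C\<^esub> [p] \<cdot>\<^bsub>S.C\<^esub> S_of p H (z4 (Suc i))) \<and>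
    (\<forall>i. h (S_of p H (z6 i)) = S_of p H (z6 i) [^]\<^bsub>S.C\<^esub> p \<oplus>\<^bsub>S.C\<^esub> [p] \<cdot>\<^bsub>S.C\<^esub> S_of p H (z6 (Suc i)))"
  then show "h = ?h"
    using univ_frob_unique[of h] by (intro extensionalityI[of h "carrier S.C" ?h]) auto
qed

lemma univ_frob_lim: "S.coherent t \<Longrightarrow> univ_frob p H (S.lim t) = S.lim (\<lambda>n. phi (t n))"
  by (simp add: univ_frob_eq S.lim_map_lim[OF phi_family])

lemma inv_S_of_H: "inv\<^bsub>SR\<^esub> (S_of p H H) = S.lim (\<lambda>_. Hinv)"
proof -
  have coh: "S.coherent (\<lambda>_. to_fract H)" "S.coherent (\<lambda>_. Hinv)"
    using h_mem L_to_fract[OF H_ZP] by (blast intro: S.coherent_const)+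
  have "to_fract H * Hinv = 1" using H_Delta_nonzero(1) by (metis right_inverse to_fract_eq_0_iff)
  then have "S.lim (\<lambda>_. to_fract H) \<otimes>\<^bsub>S.C\<^esub> S.lim (\<lambda>_. Hinv) = \<one>\<^bsub>S.C\<^esub>"
    unfolding S.lim_mult[OF coh] S.lim_one by (simp only:)
  then show ?thesis
    unfolding SR_eq S_of_eq[OF H_ZP] by (intro S.C.comm_inv_char S.lim_closed coh)
qed

end

section \<open>The affine Weierstrass ring\<close>

text \<open>The case in which an actual map \<open>\<iota>\<close> exists: density of its image
  makes the induced maps modulo \<open>p ^ n\<close> surjective, and reflecting divisibility makes
  them injective.\<close>

lemma presentation_of_hom:
  fixes A :: "('a, 'm) ring_scheme" and B :: "'b :: comm_ring_1 set" and \<iota> :: "'b \<Rightarrow> 'a"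
  assumes A: "cring A" and B: "subring_set B"
    and closed: "\<And>b. b \<in> B \<Longrightarrow> \<iota> b \<in> carrier A"
    and add: "\<And>b c. b \<in> B \<Longrightarrow> c \<in> B \<Longrightarrow> \<iota> (b + c) = \<iota> b \<oplus>\<^bsub>A\<^esub> \<iota> c"
    and mult: "\<And>b c. b \<in> B \<Longrightarrow> c \<in> B \<Longrightarrow> \<iota> (b * c) = \<iota> b \<otimes>\<^bsub>A\<^esub> \<iota> c"
    and one: "\<iota> 1 = \<one>\<^bsub>A\<^esub>"
    and dense: "\<And>a n. a \<in> carrier A \<Longrightarrow> \<exists>b\<in>B. \<exists>c\<in>carrier A. a = [(p ^ n)] \<cdot>\<^bsub>A\<^esub> c \<oplus>\<^bsub>A\<^esub> \<iota> b"
    and reflect: "\<And>b c n. b \<in> B \<Longrightarrow> c \<in> carrier A \<Longrightarrow> \<iota> b = [(p ^ n)] \<cdot>\<^bsub>A\<^esub> c \<Longrightarrow>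
      subring_set.cg B (p ^ n) b 0"
    and tf: "\<And>a b. of_nat p * a = of_nat p * (b :: 'b) \<Longrightarrow> a = b"
  shows "presentation B A p (\<lambda>n b. ppow_ideal p A n +>\<^bsub>A\<^esub> \<iota> b)"
proof -
  interpret A: cring A by (rule A)
  interpret B: subring_set B by (rule B)
  have zero: "\<iota> 0 = \<zero>\<^bsub>A\<^esub>"
    using add[of 0 0] closed[of 0] A.add.l_cancel_one'[of "\<iota> 0" "\<iota> 0"] by simp
  have uminus: "\<iota> (- b) = \<ominus>\<^bsub>A\<^esub> \<iota> b" if "b \<in> B" for b
    using add[of "- b" b] that closed by (intro A.minus_equality[symmetric]) (auto simp: zero)
  have of_nat: "\<iota> (of_nat k * b) = [k] \<cdot>\<^bsub>A\<^esub> \<iota> b" if "b \<in> B" for k b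
    using that by (induction k) (auto simp: zero add distrib_right A.add.m_comm closed)
  show ?thesis
  proof (intro presentation.intro B A presentation_axioms.intro)
    fix n
    interpret I: ideal "ppow_ideal p A n" A by (rule A.ppow_ideal_ideal)
    show "carrier (mod_ppow p A n) = (\<lambda>b. ppow_ideal p A n +>\<^bsub>A\<^esub> \<iota> b) ` B"
    proof
      show "carrier (mod_ppow p A n) \<subseteq> (\<lambda>b. ppow_ideal p A n +>\<^bsub>A\<^esub> \<iota> b) ` B"
      proof
        fix X assume "X \<in> carrier (mod_ppow p A n)"
        then obtain a where a: "a \<in> carrier A" "X = ppow_ideal p A n +>\<^bsub>A\<^esub> a"
          by (auto simp: FactRing_def A_RCOSETS_def')
        then obtain b c where bc: "b \<in> B" "c \<in> carrier A" "a = [(p ^ n)] \<cdot>\<^bsub>A\<^esub> c \<oplus>\<^bsub>A\<^esub> \<iota> b"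
          using dense by blast
        then have "[(p ^ n)] \<cdot>\<^bsub>A\<^esub> c \<in> ppow_ideal p A n" unfolding A.mem_ppow_ideal by blast
        then have "a \<in> ppow_ideal p A n +>\<^bsub>A\<^esub> \<iota> b" unfolding a_r_coset_def' bc(3) by blast
        then have "X = ppow_ideal p A n +>\<^bsub>A\<^esub> \<iota> b"
          using I.a_repr_independence'[OF _ closed[OF bc(1)]] a(2) by simp
        then show "X \<in> (\<lambda>b. ppow_ideal p A n +>\<^bsub>A\<^esub> \<iota> b) ` B" using bc(1) by blast
      qed
      show "(\<lambda>b. ppow_ideal p A n +>\<^bsub>A\<^esub> \<iota> b) ` B \<subseteq> carrier (mod_ppow p A n)"
        using closed by (auto simp: FactRing_def A_RCOSETS_def')
    qed
    show "ppow_ideal p A n +>\<^bsub>A\<^esub> \<iota> 1 = \<one>\<^bsub>mod_ppow p A n\<^esub>"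
      by (simp add: FactRing_def one)
    fix b c assume b: "b \<in> B" and c: "c \<in> B"
    show "ppow_ideal p A n +>\<^bsub>A\<^esub> \<iota> (b + c) =
        (ppow_ideal p A n +>\<^bsub>A\<^esub> \<iota> b) \<oplus>\<^bsub>mod_ppow p A n\<^esub> (ppow_ideal p A n +>\<^bsub>A\<^esub> \<iota> c)"
      using I.a_rcos_sum[OF closed[OF b] closed[OF c]] by (simp add: FactRing_def add[OF b c])
    show "ppow_ideal p A n +>\<^bsub>A\<^esub> \<iota> (b * c) =
        (ppow_ideal p A n +>\<^bsub>A\<^esub> \<iota> b) \<otimes>\<^bsub>mod_ppow p A n\<^esub> (ppow_ideal p A n +>\<^bsub>A\<^esub> \<iota> c)"
      using I.rcoset_mult_add[OF closed[OF b] closed[OF c]] by (simp add: FactRing_def mult[OF b c])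
    have iff: "(ppow_ideal p A n +>\<^bsub>A\<^esub> \<iota> b = ppow_ideal p A n +>\<^bsub>A\<^esub> \<iota> c) \<longleftrightarrow>
        \<iota> b \<ominus>\<^bsub>A\<^esub> \<iota> c \<in> ppow_ideal p A n"
      using I.a_rcos_module_minus[OF A.ring_axioms closed[OF c] closed[OF b]]
        I.a_repr_independence'[OF _ closed[OF c], of "\<iota> b"] I.a_rcos_self[OF closed[OF b]] by metis
    have diff: "\<iota> b \<ominus>\<^bsub>A\<^esub> \<iota> c = \<iota> (b - c)"
      using add[of b "- c"] b c uminus by (simp add: a_minus_def)
    show "(ppow_ideal p A n +>\<^bsub>A\<^esub> \<iota> b = ppow_ideal p A n +>\<^bsub>A\<^esub> \<iota> c) \<longleftrightarrow> B.cg (p ^ n) b c"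
      unfolding iff diff A.mem_ppow_ideal
    proof
      assume "\<exists>d\<in>carrier A. \<iota> (b - c) = [(p ^ n)] \<cdot>\<^bsub>A\<^esub> d"
      then have "B.cg (p ^ n) (b - c) 0" using reflect[of "b - c"] b c by blast
      then show "B.cg (p ^ n) b c" by (simp add: B.cg_def)
    next
      assume "B.cg (p ^ n) b c"
      then obtain d where "d \<in> B" "b - c = of_nat (p ^ n) * d" unfolding B.cg_def by blast
      then show "\<exists>d\<in>carrier A. \<iota> (b - c) = [(p ^ n)] \<cdot>\<^bsub>A\<^esub> d"
        using of_nat[of d "p ^ n"] closed by metis
    qed
    show "ppow_proj p A n (ppow_ideal p A (Suc n) +>\<^bsub>A\<^esub> \<iota> b) = ppow_ideal p A n +>\<^bsub>A\<^esub> \<iota> b"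
      using A.ppow_proj_coset[OF closed[OF b]] .
  qed (rule tf)
qed

locale weierstrass = cring R for R (structure) +
  fixes a b
  assumes a_closed: "a \<in> carrier R" and b_closed: "b \<in> carrier R"
begin

sublocale U: UP_cring R "UP R"
  by unfold_locales (rule reflexive)

sublocale V: UP_cring "UP R" "UP (UP R)"
  by unfold_locales (rule reflexive)

abbreviation U where "U \<equiv> UP R"
abbreviation V where "V \<equiv> UP (UP R)"
abbreviation I where "I \<equiv> weierstrass_ideal R a b"
abbreviation A where "A \<equiv> weierstrass_ring R a b"

definition fpol where
  "fpol = up_ring.monom U \<one> 3 \<oplus>\<^bsub>U\<^esub> up_ring.monom U a 1 \<oplus>\<^bsub>U\<^esub> up_ring.monom U b 0"

lemma fpol_closed [simp, intro]: "fpol \<in> carrier U"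
  using a_closed b_closed by (auto simp: fpol_def)

definition gen where
  "gen = up_ring.monom V \<one>\<^bsub>U\<^esub> 2 \<ominus>\<^bsub>V\<^esub> up_ring.monom V fpol 0"

lemma gen_closed [simp, intro]: "gen \<in> carrier V"
  by (auto simp: gen_def)

lemma ideal_eq: "I = PIdl\<^bsub>V\<^esub> gen"
proof -
  have c: "up_ring.monom U a 0 \<in> carrier U" "up_ring.monom U b 0 \<in> carrier U"
      "up_ring.monom U \<one> 1 \<in> carrier U" "up_ring.monom U \<one> 3 \<in> carrier U" "up_ring.monom U a 1 \<in> carrier U"
    using a_closed b_closed by auto
  have "var_y R [^]\<^bsub>V\<^esub> (2::nat) = up_ring.monom V \<one>\<^bsub>U\<^esub> 2"
    unfolding var_y_def by (subst V.monom_pow) auto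
  moreover have "var_x R [^]\<^bsub>V\<^esub> (3::nat) = up_ring.monom V (up_ring.monom U \<one> 3) 0"
    unfolding var_x_def using c by (subst V.monom_pow) (auto simp: U.monom_pow)
  moreover have "const_xy R a \<otimes>\<^bsub>V\<^esub> var_x R = up_ring.monom V (up_ring.monom U a 1) 0"
    unfolding const_xy_def var_x_def using c a_closed V.monom_mult[OF c(1,3), of 0 0]
      U.monom_mult[OF a_closed one_closed, of 0 1] by simp
  moreover have "up_ring.monom V (up_ring.monom U \<one> 3) 0 \<oplus>\<^bsub>V\<^esub> up_ring.monom V (up_ring.monom U a 1) 0
      \<oplus>\<^bsub>V\<^esub> const_xy R b = up_ring.monom V fpol 0"
    unfolding const_xy_def fpol_def using c
    by (subst V.monom_add, auto)+
  ultimately show ?thesis unfolding weierstrass_ideal_def gen_def by simp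
qed

lemma I_ideal: "ideal I V"
  unfolding ideal_eq by (rule V.P.cgenideal_ideal) auto

lemma A_eq: "A = V Quot I"
  by (simp add: weierstrass_ring_def)

sublocale A: cring A
  unfolding A_eq by (rule ideal.quotient_is_cring[OF I_ideal V.P.is_cring])

lemma class_hom: "weierstrass_class R a b \<in> ring_hom V A"
  unfolding A_eq using ideal.rcos_ring_hom[OF I_ideal] by (simp add: weierstrass_class_def[abs_def])

sublocale cl: ring_hom_cring V A "weierstrass_class R a b"
  by (intro ring_hom_cring.intro ring_hom_cring_axioms.intro class_hom V.P.is_cring A.is_cring)

definition cst where "cst P = weierstrass_class R a b (up_ring.monom V P 0)"
definition yb where "yb = weierstrass_class R a b (var_y R)"

lemma cst_hom: "cst \<in> ring_hom U A"
proof -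
  have "weierstrass_class R a b \<circ> (\<lambda>P. up_ring.monom V P 0) \<in> ring_hom U A"
    by (rule ring_hom_trans[OF V.const_ring_hom class_hom])
  then show ?thesis by (simp add: comp_def cst_def[abs_def])
qed

sublocale cst: ring_hom_cring U A cst
  by (intro ring_hom_cring.intro ring_hom_cring_axioms.intro cst_hom U.P.is_cring A.is_cring)

lemma var_y_closed: "var_y R \<in> carrier V"
  unfolding var_y_def by auto

lemma yb_closed [simp, intro]: "yb \<in> carrier A"
  unfolding yb_def using var_y_closed by auto

lemma yb_square: "yb \<otimes>\<^bsub>A\<^esub> yb = cst fpol"
proof -
  interpret I: ideal I V by (rule I_ideal)
  have "var_y R \<otimes>\<^bsub>V\<^esub> var_y R = up_ring.monom V \<one>\<^bsub>U\<^esub> 2"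
    unfolding var_y_def using V.monom_mult[of "\<one>\<^bsub>U\<^esub>" "\<one>\<^bsub>U\<^esub>" 1 1] by (simp add: numeral_2_eq_2)
  then have "yb \<otimes>\<^bsub>A\<^esub> yb = weierstrass_class R a b (up_ring.monom V \<one>\<^bsub>U\<^esub> 2)"
    unfolding yb_def using var_y_closed by (simp flip: cl.hom_mult)
  also have "up_ring.monom V \<one>\<^bsub>U\<^esub> 2 = gen \<oplus>\<^bsub>V\<^esub> up_ring.monom V fpol 0"
    unfolding gen_def by (simp add: a_minus_def V.P.a_assoc V.P.l_neg)
  also have "weierstrass_class R a b \<dots> = weierstrass_class R a b gen \<oplus>\<^bsub>A\<^esub> cst fpol"
    unfolding cst_def by simp
  also have "weierstrass_class R a b gen = \<zero>\<^bsub>A\<^esub>"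
    unfolding weierstrass_class_def A_eq using I.a_rcos_const[of gen] V.P.cgenideal_self[OF gen_closed]
    by (simp add: FactRing_def ideal_eq)
  finally show ?thesis by simp
qed

text \<open>The set \<open>T\<close> contains the constants and is closed under addition and under
  multiplication by \<open>yb\<close>, because \<open>yb\<close> squares to the constant
  \<open>fpol\<close>; so it absorbs all monomials in \<open>y\<close>.\<close>

lemma exhaust:
  assumes "f \<in> carrier A"
  obtains P Q where "P \<in> carrier U" "Q \<in> carrier U" "f = cst P \<oplus>\<^bsub>A\<^esub> cst Q \<otimes>\<^bsub>A\<^esub> yb"
proof -
  define T where "T = {cst P \<oplus>\<^bsub>A\<^esub> cst Q \<otimes>\<^bsub>A\<^esub> yb | P Q. P \<in> carrier U \<and> Q \<in> carrier U}"
  have T_cst: "cst P \<in> T" if "P \<in> carrier U" for P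
    unfolding T_def using that by (intro CollectI exI[of _ P] exI[of _ "\<zero>\<^bsub>U\<^esub>"]) auto
  have T_add: "u \<oplus>\<^bsub>A\<^esub> v \<in> T" if uv: "u \<in> T" "v \<in> T" for u v
  proof -
    obtain P Q P' Q' where *: "P \<in> carrier U" "Q \<in> carrier U" "P' \<in> carrier U" "Q' \<in> carrier U"
        "u = cst P \<oplus>\<^bsub>A\<^esub> cst Q \<otimes>\<^bsub>A\<^esub> yb" "v = cst P' \<oplus>\<^bsub>A\<^esub> cst Q' \<otimes>\<^bsub>A\<^esub> yb"
      using uv unfolding T_def by blast
    have "u \<oplus>\<^bsub>A\<^esub> v = cst (P \<oplus>\<^bsub>U\<^esub> P') \<oplus>\<^bsub>A\<^esub> cst (Q \<oplus>\<^bsub>U\<^esub> Q') \<otimes>\<^bsub>A\<^esub> yb"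
      using * by (simp add: A.l_distr A.a_ac)
    then show ?thesis unfolding T_def using * by blast
  qed
  have T_yb: "u \<otimes>\<^bsub>A\<^esub> yb \<in> T" if u: "u \<in> T" for u
  proof -
    obtain P Q where *: "P \<in> carrier U" "Q \<in> carrier U" "u = cst P \<oplus>\<^bsub>A\<^esub> cst Q \<otimes>\<^bsub>A\<^esub> yb"
      using u unfolding T_def by blast
    have "u \<otimes>\<^bsub>A\<^esub> yb = cst (Q \<otimes>\<^bsub>U\<^esub> fpol) \<oplus>\<^bsub>A\<^esub> cst P \<otimes>\<^bsub>A\<^esub> yb"
      using * by (simp add: A.l_distr A.m_assoc yb_square A.a_comm)
    then show ?thesis unfolding T_def using * by blast
  qed
  have T_monom: "weierstrass_class R a b (up_ring.monom V P i) \<in> T" if P: "P \<in> carrier U" for P i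
  proof (induction i)
    case 0
    then show ?case using T_cst[OF P] by (simp add: cst_def)
  next
    case (Suc i)
    have "up_ring.monom V P (Suc i) = up_ring.monom V P i \<otimes>\<^bsub>V\<^esub> var_y R"
      unfolding var_y_def using V.monom_mult[of P "\<one>\<^bsub>U\<^esub>" i 1] P by simp
    then show ?case using T_yb[OF Suc] P var_y_closed unfolding yb_def by simp
  qed
  obtain g where g: "g \<in> carrier V" "f = weierstrass_class R a b g"
    using assms unfolding A_eq weierstrass_class_def by (auto simp: FactRing_def A_RCOSETS_def')
  have fin: "weierstrass_class R a b (\<Oplus>\<^bsub>V\<^esub>i\<in>S. up_ring.monom V (up_ring.coeff V g i) i) \<in> T"
    if "finite S" for S
    using that
  proof (induction S rule: finite_induct)
    case empty
    then show ?case using T_cst[of "\<zero>\<^bsub>U\<^esub>"] by simp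
  next
    case (insert i S)
    then show ?case using g(1) T_add T_monom by (subst V.P.finsum_insert) auto
  qed
  have "f \<in> T" using fin[of "{..deg U g}"] V.up_repr[OF g(1)] g(2) by simp
  then show ?thesis using that unfolding T_def by blast
qed

text \<open>If \<open>P + Q y = G (y ^ 2 - fpol)\<close>, comparing coefficients from
  \<open>y ^ 2\<close> on shows \<open>c n = fpol * c (n + 2)\<close> for the coefficients of
  \<open>G\<close>. They vanish for large \<open>n\<close>, hence everywhere.\<close>

lemma basis:
  assumes P: "P \<in> carrier U" and Q: "Q \<in> carrier U" and zero: "cst P \<oplus>\<^bsub>A\<^esub> cst Q \<otimes>\<^bsub>A\<^esub> yb = \<zero>\<^bsub>A\<^esub>"
  shows "P = \<zero>\<^bsub>U\<^esub>" "Q = \<zero>\<^bsub>U\<^esub>"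
proof -
  interpret I: ideal I V by (rule I_ideal)
  define g where "g = up_ring.monom V P 0 \<oplus>\<^bsub>V\<^esub> up_ring.monom V Q 1"
  have g: "g \<in> carrier V" using P Q by (auto simp: g_def)
  have "up_ring.monom V Q 1 = up_ring.monom V Q 0 \<otimes>\<^bsub>V\<^esub> var_y R"
    unfolding var_y_def using V.monom_mult[of Q "\<one>\<^bsub>U\<^esub>" 0 1] Q by simp
  then have "weierstrass_class R a b g = cst P \<oplus>\<^bsub>A\<^esub> cst Q \<otimes>\<^bsub>A\<^esub> yb"
    unfolding g_def cst_def yb_def using P Q var_y_closed by simp
  then have "weierstrass_class R a b g = I" using zero by (simp add: A_eq FactRing_def)
  then have "g \<in> I" using I.a_rcos_self[OF g] by (simp add: weierstrass_class_def)
  then obtain G where G: "G \<in> carrier V" "g = G \<otimes>\<^bsub>V\<^esub> gen"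
    unfolding ideal_eq cgenideal_def by blast
  define c where "c = up_ring.coeff V G"
  have c: "c n \<in> carrier U" for n using G by (simp add: c_def)
  have expand: "g = up_ring.monom V \<one>\<^bsub>U\<^esub> 2 \<otimes>\<^bsub>V\<^esub> G \<ominus>\<^bsub>V\<^esub> up_ring.monom V fpol 0 \<otimes>\<^bsub>V\<^esub> G"
    unfolding G(2) gen_def using G(1)
    by (simp add: a_minus_def V.P.r_distr V.P.l_distr V.P.m_comm V.P.l_minus V.P.r_minus)
  have rec: "c n = fpol \<otimes>\<^bsub>U\<^esub> c (n + 2)" for n
  proof -
    have "up_ring.coeff V g (n + 2) = \<zero>\<^bsub>U\<^esub>" unfolding g_def using P Q by simp
    moreover have "up_ring.coeff V g (n + 2) = c n \<ominus>\<^bsub>U\<^esub> fpol \<otimes>\<^bsub>U\<^esub> c (n + 2)"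
      unfolding expand c_def
      using V.coeff_monom_mult[of "\<one>\<^bsub>U\<^esub>" G 2 n] V.coeff_monom_mult[of fpol G 0 "n + 2"] G(1)
      by (simp del: V.coeff_mult)
    ultimately have "c n \<ominus>\<^bsub>U\<^esub> fpol \<otimes>\<^bsub>U\<^esub> c (n + 2) = \<zero>\<^bsub>U\<^esub>" by simp
    moreover have "c n = (c n \<ominus>\<^bsub>U\<^esub> fpol \<otimes>\<^bsub>U\<^esub> c (n + 2)) \<oplus>\<^bsub>U\<^esub> fpol \<otimes>\<^bsub>U\<^esub> c (n + 2)"
      using c by (simp add: a_minus_def U.P.a_assoc U.P.l_neg)
    ultimately show ?thesis using c by simp
  qed
  obtain N where N: "\<And>n. n > N \<Longrightarrow> c n = \<zero>\<^bsub>U\<^esub>"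
    using V.deg_aboveD[OF _ G(1)] unfolding c_def by blast
  \<comment> \<open>\<open>k\<close> counts the downward steps of length two from the region where
    the coefficients of \<open>G\<close> are known to vanish.\<close>
  have vanish: "c n = \<zero>\<^bsub>U\<^esub>" if "n + 2 * k > N" for n k
    using that
  proof (induction k arbitrary: n)
    case 0
    then show ?case using N by simp
  next
    case (Suc k)
    then have "c (n + 2) = \<zero>\<^bsub>U\<^esub>" by (intro Suc.IH) simp
    then show ?case using rec[of n] by simp
  qed
  have "c n = \<zero>\<^bsub>U\<^esub>" for n using vanish[of n "Suc N"] by simp
  then have "G = \<zero>\<^bsub>V\<^esub>" using G(1) by (intro V.up_eqI) (auto simp: c_def)
  then have "g = \<zero>\<^bsub>V\<^esub>" using G by simp
  then have "up_ring.coeff V g 0 = \<zero>\<^bsub>U\<^esub>" "up_ring.coeff V g 1 = \<zero>\<^bsub>U\<^esub>" by simp_all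
  then show "P = \<zero>\<^bsub>U\<^esub>" "Q = \<zero>\<^bsub>U\<^esub>" unfolding g_def using P Q by simp_all
qed

end

section \<open>The coordinate ring of the curve over the localisation\<close>

text \<open>\<open>WCurve P Q\<close> stands for \<open>P + Q y\<close>.\<close>

datatype wcurve = WCurve (xpart: "zpoly fract poly") (ypart: "zpoly fract poly")

text \<open>The cubic of the curve, fixed outside the locale of \<open>p\<close> because the
  multiplication of the type \<open>wcurve\<close> is built on it; inside the locale it is
  \<open>F\<close>.\<close>

definition wF :: "zpoly fract poly" where
  "wF = [:to_fract (z6 0), to_fract (z4 0), 0, 1:]"

instantiation wcurve :: comm_ring_1
begin

definition "0 = WCurve 0 0"
definition "1 = WCurve 1 0"
definition "u + v = WCurve (xpart u + xpart v) (ypart u + ypart v)"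
definition "u - v = WCurve (xpart u - xpart v) (ypart u - ypart v)"
definition "- u = WCurve (- xpart u) (- ypart u)"
definition "u * v = WCurve (xpart u * xpart v + wF * ypart u * ypart v)
  (xpart u * ypart v + xpart v * ypart u)"

instance
  by standard (auto simp: zero_wcurve_def one_wcurve_def plus_wcurve_def minus_wcurve_def
      uminus_wcurve_def times_wcurve_def algebra_simps intro!: wcurve.expand)

end

lemma wcurve_parts [simp]:
  "xpart 0 = 0" "ypart 0 = 0" "xpart 1 = 1" "ypart 1 = 0"
  "xpart (u + v) = xpart u + xpart v" "ypart (u + v) = ypart u + ypart v"
  "xpart (u - v) = xpart u - xpart v" "ypart (u - v) = ypart u - ypart v"
  "xpart (- u) = - xpart u" "ypart (- u) = - ypart u"
  "xpart (u * v) = xpart u * xpart v + wF * ypart u * ypart v"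
  "ypart (u * v) = xpart u * ypart v + xpart v * ypart u"
  by (simp_all add: zero_wcurve_def one_wcurve_def plus_wcurve_def minus_wcurve_def
      uminus_wcurve_def times_wcurve_def)

lemma wcurve_of_nat [simp]: "xpart (of_nat k) = of_nat k" "ypart (of_nat k) = 0"
  by (induction k) auto

lemma wcurve_eqI: "xpart u = xpart v \<Longrightarrow> ypart u = ypart v \<Longrightarrow> u = v"
  by (intro wcurve.expand) simp

lemma (in weierstrass) mult_formula:
  assumes "P \<in> carrier U" "Q \<in> carrier U" "P' \<in> carrier U" "Q' \<in> carrier U"
  shows "(cst P \<oplus>\<^bsub>A\<^esub> cst Q \<otimes>\<^bsub>A\<^esub> yb) \<otimes>\<^bsub>A\<^esub> (cst P' \<oplus>\<^bsub>A\<^esub> cst Q' \<otimes>\<^bsub>A\<^esub> yb) =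
    cst (P \<otimes>\<^bsub>U\<^esub> P' \<oplus>\<^bsub>U\<^esub> fpol \<otimes>\<^bsub>U\<^esub> Q \<otimes>\<^bsub>U\<^esub> Q') \<oplus>\<^bsub>A\<^esub> cst (P \<otimes>\<^bsub>U\<^esub> Q' \<oplus>\<^bsub>U\<^esub> P' \<otimes>\<^bsub>U\<^esub> Q) \<otimes>\<^bsub>A\<^esub> yb"
proof -
  define c c' d d' where "c = cst P" "c' = cst P'" "d = cst Q" "d' = cst Q'"
  have cl: "c \<in> carrier A" "c' \<in> carrier A" "d \<in> carrier A" "d' \<in> carrier A"
    using assms by (auto simp: c_c'_d_d'_def)
  have "(c \<oplus>\<^bsub>A\<^esub> d \<otimes>\<^bsub>A\<^esub> yb) \<otimes>\<^bsub>A\<^esub> (c' \<oplus>\<^bsub>A\<^esub> d' \<otimes>\<^bsub>A\<^esub> yb) =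
      (c \<otimes>\<^bsub>A\<^esub> c' \<oplus>\<^bsub>A\<^esub> (yb \<otimes>\<^bsub>A\<^esub> yb) \<otimes>\<^bsub>A\<^esub> d \<otimes>\<^bsub>A\<^esub> d') \<oplus>\<^bsub>A\<^esub> (c \<otimes>\<^bsub>A\<^esub> d' \<oplus>\<^bsub>A\<^esub> c' \<otimes>\<^bsub>A\<^esub> d) \<otimes>\<^bsub>A\<^esub> yb"
    using cl by (simp add: A.l_distr A.r_distr A.a_ac A.m_ac)
  then show ?thesis using assms unfolding yb_square c_c'_d_d'_def by simp
qed

lemma (in ring_hom_cring) hom_add_pow: "u \<in> carrier R \<Longrightarrow> h ([k] \<cdot> u) = [k] \<cdot>\<^bsub>S\<^esub> h u" for k :: nat
  by (induction k) auto

lemma (in UP_cring) coeff_add_pow: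
  "u \<in> carrier P \<Longrightarrow> up_ring.coeff P ([k] \<cdot>\<^bsub>P\<^esub> u) n = [k] \<cdot> up_ring.coeff P u n" for k :: nat
  by (induction k) auto

lemma (in UP_cring) coeff_apply: "u \<in> carrier P \<Longrightarrow> up_ring.coeff P u n = u n"
  unfolding P_def by (simp add: UP_def)

context good_prime
begin

lemma wF_eq: "wF = F"
  by (simp add: wF_def F_def)

definition B :: "wcurve set" where
  "B = {c. xpart c \<in> LX \<and> ypart c \<in> LX}"

lemma B_iff: "c \<in> B \<longleftrightarrow> xpart c \<in> LX \<and> ypart c \<in> LX"
  by (simp add: B_def)

sublocale B: subring_set B
  by unfold_locales (auto simp: B_iff wF_eq)

lemma B_cg: "B.cg q c d \<longleftrightarrow> L.LX.cg q (xpart c) (xpart d) \<and> L.LX.cg q (ypart c) (ypart d)"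
proof
  assume "B.cg q c d"
  then obtain e where "e \<in> B" "c = d + of_nat q * e" by (rule B.cgE)
  then show "L.LX.cg q (xpart c) (xpart d) \<and> L.LX.cg q (ypart c) (ypart d)"
    by (intro conjI L.LX.cgI[of "xpart e"] L.LX.cgI[of "ypart e"]) (simp_all add: B_iff)
next
  assume cg: "L.LX.cg q (xpart c) (xpart d) \<and> L.LX.cg q (ypart c) (ypart d)"
  obtain e where e: "e \<in> LX" "xpart c = xpart d + of_nat q * e" using cg by (blast elim: L.LX.cgE)
  obtain e' where e': "e' \<in> LX" "ypart c = ypart d + of_nat q * e'" using cg by (blast elim: L.LX.cgE)
  show "B.cg q c d"
    by (rule B.cgI[of "WCurve e e'"]) (use e e' in \<open>auto simp: B_iff intro!: wcurve_eqI\<close>)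
qed

lemma S_of_z: "S_of p H (z4 0) = S.lim (\<lambda>_. zz4)" "S_of p H (z6 0) = S.lim (\<lambda>_. zz6)"
  using z_ZP by (simp_all add: S_of_eq)

sublocale W: weierstrass S.C "S_of p H (z4 0)" "S_of p H (z6 0)"
  by (intro weierstrass.intro weierstrass_axioms.intro S.C.is_cring)
    (simp_all only: S_of_z S.lim_closed S.coherent_const a_mem b_mem)

lemma ER_eq: "E_ring p H = W.A"
  by (simp add: E_ring_def S_ring_def)

section \<open>Polynomials over \<open>L\<close> inside those over the completed base\<close>

definition ux :: "zpoly fract poly \<Rightarrow> nat \<Rightarrow> nat \<Rightarrow> zpoly fract set" where
  "ux P = (\<lambda>j. S.lim (\<lambda>_. Polynomial.coeff P j))"

lemma lim_coeff_closed: "P \<in> LX \<Longrightarrow> S.lim (\<lambda>_. Polynomial.coeff P j) \<in> carrier S.C"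
  by (intro S.lim_closed S.coherent_const polys_overD)

lemma ux_closed: "P \<in> LX \<Longrightarrow> ux P \<in> carrier W.U"
proof -
  assume P: "P \<in> LX"
  have "bound \<zero>\<^bsub>S.C\<^esub> (Polynomial.degree P) (ux P)"
    by (rule bound.intro) (simp add: ux_def coeff_eq_0 S.lim_zero)
  then have "ux P \<in> up S.C" using lim_coeff_closed[OF P] unfolding up_def ux_def by blast
  then show ?thesis by (simp add: UP_def)
qed

lemma ux_coeff: "P \<in> LX \<Longrightarrow> up_ring.coeff W.U (ux P) j = S.lim (\<lambda>_. Polynomial.coeff P j)"
  using W.U.coeff_apply[OF ux_closed] by (simp add: ux_def)

lemma lim_sum:
  assumes "finite J" "\<And>i. i \<in> J \<Longrightarrow> f i \<in> L"
  shows "S.lim (\<lambda>_. sum f J) = (\<Oplus>\<^bsub>S.C\<^esub>i\<in>J. S.lim (\<lambda>_. f i))"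
  using assms
proof (induction J rule: finite_induct)
  case empty
  then show ?case by (simp add: S.lim_zero)
next
  case (insert i J)
  have c: "S.coherent (\<lambda>_. f i)" "S.coherent (\<lambda>_. sum f J)"
    using insert.prems by (intro S.coherent_const L.sum_mem; blast)+
  have "(\<Oplus>\<^bsub>S.C\<^esub>i\<in>insert i J. S.lim (\<lambda>_. f i)) = S.lim (\<lambda>_. f i) \<oplus>\<^bsub>S.C\<^esub> (\<Oplus>\<^bsub>S.C\<^esub>i\<in>J. S.lim (\<lambda>_. f i))"
    using insert.hyps insert.prems
    by (intro S.C.finsum_insert) (auto intro!: S.lim_closed S.coherent_const)
  then show ?case using insert S.lim_add[OF c] by simp
qed

lemma ux_add: "P \<in> LX \<Longrightarrow> Q \<in> LX \<Longrightarrow> ux (P + Q) = ux P \<oplus>\<^bsub>W.U\<^esub> ux Q"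
proof -
  assume P: "P \<in> LX" and Q: "Q \<in> LX"
  show ?thesis
  proof (rule W.U.up_eqI)
    show "up_ring.coeff W.U (ux (P + Q)) n = up_ring.coeff W.U (ux P \<oplus>\<^bsub>W.U\<^esub> ux Q) n" for n
      unfolding W.U.coeff_add[OF ux_closed[OF P] ux_closed[OF Q]] ux_coeff[OF P] ux_coeff[OF Q]
        ux_coeff[OF L.LX.add_mem[OF P Q]]
        S.lim_add[OF S.coherent_const[OF polys_overD[OF P]] S.coherent_const[OF polys_overD[OF Q]]]
      by (simp only: Polynomial.coeff_add)
  qed (simp_all only: ux_closed P Q L.LX.add_mem W.U.UP_a_closed)
qed

lemma ux_mult: "P \<in> LX \<Longrightarrow> Q \<in> LX \<Longrightarrow> ux (P * Q) = ux P \<otimes>\<^bsub>W.U\<^esub> ux Q"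
proof -
  assume P: "P \<in> LX" and Q: "Q \<in> LX"
  show ?thesis
  proof (rule W.U.up_eqI)
    fix n
    have "up_ring.coeff W.U (ux (P * Q)) n =
        (\<Oplus>\<^bsub>S.C\<^esub>i\<in>{..n}. S.lim (\<lambda>_. Polynomial.coeff P i * Polynomial.coeff Q (n - i)))"
      unfolding ux_coeff[OF L.LX.mult_mem[OF P Q]] Polynomial.coeff_mult
      using polys_overD[OF P] polys_overD[OF Q] by (intro lim_sum L.mult_mem) auto
    also have "\<dots> = (\<Oplus>\<^bsub>S.C\<^esub>i\<in>{..n}. up_ring.coeff W.U (ux P) i \<otimes>\<^bsub>S.C\<^esub> up_ring.coeff W.U (ux Q) (n - i))"
      unfolding ux_coeff[OF P] ux_coeff[OF Q]
        S.lim_mult[OF S.coherent_const[OF polys_overD[OF P]] S.coherent_const[OF polys_overD[OF Q]]] ..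
    also have "\<dots> = up_ring.coeff W.U (ux P \<otimes>\<^bsub>W.U\<^esub> ux Q) n"
      by (rule W.U.coeff_mult[OF ux_closed[OF P] ux_closed[OF Q], symmetric])
    finally show "up_ring.coeff W.U (ux (P * Q)) n = up_ring.coeff W.U (ux P \<otimes>\<^bsub>W.U\<^esub> ux Q) n" .
  qed (simp_all only: ux_closed P Q L.LX.mult_mem W.U.UP_mult_closed)
qed

lemma ux_monom: "c \<in> L \<Longrightarrow> ux (Polynomial.monom c n) = up_ring.monom W.U (S.lim (\<lambda>_. c)) n"
proof -
  assume c: "c \<in> L"
  have mc: "Polynomial.monom c n \<in> LX" using c by (auto intro!: polys_overI)
  have lc: "S.lim (\<lambda>_. c) \<in> carrier S.C" using c by (intro S.lim_closed S.coherent_const)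
  show ?thesis
  proof (rule W.U.up_eqI)
    show "up_ring.coeff W.U (ux (Polynomial.monom c n)) k =
        up_ring.coeff W.U (up_ring.monom W.U (S.lim (\<lambda>_. c)) n) k" for k
      unfolding ux_coeff[OF mc] W.U.coeff_monom[OF lc] by (simp add: S.lim_zero)
  qed (simp_all only: ux_closed mc W.U.monom_closed lc)
qed

lemma ux_0: "ux 0 = \<zero>\<^bsub>W.U\<^esub>"
  by (simp add: ux_def UP_def S.lim_zero)

lemma ux_one: "ux 1 = \<one>\<^bsub>W.U\<^esub>"
  using ux_monom[of 1 0] W.U.monom_one by (simp add: S.lim_one)

lemma ux_F: "ux F = W.fpol"
proof -
  have F: "F = Polynomial.monom 1 3 + Polynomial.monom zz4 1 + Polynomial.monom zz6 0"
    by (simp add: F_def monom_altdef power3_eq_cube)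
  have m: "Polynomial.monom c n \<in> LX" if "c \<in> L" for c n
    using that by (auto intro!: polys_overI)
  show ?thesis unfolding F W.fpol_def
    using m[OF L.one_mem, of 3] m[OF a_mem, of 1] m[OF b_mem, of 0]
    by (simp add: ux_add ux_monom a_mem b_mem S_of_z S.lim_one)
qed

definition \<iota> :: "wcurve \<Rightarrow> (nat \<Rightarrow> nat \<Rightarrow> nat \<Rightarrow> zpoly fract set) set" where
  "\<iota> c = W.cst (ux (xpart c)) \<oplus>\<^bsub>W.A\<^esub> W.cst (ux (ypart c)) \<otimes>\<^bsub>W.A\<^esub> W.yb"

text \<open>A coefficient \<open>S.lim b\<close> differs from the constant sequence
  \<open>b n\<close> by a multiple of \<open>p ^ n\<close>, and only finitely many coefficients
  occur.\<close>

lemma U_approx: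
  assumes P: "P \<in> carrier W.U"
  shows "\<exists>Q\<in>LX. \<exists>T\<in>carrier W.U. P = [(p ^ n)] \<cdot>\<^bsub>W.U\<^esub> T \<oplus>\<^bsub>W.U\<^esub> ux Q"
proof -
  define N where "N = deg S.C P"
  have "\<exists>l t. l \<in> L \<and> t \<in> carrier S.C \<and> up_ring.coeff W.U P j = [(p ^ n)] \<cdot>\<^bsub>S.C\<^esub> t \<oplus>\<^bsub>S.C\<^esub> S.lim (\<lambda>_. l)" for j
  proof -
    obtain b where b: "S.coherent b" "up_ring.coeff W.U P j = S.lim b"
      using W.U.coeff_closed[OF P] by (rule S.lim_exhaust)
    have bn: "b n \<in> L" by (rule S.coherentD(1)[OF b(1)])
    have coh: "S.coherent (\<lambda>_. b n)" using bn by (rule S.coherent_const)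
    have "S.coherent (\<lambda>i. b i - b n)" by (rule S.coherent_ops(4)[OF b(1) coh])
    then obtain t where t: "S.coherent t" "S.lim (\<lambda>i. b i - b n) = [(p ^ n)] \<cdot>\<^bsub>S.C\<^esub> S.lim t"
      using S.divide_by_ppow[of "\<lambda>i. b i - b n" n] by auto
    have "S.lim b = S.lim (\<lambda>i. b i - b n) \<oplus>\<^bsub>S.C\<^esub> S.lim (\<lambda>_. b n)"
      using S.lim_add[OF \<open>S.coherent (\<lambda>i. b i - b n)\<close> coh] by simp
    then show ?thesis using b(2) t bn S.lim_closed[OF t(1)] by metis
  qed
  then obtain l t where lt: "\<And>j. l j \<in> L" "\<And>j. t j \<in> carrier S.C"
      "\<And>j. up_ring.coeff W.U P j = [(p ^ n)] \<cdot>\<^bsub>S.C\<^esub> t j \<oplus>\<^bsub>S.C\<^esub> S.lim (\<lambda>_. l j)"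
    by metis
  define Q where "Q = (\<Sum>j\<le>N. Polynomial.monom (l j) j)"
  have Qc: "Polynomial.coeff Q j = (if j \<le> N then l j else 0)" for j
    by (simp add: Q_def coeff_sum)
  have Q: "Q \<in> LX" using lt(1) by (intro polys_overI) (simp add: Qc)
  define T where "T = (\<lambda>j. if j \<le> N then t j else \<zero>\<^bsub>S.C\<^esub>)"
  have "bound \<zero>\<^bsub>S.C\<^esub> N T" by (rule bound.intro) (simp add: T_def)
  then have "T \<in> up S.C" using lt(2) unfolding up_def T_def by auto
  then have T: "T \<in> carrier W.U" by (simp add: UP_def)
  have Tn: "[(p ^ n)] \<cdot>\<^bsub>W.U\<^esub> T \<in> carrier W.U" using T by simp
  have "P = [(p ^ n)] \<cdot>\<^bsub>W.U\<^esub> T \<oplus>\<^bsub>W.U\<^esub> ux Q"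
  proof (rule W.U.up_eqI)
    fix j
    have "up_ring.coeff W.U ([(p ^ n)] \<cdot>\<^bsub>W.U\<^esub> T \<oplus>\<^bsub>W.U\<^esub> ux Q) j =
        [(p ^ n)] \<cdot>\<^bsub>S.C\<^esub> T j \<oplus>\<^bsub>S.C\<^esub> S.lim (\<lambda>_. Polynomial.coeff Q j)"
      unfolding W.U.coeff_add[OF Tn ux_closed[OF Q]] W.U.coeff_add_pow[OF T] W.U.coeff_apply[OF T] ux_coeff[OF Q] ..
    also have "\<dots> = up_ring.coeff W.U P j"
    proof (cases "j \<le> N")
      case True
      then show ?thesis using lt(3)[of j] by (simp add: T_def Qc)
    next
      case False
      then have "up_ring.coeff W.U P j = \<zero>\<^bsub>S.C\<^esub>" using W.U.deg_aboveD[OF _ P] by (simp add: N_def)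
      moreover have "S.lim (\<lambda>_. Polynomial.coeff Q j) = \<zero>\<^bsub>S.C\<^esub>" using False by (simp add: Qc S.lim_zero)
      moreover have "[(p ^ n)] \<cdot>\<^bsub>S.C\<^esub> T j = \<zero>\<^bsub>S.C\<^esub>" using False by (simp add: T_def)
      ultimately show ?thesis by simp
    qed
    finally show "up_ring.coeff W.U P j = up_ring.coeff W.U ([(p ^ n)] \<cdot>\<^bsub>W.U\<^esub> T \<oplus>\<^bsub>W.U\<^esub> ux Q) j" ..
  qed (use P Tn ux_closed[OF Q] in simp_all)
  then show ?thesis using Q T by blast
qed

lemma U_reflect:
  assumes P: "P \<in> LX" and T: "T \<in> carrier W.U" and eq: "ux P = [(p ^ n)] \<cdot>\<^bsub>W.U\<^esub> T"
  shows "L.LX.cg (p ^ n) P 0"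
  unfolding L.cg_poly_iff
proof
  fix j
  obtain t where t: "S.coherent t" "up_ring.coeff W.U T j = S.lim t"
    using W.U.coeff_closed[OF T] by (rule S.lim_exhaust)
  have Pj: "Polynomial.coeff P j \<in> L" by (rule polys_overD[OF P])
  have tn: "t n \<in> L" by (rule S.coherentD(1)[OF t(1)])
  have "S.lim (\<lambda>_. Polynomial.coeff P j) = up_ring.coeff W.U (ux P) j" by (rule ux_coeff[OF P, symmetric])
  also have "\<dots> = [(p ^ n)] \<cdot>\<^bsub>S.C\<^esub> S.lim t" unfolding eq W.U.coeff_add_pow[OF T] t(2) ..
  also have "\<dots> = S.lim (\<lambda>i. of_nat (p ^ n) * t i)" by (rule S.lim_add_pow[OF t(1)])
  finally have "\<sigma> n (Polynomial.coeff P j) = \<sigma> n (of_nat (p ^ n) * t n)"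
    by (simp only: S.lim_def fun_eq_iff)
  then have "L.cg (p ^ n) (Polynomial.coeff P j) (of_nat (p ^ n) * t n)"
    using S.pi_eq[OF Pj L.mult_mem[OF L.of_nat_mem tn]] by blast
  also have "L.cg (p ^ n) \<dots> 0" using tn by (rule L.cg_0_mult)
  finally show "L.cg (p ^ n) (Polynomial.coeff P j) (Polynomial.coeff 0 j)" by simp
qed

definition \<pi> where "\<pi> n c = ppow_ideal p W.A n +>\<^bsub>W.A\<^esub> \<iota> c"

lemma \<iota>_closed: "c \<in> B \<Longrightarrow> \<iota> c \<in> carrier W.A"
  unfolding \<iota>_def B_iff by (intro W.A.a_closed W.A.m_closed W.cst.hom_closed ux_closed W.yb_closed; blast)

lemma E_presentation: "presentation B W.A p \<pi>"
  unfolding \<pi>_def[abs_def]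
proof (rule presentation_of_hom[OF W.A.is_cring B.subring_set_axioms \<iota>_closed])
  have uxB: "ux (xpart c) \<in> carrier W.U" "ux (ypart c) \<in> carrier W.U" if "c \<in> B" for c
    using that ux_closed by (auto simp: B_iff)
  show "\<iota> (b + c) = \<iota> b \<oplus>\<^bsub>W.A\<^esub> \<iota> c" if b: "b \<in> B" and c: "c \<in> B" for b c
  proof -
    have "\<iota> (b + c) = W.cst (ux (xpart b) \<oplus>\<^bsub>W.U\<^esub> ux (xpart c)) \<oplus>\<^bsub>W.A\<^esub>
        W.cst (ux (ypart b) \<oplus>\<^bsub>W.U\<^esub> ux (ypart c)) \<otimes>\<^bsub>W.A\<^esub> W.yb"
      using b c by (simp add: \<iota>_def ux_add B_iff)
    then show ?thesis using uxB[OF b] uxB[OF c] unfolding \<iota>_def by (simp add: W.A.l_distr W.A.a_ac)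
  qed
  show "\<iota> (b * c) = \<iota> b \<otimes>\<^bsub>W.A\<^esub> \<iota> c" if b: "b \<in> B" and c: "c \<in> B" for b c
    unfolding \<iota>_def W.mult_formula[OF uxB[OF b] uxB[OF c]]
    using b c by (simp add: B_iff wF_eq ux_add ux_mult ux_F)
  show "\<iota> 1 = \<one>\<^bsub>W.A\<^esub>"
    by (simp add: \<iota>_def ux_0 ux_one)
  show "\<exists>b\<in>B. \<exists>c\<in>carrier W.A. f = [(p ^ n)] \<cdot>\<^bsub>W.A\<^esub> c \<oplus>\<^bsub>W.A\<^esub> \<iota> b" if f: "f \<in> carrier W.A" for f n
  proof -
    obtain P Q where PQ: "P \<in> carrier W.U" "Q \<in> carrier W.U" "f = W.cst P \<oplus>\<^bsub>W.A\<^esub> W.cst Q \<otimes>\<^bsub>W.A\<^esub> W.yb"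
      using f by (rule W.exhaust)
    obtain P' T where P': "P' \<in> LX" "T \<in> carrier W.U" "P = [(p ^ n)] \<cdot>\<^bsub>W.U\<^esub> T \<oplus>\<^bsub>W.U\<^esub> ux P'"
      using U_approx[OF PQ(1)] by blast
    obtain Q' T' where Q': "Q' \<in> LX" "T' \<in> carrier W.U" "Q = [(p ^ n)] \<cdot>\<^bsub>W.U\<^esub> T' \<oplus>\<^bsub>W.U\<^esub> ux Q'"
      using U_approx[OF PQ(2)] by blast
    have "f = [(p ^ n)] \<cdot>\<^bsub>W.A\<^esub> (W.cst T \<oplus>\<^bsub>W.A\<^esub> W.cst T' \<otimes>\<^bsub>W.A\<^esub> W.yb) \<oplus>\<^bsub>W.A\<^esub> \<iota> (WCurve P' Q')"
      unfolding PQ(3) P'(3) Q'(3) \<iota>_def using P' Q' ux_closed[OF P'(1)] ux_closed[OF Q'(1)]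
      by (simp add: W.cst.hom_add_pow W.A.l_distr W.A.add_pow_ldistr W.A.add.nat_pow_distrib W.A.a_ac)
    then show ?thesis using P' Q'
      by (intro bexI[of _ "WCurve P' Q'"] bexI[of _ "W.cst T \<oplus>\<^bsub>W.A\<^esub> W.cst T' \<otimes>\<^bsub>W.A\<^esub> W.yb"]) (simp_all add: B_iff)
  qed
  show "B.cg (p ^ n) b 0" if b: "b \<in> B" and c: "c \<in> carrier W.A" and eq: "\<iota> b = [(p ^ n)] \<cdot>\<^bsub>W.A\<^esub> c" for b c n
  proof -
    obtain P Q where PQ: "P \<in> carrier W.U" "Q \<in> carrier W.U" "c = W.cst P \<oplus>\<^bsub>W.A\<^esub> W.cst Q \<otimes>\<^bsub>W.A\<^esub> W.yb"
      using c by (rule W.exhaust)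
    define P' where "P' = ux (xpart b) \<ominus>\<^bsub>W.U\<^esub> [(p ^ n)] \<cdot>\<^bsub>W.U\<^esub> P"
    define Q' where "Q' = ux (ypart b) \<ominus>\<^bsub>W.U\<^esub> [(p ^ n)] \<cdot>\<^bsub>W.U\<^esub> Q"
    have PQ': "P' \<in> carrier W.U" "Q' \<in> carrier W.U" using uxB[OF b] PQ by (simp_all add: P'_def Q'_def)
    have eqs: "ux (xpart b) = P' \<oplus>\<^bsub>W.U\<^esub> [(p ^ n)] \<cdot>\<^bsub>W.U\<^esub> P" "ux (ypart b) = Q' \<oplus>\<^bsub>W.U\<^esub> [(p ^ n)] \<cdot>\<^bsub>W.U\<^esub> Q"
      using uxB[OF b] PQ by (simp_all add: P'_def Q'_def a_minus_def W.U.P.a_assoc W.U.P.l_neg)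
    have "(W.cst P' \<oplus>\<^bsub>W.A\<^esub> W.cst Q' \<otimes>\<^bsub>W.A\<^esub> W.yb) \<oplus>\<^bsub>W.A\<^esub> [(p ^ n)] \<cdot>\<^bsub>W.A\<^esub> c = \<iota> b"
      unfolding \<iota>_def eqs PQ(3) using PQ PQ'
      by (simp add: W.cst.hom_add_pow W.A.l_distr W.A.add_pow_ldistr W.A.add.nat_pow_distrib W.A.a_ac)
    moreover have "W.cst P' \<oplus>\<^bsub>W.A\<^esub> W.cst Q' \<otimes>\<^bsub>W.A\<^esub> W.yb \<in> carrier W.A" using PQ' by simp
    moreover have "[(p ^ n)] \<cdot>\<^bsub>W.A\<^esub> c \<in> carrier W.A" using c by simp
    ultimately have "W.cst P' \<oplus>\<^bsub>W.A\<^esub> W.cst Q' \<otimes>\<^bsub>W.A\<^esub> W.yb = \<zero>\<^bsub>W.A\<^esub>"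
      unfolding eq using W.A.add.r_cancel_one by blast
    then have z: "P' = \<zero>\<^bsub>W.U\<^esub>" "Q' = \<zero>\<^bsub>W.U\<^esub>" using W.basis[OF PQ'] by simp_all
    have "L.LX.cg (p ^ n) (xpart b) 0" "L.LX.cg (p ^ n) (ypart b) 0"
      using U_reflect[of "xpart b" P n] U_reflect[of "ypart b" Q n] b PQ(1,2)
      unfolding B_iff eqs z by simp_all
    then show ?thesis by (simp add: B_cg)
  qed
  show "a = b" if "of_nat p * a = of_nat p * (b :: wcurve)" for a b
  proof -
    have "of_nat p * xpart a = of_nat p * xpart b" "of_nat p * ypart a = of_nat p * ypart b"
      using arg_cong[OF that, of xpart] arg_cong[OF that, of ypart] by simp_all
    then show ?thesis using p_pow_cancel[of 1 "xpart a" "xpart b"] p_pow_cancel[of 1 "ypart a" "ypart b"]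
      by (intro wcurve_eqI) simp_all
  qed
qed

end

section \<open>Differentials and the Frobenius lift on the curve\<close>

context module
begin

section \<open>Congruence modulo a submodule\<close>

lemma submodule_cong_trans:
  assumes N: "submodule N R M" and "u \<in> carrier M" "v \<in> carrier M" "w \<in> carrier M"
    and "u \<ominus>\<^bsub>M\<^esub> v \<in> N" "v \<ominus>\<^bsub>M\<^esub> w \<in> N"
  shows "u \<ominus>\<^bsub>M\<^esub> w \<in> N"
proof -
  have "v \<oplus>\<^bsub>M\<^esub> (\<ominus>\<^bsub>M\<^esub> v \<oplus>\<^bsub>M\<^esub> \<ominus>\<^bsub>M\<^esub> w) = \<ominus>\<^bsub>M\<^esub> w"
    using assms(2-4) by (simp add: M.r_neg flip: M.a_assoc)
  then have "u \<ominus>\<^bsub>M\<^esub> w = (u \<ominus>\<^bsub>M\<^esub> v) \<oplus>\<^bsub>M\<^esub> (v \<ominus>\<^bsub>M\<^esub> w)"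
    using assms(2-4) by (simp add: a_minus_def M.a_ac)
  then show ?thesis using submoduleE(5)[OF N assms(5,6)] by simp
qed

lemma submodule_cong_sym:
  assumes N: "submodule N R M" and "u \<in> carrier M" "v \<in> carrier M" and "u \<ominus>\<^bsub>M\<^esub> v \<in> N"
  shows "v \<ominus>\<^bsub>M\<^esub> u \<in> N"
proof -
  have "v \<ominus>\<^bsub>M\<^esub> u = \<ominus>\<^bsub>M\<^esub> (u \<ominus>\<^bsub>M\<^esub> v)"
    using assms(2,3) by (simp add: a_minus_def M.minus_add M.a_comm)
  then show ?thesis using submoduleE(3)[OF N assms(4)] by simp
qed

lemma submodule_cong_add:
  assumes N: "submodule N R M" and "u \<in> carrier M" "v \<in> carrier M" "u' \<in> carrier M" "v' \<in> carrier M"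
    and "u \<ominus>\<^bsub>M\<^esub> v \<in> N" "u' \<ominus>\<^bsub>M\<^esub> v' \<in> N"
  shows "(u \<oplus>\<^bsub>M\<^esub> u') \<ominus>\<^bsub>M\<^esub> (v \<oplus>\<^bsub>M\<^esub> v') \<in> N"
proof -
  have "(u \<oplus>\<^bsub>M\<^esub> u') \<ominus>\<^bsub>M\<^esub> (v \<oplus>\<^bsub>M\<^esub> v') = (u \<ominus>\<^bsub>M\<^esub> v) \<oplus>\<^bsub>M\<^esub> (u' \<ominus>\<^bsub>M\<^esub> v')"
    using assms(2-5) by (simp add: a_minus_def M.minus_add M.a_ac)
  then show ?thesis using submoduleE(5)[OF N assms(6,7)] by simp
qed

lemma submodule_cong_smult:
  assumes N: "submodule N R M" and "u \<in> carrier M" "v \<in> carrier M" "c \<in> carrier R"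
    and "u \<ominus>\<^bsub>M\<^esub> v \<in> N"
  shows "c \<odot>\<^bsub>M\<^esub> u \<ominus>\<^bsub>M\<^esub> c \<odot>\<^bsub>M\<^esub> v \<in> N"
proof -
  have "c \<odot>\<^bsub>M\<^esub> u \<ominus>\<^bsub>M\<^esub> c \<odot>\<^bsub>M\<^esub> v = c \<odot>\<^bsub>M\<^esub> (u \<ominus>\<^bsub>M\<^esub> v)"
    using assms(2-4) by (simp add: a_minus_def smult_r_distr smult_r_minus)
  then show ?thesis using submoduleE(4)[OF N assms(4,5)] by simp
qed

end

lemma mod_ppow_map_coset:
  assumes "ring_hom_cring R A g" and r: "r \<in> carrier R"
  shows "mod_ppow_map p A g n (ppow_ideal p R n +>\<^bsub>R\<^esub> r) = ppow_ideal p A n +>\<^bsub>A\<^esub> g r"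
proof -
  interpret g: ring_hom_cring R A g by fact
  interpret I: ideal "ppow_ideal p A n" A by (rule g.S.ppow_ideal_ideal)
  interpret J: ideal "ppow_ideal p R n" R by (rule g.R.ppow_ideal_ideal)
  show ?thesis
  proof
    show "mod_ppow_map p A g n (ppow_ideal p R n +>\<^bsub>R\<^esub> r) \<subseteq> ppow_ideal p A n +>\<^bsub>A\<^esub> g r"
    proof
      fix y assume "y \<in> mod_ppow_map p A g n (ppow_ideal p R n +>\<^bsub>R\<^esub> r)"
      then obtain i j where ij: "i \<in> ppow_ideal p A n" "j \<in> ppow_ideal p R n" "y = i \<oplus>\<^bsub>A\<^esub> g (j \<oplus>\<^bsub>R\<^esub> r)"
        unfolding mod_ppow_map_def set_add_def' a_r_coset_def' by blast
      obtain c where c: "c \<in> carrier R" "j = [(p ^ n)] \<cdot>\<^bsub>R\<^esub> c" using ij(2) unfolding g.R.mem_ppow_ideal by blast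
      have gj: "g j \<in> ppow_ideal p A n"
        unfolding g.S.mem_ppow_ideal c(2) g.hom_add_pow[OF c(1)] using g.hom_closed[OF c(1)] by blast
      have "y = (i \<oplus>\<^bsub>A\<^esub> g j) \<oplus>\<^bsub>A\<^esub> g r"
        unfolding ij(3) using I.a_Hcarr[OF ij(1)] J.a_Hcarr[OF ij(2)] r by (simp add: g.S.a_assoc)
      then show "y \<in> ppow_ideal p A n +>\<^bsub>A\<^esub> g r"
        unfolding a_r_coset_def' using I.a_closed[OF ij(1) gj] by blast
    qed
    show "ppow_ideal p A n +>\<^bsub>A\<^esub> g r \<subseteq> mod_ppow_map p A g n (ppow_ideal p R n +>\<^bsub>R\<^esub> r)"
      unfolding mod_ppow_map_def set_add_def' a_r_coset_def'[of A]
      using J.a_rcos_self[OF r] by blast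
  qed
qed

context good_prime
begin

sublocale E: presentation B W.A p \<pi>
  by (rule E_presentation)

subsection \<open>The invariant derivation\<close>

definition Dv :: "wcurve \<Rightarrow> wcurve" where
  "Dv c = WCurve (pderiv (ypart c) * F + half * pderiv F * ypart c) (pderiv (xpart c))"

definition cc :: "zpoly fract \<Rightarrow> wcurve" where "cc l = WCurve [:l:] 0"
definition cx :: wcurve where "cx = WCurve [:0, 1:] 0"
definition cy :: wcurve where "cy = WCurve 0 1"

lemma Dv_parts [simp]:
  "xpart (Dv c) = pderiv (ypart c) * F + half * pderiv F * ypart c" "ypart (Dv c) = pderiv (xpart c)"
  by (simp_all add: Dv_def)

lemma gens_parts [simp]: "xpart (cc l) = [:l:]" "ypart (cc l) = 0" "xpart cx = [:0, 1:]" "ypart cx = 0"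
  "xpart cy = 0" "ypart cy = 1"
  by (simp_all add: cc_def cx_def cy_def)

lemma Dv_B [simp]: "c \<in> B \<Longrightarrow> Dv c \<in> B"
  by (simp add: B_iff)

lemma gens_B [simp]: "l \<in> L \<Longrightarrow> cc l \<in> B" "cx \<in> B" "cy \<in> B"
  by (simp_all add: B_iff)

lemma Dv_add: "Dv (c + d) = Dv c + Dv d"
  by (rule wcurve_eqI) (simp_all add: pderiv_add algebra_simps)

lemma Dv_mult: "Dv (c * d) = c * Dv d + d * Dv c"
proof (rule wcurve_eqI)
  show "xpart (Dv (c * d)) = xpart (c * Dv d + d * Dv c)"
    by (simp add: wF_eq pderiv_add pderiv_mult algebra_simps)
  have "ypart (c * Dv d + d * Dv c) = xpart c * pderiv (xpart d) + xpart d * pderiv (xpart c) +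
      F * (ypart c * pderiv (ypart d) + ypart d * pderiv (ypart c)) +
      (2 * half) * (pderiv F * ypart c * ypart d)"
    by (simp add: algebra_simps)
  then show "ypart (Dv (c * d)) = ypart (c * Dv d + d * Dv c)"
    unfolding half by (simp add: wF_eq pderiv_add pderiv_mult algebra_simps)
qed

lemma Dv_cc: "Dv (cc l) = 0"
  by (rule wcurve_eqI) (simp_all add: pderiv_pCons)

lemma Dv_cx: "Dv cx = cy"
  by (rule wcurve_eqI) (simp_all add: pderiv_pCons)

lemma Dv_of_nat: "Dv (of_nat q * c) = of_nat q * Dv c"
  by (induction q) (simp_all add: Dv_add algebra_simps, rule wcurve_eqI, simp_all)

lemma Dv_cg: "B.cg q c d \<Longrightarrow> B.cg q (Dv c) (Dv d)"
proof -
  assume "B.cg q c d"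
  then obtain e where "e \<in> B" "c = d + of_nat q * e" by (rule B.cgE)
  then show ?thesis by (intro B.cgI[of "Dv e"]) (simp_all add: Dv_add Dv_of_nat)
qed

abbreviation An where "An n \<equiv> mod_ppow p W.A n"

definition Dn :: "nat \<Rightarrow> _ \<Rightarrow> _" where
  "Dn n X = \<pi> n (Dv (SOME b. b \<in> B \<and> \<pi> n b = X))"

lemma Dn_pi: "b \<in> B \<Longrightarrow> Dn n (\<pi> n b) = \<pi> n (Dv b)"
proof -
  assume b: "b \<in> B"
  define c where "c = (SOME c. c \<in> B \<and> \<pi> n c = \<pi> n b)"
  have "c \<in> B \<and> \<pi> n c = \<pi> n b" unfolding c_def by (rule someI[of _ b]) (simp add: b)
  then have c: "c \<in> B" "B.cg (p ^ n) c b" using E.pi_eq[of c b n] b by simp_all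
  have "\<pi> n (Dv c) = \<pi> n (Dv b)" using E.pi_eq[of "Dv c" "Dv b" n] b c Dv_cg by simp
  then show ?thesis by (simp add: Dn_def c_def)
qed

lemma level_exhaust: assumes "X \<in> carrier (An n)" obtains b where "b \<in> B" "X = \<pi> n b"
  using assms unfolding E.pi_surj by blast

lemma E_const_eq: "E_const p H t = W.cst (up_ring.monom W.U t 0)"
  by (simp add: E_const_def E_class_def const_xy_def W.cst_def S_ring_def)

lemma E_const_hom: "ring_hom_cring S.C W.A (E_const p H)"
proof -
  have "W.cst \<circ> (\<lambda>t. up_ring.monom W.U t 0) \<in> ring_hom S.C W.A"
    by (rule ring_hom_trans[OF W.U.const_ring_hom W.cst_hom])
  then show ?thesis
    by (intro ring_hom_cring.intro ring_hom_cring_axioms.intro S.C.is_cring W.A.is_cring)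
      (simp add: comp_def E_const_eq[abs_def])
qed

lemma iota_cc: "l \<in> L \<Longrightarrow> \<iota> (cc l) = E_const p H (S.lim (\<lambda>_. l))"
proof -
  assume l: "l \<in> L"
  have "ux [:l:] = up_ring.monom W.U (S.lim (\<lambda>_. l)) 0" using ux_monom[OF l, of 0] by (simp add: monom_0)
  moreover have "S.lim (\<lambda>_. l) \<in> carrier S.C" using l by (intro S.lim_closed S.coherent_const)
  ultimately show ?thesis by (simp add: \<iota>_def E_const_eq ux_0)
qed

text \<open>\<open>t\<close> and the constant sequence \<open>l\<close> differ by
  \<open>p ^ n\<close> times an element of the completed base, which the homomorphism
  \<open>E_const\<close> carries into the ideal of \<open>p ^ n\<close>.\<close>

lemma const_level:
  assumes t: "t \<in> carrier S.C" and l: "l \<in> L" and eq: "t n = \<sigma> n l"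
  shows "ppow_ideal p W.A n +>\<^bsub>W.A\<^esub> E_const p H t = \<pi> n (cc l)"
proof -
  interpret g: ring_hom_cring S.C W.A "E_const p H" by (rule E_const_hom)
  interpret I: ideal "ppow_ideal p W.A n" W.A by (rule W.A.ppow_ideal_ideal)
  obtain b where b: "S.coherent b" "t = S.lim b" using t by (rule S.lim_exhaust)
  have coh: "S.coherent (\<lambda>_. l)" using l by (rule S.coherent_const)
  have coh': "S.coherent (\<lambda>i. b i - l)" by (rule S.coherent_ops(4)[OF b(1) coh])
  have "L.cg (p ^ n) (b n) l"
    using eq S.pi_eq[OF S.coherentD(1)[OF b(1)] l, of n] by (simp add: b S.lim_def)
  then have "L.cg (p ^ n) (b n - l) (l - l)" by (rule L.cg_diff) (rule L.cg_refl)
  then obtain d where d: "S.coherent d" "S.lim (\<lambda>i. b i - l) = [(p ^ n)] \<cdot>\<^bsub>S.C\<^esub> S.lim d"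
    using S.divide_by_ppow[OF coh', of n] by auto
  have lim_l: "S.lim (\<lambda>_. l) \<in> carrier S.C" by (rule S.lim_closed[OF coh])
  have "t = [(p ^ n)] \<cdot>\<^bsub>S.C\<^esub> S.lim d \<oplus>\<^bsub>S.C\<^esub> S.lim (\<lambda>_. l)"
    unfolding d(2)[symmetric] S.lim_add[OF coh' coh] b(2) by simp
  then have "E_const p H t = [(p ^ n)] \<cdot>\<^bsub>W.A\<^esub> E_const p H (S.lim d) \<oplus>\<^bsub>W.A\<^esub> E_const p H (S.lim (\<lambda>_. l))"
    using S.lim_closed[OF d(1)] lim_l by (simp add: g.hom_add_pow)
  moreover have "[(p ^ n)] \<cdot>\<^bsub>W.A\<^esub> E_const p H (S.lim d) \<in> ppow_ideal p W.A n"
    unfolding W.A.mem_ppow_ideal using g.hom_closed[OF S.lim_closed[OF d(1)]] by blast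
  ultimately have "E_const p H t \<in> ppow_ideal p W.A n +>\<^bsub>W.A\<^esub> \<iota> (cc l)"
    unfolding a_r_coset_def' iota_cc[OF l] by blast
  then show ?thesis unfolding \<pi>_def using I.a_repr_independence' \<iota>_closed[OF gens_B(1)[OF l]] by simp
qed

abbreviation Rn where "Rn n \<equiv> mod_ppow p S.C n"
abbreviation gn where "gn n \<equiv> mod_ppow_map p W.A (E_const p H) n"

text \<open>At level \<open>n\<close> the completed base and \<open>L\<close> have the same image in
  the curve, so the relations coming from the base may be indexed by the constants
  \<open>cc l\<close>.\<close>

lemma gn_image: "gn n ` carrier (Rn n) = (\<lambda>l. \<pi> n (cc l)) ` L"
proof
  show "gn n ` carrier (Rn n) \<subseteq> (\<lambda>l. \<pi> n (cc l)) ` L"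
  proof
    fix y assume "y \<in> gn n ` carrier (Rn n)"
    then obtain t where t: "t \<in> carrier S.C" "y = gn n (ppow_ideal p S.C n +>\<^bsub>S.C\<^esub> t)"
      unfolding FactRing_def A_RCOSETS_def' by auto
    obtain b where b: "S.coherent b" "t = S.lim b" using t(1) by (rule S.lim_exhaust)
    have "y = \<pi> n (cc (b n))"
      unfolding t(2) mod_ppow_map_coset[OF E_const_hom t(1)]
      by (rule const_level[OF t(1) S.coherentD(1)[OF b(1)]]) (simp add: b S.lim_def)
    then show "y \<in> (\<lambda>l. \<pi> n (cc l)) ` L" using S.coherentD(1)[OF b(1)] by blast
  qed
  show "(\<lambda>l. \<pi> n (cc l)) ` L \<subseteq> gn n ` carrier (Rn n)"
  proof
    fix y assume "y \<in> (\<lambda>l. \<pi> n (cc l)) ` L"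
    then obtain l where l: "l \<in> L" "y = \<pi> n (cc l)" by blast
    have lim_l: "S.lim (\<lambda>_. l) \<in> carrier S.C" using l(1) by (intro S.lim_closed S.coherent_const)
    have "y = gn n (ppow_ideal p S.C n +>\<^bsub>S.C\<^esub> S.lim (\<lambda>_. l))"
      unfolding l(2) mod_ppow_map_coset[OF E_const_hom lim_l]
      by (rule const_level[OF lim_l l(1), symmetric]) (simp add: S.lim_def)
    moreover have "ppow_ideal p S.C n +>\<^bsub>S.C\<^esub> S.lim (\<lambda>_. l) \<in> carrier (Rn n)"
      using lim_l by (auto simp: FactRing_def A_RCOSETS_def')
    ultimately show "y \<in> gn n ` carrier (Rn n)" by blast
  qed
qed

subsection \<open>Differentials modulo powers of p\<close>

lemma An_deriv: "kahler_deriv (An n) (Rn n) (gn n) (Dn n)"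
proof (intro kahler_deriv.intro E.level_cring kahler_deriv_axioms.intro)
  fix X assume X: "X \<in> carrier (An n)"
  then obtain b where b: "b \<in> B" "X = \<pi> n b" by (rule level_exhaust)
  show "Dn n X \<in> carrier (An n)" using b by (simp add: Dn_pi E.pi_closed)
  fix Y assume Y: "Y \<in> carrier (An n)"
  then obtain c where c: "c \<in> B" "Y = \<pi> n c" by (rule level_exhaust)
  show "Dn n (X \<oplus>\<^bsub>An n\<^esub> Y) = Dn n X \<oplus>\<^bsub>An n\<^esub> Dn n Y"
    using b c by (simp add: Dn_pi Dv_add flip: E.pi_add)
  have "Dn n (X \<otimes>\<^bsub>An n\<^esub> Y) = \<pi> n (b * Dv c + c * Dv b)"
    using b c by (simp add: Dn_pi Dv_mult flip: E.pi_mult)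
  then show "Dn n (X \<otimes>\<^bsub>An n\<^esub> Y) = X \<otimes>\<^bsub>An n\<^esub> Dn n Y \<oplus>\<^bsub>An n\<^esub> Y \<otimes>\<^bsub>An n\<^esub> Dn n X"
    using b c by (simp add: Dn_pi E.pi_add E.pi_mult)
next
  fix t assume "t \<in> carrier (Rn n)"
  then obtain l where l: "l \<in> L" "gn n t = \<pi> n (cc l)" using gn_image[of n] by blast
  show "gn n t \<in> carrier (An n)" using l by (simp add: E.pi_closed)
  show "Dn n (gn n t) = \<zero>\<^bsub>An n\<^esub>" using l by (simp add: Dn_pi Dv_cc E.pi_zero)
qed

definition lin where
  "lin n u v = \<pi> n u \<odot>\<^bsub>free_mod (An n)\<^esub> free_gen (An n) (\<pi> n cx) \<oplus>\<^bsub>free_mod (An n)\<^esub>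
     \<pi> n v \<odot>\<^bsub>free_mod (An n)\<^esub> free_gen (An n) (\<pi> n cy)"

text \<open>The coefficients of \<open>\<omega> = r y dx + 2 s dy\<close>, where \<open>r f + s f' = 1\<close>.\<close>

definition wx :: wcurve where "wx = WCurve 0 r"
definition wy :: wcurve where "wy = WCurve (2 * s) 0"

lemma w_B [simp]: "wx \<in> B" "wy \<in> B"
  by (simp_all add: wx_def wy_def B_iff)

lemma w_Dv: "wx * Dv cx + wy * Dv cy = 1"
proof (rule wcurve_eqI)
  have "xpart (wx * Dv cx + wy * Dv cy) = r * F + (2 * half) * (s * pderiv F)"
    by (simp add: wx_def wy_def wF_eq pderiv_pCons algebra_simps)
  then show "xpart (wx * Dv cx + wy * Dv cy) = xpart 1" unfolding half using bezout by simp
  show "ypart (wx * Dv cx + wy * Dv cy) = ypart 1"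
    by (simp add: wx_def wy_def wF_eq)
qed

text \<open>For \<open>c = P + Q y\<close> the product rule gives
  \<open>dc = (P' + Q' y) dx + Q dy\<close>. The relation \<open>2 y dy = F' dx\<close>, obtained
  from \<open>y ^ 2 = F\<close>, then turns this into the multiple \<open>Dv c\<close> of
  \<open>r y dx + 2 s dy\<close>. All steps are congruences modulo an arbitrary submodule containing
  the relations.\<close>

lemma gen_cong:
  assumes N: "submodule N (An n) (free_mod (An n))" and rels: "kahler_rels (Rn n) (An n) (gn n) \<subseteq> N"
    and c: "c \<in> B"
  shows "free_gen (An n) (\<pi> n c) \<ominus>\<^bsub>free_mod (An n)\<^esub> \<pi> n (Dv c) \<odot>\<^bsub>free_mod (An n)\<^esub> lin n wx wy \<in> N"
proof -
  interpret K: kahler_deriv "An n" "Rn n" "gn n" "Dn n" by (rule An_deriv)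
  let ?F = "free_mod (An n)"
  define gen where "gen c = free_gen (An n) (\<pi> n c)" for c
  have gen [simp]: "gen c \<in> carrier ?F" if "c \<in> B" for c
    using that by (simp add: gen_def K.free_gen_closed E.pi_closed)
  have pi [simp]: "\<pi> n c \<in> carrier (An n)" if "c \<in> B" for c using that by (rule E.pi_closed)
  have lin_def': "lin n u v = \<pi> n u \<odot>\<^bsub>?F\<^esub> gen cx \<oplus>\<^bsub>?F\<^esub> \<pi> n v \<odot>\<^bsub>?F\<^esub> gen cy" for u v
    by (simp add: lin_def gen_def)
  have lin [simp]: "lin n u v \<in> carrier ?F" if "u \<in> B" "v \<in> B" for u v
    using that by (simp add: lin_def')
  have lin_add: "lin n u v \<oplus>\<^bsub>?F\<^esub> lin n u' v' = lin n (u + u') (v + v')"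
    if "u \<in> B" "v \<in> B" "u' \<in> B" "v' \<in> B" for u v u' v'
    using that by (simp add: lin_def' E.pi_add K.F.smult_l_distr K.F.M.a_ac)
  have lin_smult: "\<pi> n e \<odot>\<^bsub>?F\<^esub> lin n u v = lin n (e * u) (e * v)" if "e \<in> B" "u \<in> B" "v \<in> B" for e u v
    using that by (simp add: lin_def' E.pi_mult K.F.smult_r_distr K.F.smult_assoc1)
  \<comment> \<open>\<open>T c u v\<close> expresses \<open>dc = u dx + v dy\<close> modulo
    \<open>N\<close>; sums and products of such statements follow from the relations.\<close>
  define T where "T c u v \<longleftrightarrow> c \<in> B \<and> u \<in> B \<and> v \<in> B \<and> gen c \<ominus>\<^bsub>?F\<^esub> lin n u v \<in> N" for c u v
  have zeroN: "\<zero>\<^bsub>?F\<^esub> \<in> N" using subgroup.one_closed[OF submodule.axioms(1)[OF N]] by simp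
  have refl: "u \<ominus>\<^bsub>?F\<^esub> u \<in> N" if "u \<in> carrier ?F" for u
    using zeroN that by (simp add: a_minus_def K.F.M.r_neg)
  have T_add: "T (c + d) (u + u') (v + v')" if "T c u v" "T d u' v'" for c d u u' v v'
  proof -
    have B: "c \<in> B" "d \<in> B" "u \<in> B" "v \<in> B" "u' \<in> B" "v' \<in> B" using that by (simp_all add: T_def)
    have step: "gen (c + d) \<ominus>\<^bsub>?F\<^esub> (gen c \<oplus>\<^bsub>?F\<^esub> gen d) \<in> N"
    proof -
      have "gen (c + d) = free_gen (An n) (\<pi> n c \<oplus>\<^bsub>An n\<^esub> \<pi> n d)" using B by (simp add: gen_def E.pi_add)
      then have "gen (c + d) \<ominus>\<^bsub>?F\<^esub> (gen c \<oplus>\<^bsub>?F\<^esub> gen d) \<in> kahler_rels (Rn n) (An n) (gn n)"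
        unfolding kahler_rels_def gen_def using pi[OF B(1)] pi[OF B(2)] by auto
      then show ?thesis using rels by blast
    qed
    have "gen (c + d) \<ominus>\<^bsub>?F\<^esub> (lin n u v \<oplus>\<^bsub>?F\<^esub> lin n u' v') \<in> N"
    proof (rule K.F.submodule_cong_trans[OF N _ _ _ step K.F.submodule_cong_add[OF N]])
      show "gen c \<ominus>\<^bsub>?F\<^esub> lin n u v \<in> N" "gen d \<ominus>\<^bsub>?F\<^esub> lin n u' v' \<in> N"
        using that by (simp_all add: T_def)
    qed (use B in simp_all)
    then show ?thesis using B by (simp add: T_def lin_add)
  qed
  have T_mult: "T (c * d) (c * u' + d * u) (c * v' + d * v)" if "T c u v" "T d u' v'" for c d u u' v v'
  proof -
    have B: "c \<in> B" "d \<in> B" "u \<in> B" "v \<in> B" "u' \<in> B" "v' \<in> B" using that by (simp_all add: T_def)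
    have step: "gen (c * d) \<ominus>\<^bsub>?F\<^esub> (\<pi> n c \<odot>\<^bsub>?F\<^esub> gen d \<oplus>\<^bsub>?F\<^esub> \<pi> n d \<odot>\<^bsub>?F\<^esub> gen c) \<in> N"
    proof -
      have "gen (c * d) = free_gen (An n) (\<pi> n c \<otimes>\<^bsub>An n\<^esub> \<pi> n d)" using B by (simp add: gen_def E.pi_mult)
      then have "gen (c * d) \<ominus>\<^bsub>?F\<^esub> (\<pi> n c \<odot>\<^bsub>?F\<^esub> gen d \<oplus>\<^bsub>?F\<^esub> \<pi> n d \<odot>\<^bsub>?F\<^esub> gen c) \<in>
          kahler_rels (Rn n) (An n) (gn n)"
        unfolding kahler_rels_def gen_def using pi[OF B(1)] pi[OF B(2)] by auto
      then show ?thesis using rels by blast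
    qed
    have "gen (c * d) \<ominus>\<^bsub>?F\<^esub>
        (\<pi> n c \<odot>\<^bsub>?F\<^esub> lin n u' v' \<oplus>\<^bsub>?F\<^esub> \<pi> n d \<odot>\<^bsub>?F\<^esub> lin n u v) \<in> N"
    proof (rule K.F.submodule_cong_trans[OF N _ _ _ step K.F.submodule_cong_add[OF N _ _ _ _
            K.F.submodule_cong_smult[OF N] K.F.submodule_cong_smult[OF N]]])
      show "gen c \<ominus>\<^bsub>?F\<^esub> lin n u v \<in> N" "gen d \<ominus>\<^bsub>?F\<^esub> lin n u' v' \<in> N"
        using that by (simp_all add: T_def)
    qed (use B in simp_all)
    then show ?thesis using B by (simp add: T_def lin_add lin_smult)
  qed
  have lin_00: "lin n 0 0 = \<zero>\<^bsub>?F\<^esub>"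
    by (simp add: lin_def' E.pi_zero)
  have T_cc: "T (cc l) 0 0" if l: "l \<in> L" for l
  proof -
    obtain t where "t \<in> carrier (Rn n)" "\<pi> n (cc l) = gn n t" using gn_image[of n] l by blast
    then have "gen (cc l) \<in> kahler_rels (Rn n) (An n) (gn n)" unfolding kahler_rels_def gen_def by auto
    then have "gen (cc l) \<in> N" using rels by blast
    moreover have "gen (cc l) \<ominus>\<^bsub>?F\<^esub> \<zero>\<^bsub>?F\<^esub> = gen (cc l)"
      using gen[of "cc l"] l K.F.M.minus_equality[of "\<zero>\<^bsub>?F\<^esub>" "\<zero>\<^bsub>?F\<^esub>"] by (simp add: a_minus_def)
    ultimately show ?thesis using l by (simp add: T_def lin_00)
  qed
  have T_cx: "T cx 1 0"
  proof -
    have "lin n 1 0 = gen cx" by (simp add: lin_def' E.pi_zero E.pi_one)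
    then show ?thesis using refl[of "gen cx"] by (simp add: T_def)
  qed
  have T_cy: "T cy 0 1"
  proof -
    have "lin n 0 1 = gen cy" by (simp add: lin_def' E.pi_zero E.pi_one)
    then show ?thesis using refl[of "gen cy"] by (simp add: T_def)
  qed
  have T_poly: "T (WCurve P 0) (WCurve (pderiv P) 0) 0" if "P \<in> LX" for P
    using that
  proof (induction P)
    case 0
    have "cc 0 = WCurve 0 0" "(0 :: wcurve) = WCurve 0 0" by (simp_all add: cc_def zero_wcurve_def)
    then show ?case using T_cc[of 0] by simp
  next
    case (pCons l P)
    then have "l \<in> L" "T (WCurve P 0) (WCurve (pderiv P) 0) 0" by simp_all
    then have "T (cc l + cx * WCurve P 0) (0 + (cx * WCurve (pderiv P) 0 + WCurve P 0 * 1)) (0 + (cx * 0 + WCurve P 0 * 0))"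
      by (intro T_add T_mult T_cc T_cx)
    moreover have "cc l + cx * WCurve P 0 = WCurve (pCons l P) 0" by (rule wcurve_eqI) simp_all
    moreover have "0 + (cx * WCurve (pderiv P) 0 + WCurve P 0 * 1) = WCurve (pderiv (pCons l P)) 0"
      by (rule wcurve_eqI) (simp_all add: pderiv_pCons)
    ultimately show ?case by simp
  qed
  \<comment> \<open>The differential of \<open>y ^ 2 = F\<close> is computed by the product rule
    and, below, by \<open>T_poly\<close>; comparing the two gives
    \<open>2 y dy = F' dx\<close>.\<close>
  have "T (cy * cy) (cy * 0 + cy * 0) (cy * 1 + cy * 1)" by (intro T_mult T_cy)
  moreover have "cy * cy = WCurve F 0" "cy * 1 + cy * 1 = WCurve 0 2"
    using wcurve_of_nat[of 2] by (rule_tac wcurve_eqI; simp add: wF_eq)+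
  ultimately have "T (WCurve F 0) 0 (WCurve 0 2)" by simp
  then have TF: "gen (WCurve F 0) \<ominus>\<^bsub>?F\<^esub> lin n 0 (WCurve 0 2) \<in> N" by (simp add: T_def)
  have BF: "WCurve F 0 \<in> B" "WCurve 0 2 \<in> B" "WCurve (pderiv F) 0 \<in> B" by (simp_all add: B_iff)
  have "lin n 0 (WCurve 0 2) \<ominus>\<^bsub>?F\<^esub> gen (WCurve F 0) \<in> N"
    by (rule K.F.submodule_cong_sym[OF N _ _ TF]) (use BF in simp_all)
  moreover have "gen (WCurve F 0) \<ominus>\<^bsub>?F\<^esub> lin n (WCurve (pderiv F) 0) 0 \<in> N"
    using T_poly[OF F_mem] by (simp add: T_def)
  ultimately have rel: "lin n 0 (WCurve 0 2) \<ominus>\<^bsub>?F\<^esub> lin n (WCurve (pderiv F) 0) 0 \<in> N"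
    by (rule K.F.submodule_cong_trans[OF N, rotated 3]) (use BF in simp_all)
  define P Q where "P = xpart c" "Q = ypart c"
  have PQ: "P \<in> LX" "Q \<in> LX" using c by (simp_all add: P_Q_def B_iff)
  have "T (WCurve P 0 + WCurve Q 0 * cy) (WCurve (pderiv P) 0 + (WCurve Q 0 * 0 + cy * WCurve (pderiv Q) 0))
      (0 + (WCurve Q 0 * 1 + cy * 0))"
    using PQ by (intro T_add T_mult T_poly T_cy)
  moreover have "WCurve P 0 + WCurve Q 0 * cy = c" by (rule wcurve_eqI) (simp_all add: P_Q_def)
  moreover have "WCurve (pderiv P) 0 + (WCurve Q 0 * 0 + cy * WCurve (pderiv Q) 0) = WCurve (pderiv P) (pderiv Q)"
    by (rule wcurve_eqI) simp_all
  ultimately have T_c: "T c (WCurve (pderiv P) (pderiv Q)) (WCurve Q 0)" by simp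
  \<comment> \<open>The multiple of the relation \<open>2 y dy - F' dx\<close> to be added. It is
    found by dividing \<open>P' + Q' y - Dv c * wx\<close> by \<open>pderiv F\<close>, which is
    possible since \<open>1 - r * F = s * pderiv F\<close>.\<close>
  define e where "e = WCurve (s * pderiv P) (s * pderiv Q - half * r * Q)"
  have e: "e \<in> B" using PQ by (simp add: e_def B_iff)
  have r_F: "r * F = 1 - s * pderiv F" using s_dF by simp
  have u: "WCurve (pderiv P) (pderiv Q) = Dv c * wx + e * WCurve (pderiv F) 0"
  proof (rule wcurve_eqI)
    have "xpart (Dv c * wx + e * WCurve (pderiv F) 0) = (r * F) * pderiv P + s * pderiv F * pderiv P"
      by (simp add: wx_def e_def wF_eq P_Q_def algebra_simps)
    then show "xpart (WCurve (pderiv P) (pderiv Q)) = xpart (Dv c * wx + e * WCurve (pderiv F) 0)"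
      unfolding r_F by (simp add: algebra_simps)
    have "ypart (Dv c * wx + e * WCurve (pderiv F) 0) = (r * F) * pderiv Q + s * pderiv F * pderiv Q"
      by (simp add: wx_def e_def wF_eq P_Q_def algebra_simps)
    then show "ypart (WCurve (pderiv P) (pderiv Q)) = ypart (Dv c * wx + e * WCurve (pderiv F) 0)"
      unfolding r_F by (simp add: algebra_simps)
  qed
  have v: "WCurve Q 0 + e * WCurve 0 2 = Dv c * wy"
  proof (rule wcurve_eqI)
    have "xpart (WCurve Q 0 + e * WCurve 0 2) = Q + 2 * s * F * pderiv Q - (2 * half) * (r * F) * Q"
      by (simp add: e_def wF_eq algebra_simps)
    also have "\<dots> = 2 * s * F * pderiv Q + s * pderiv F * Q" unfolding half r_F by (simp add: algebra_simps)
    also have "\<dots> = 2 * s * F * pderiv Q + (2 * half) * s * pderiv F * Q" unfolding half by simp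
    also have "\<dots> = xpart (Dv c * wy)" by (simp add: wy_def wF_eq P_Q_def algebra_simps)
    finally show "xpart (WCurve Q 0 + e * WCurve 0 2) = xpart (Dv c * wy)" .
    show "ypart (WCurve Q 0 + e * WCurve 0 2) = ypart (Dv c * wy)"
      by (simp add: e_def wy_def wF_eq P_Q_def algebra_simps)
  qed
  have Bs: "WCurve (pderiv P) (pderiv Q) \<in> B" "WCurve Q 0 \<in> B" "WCurve 0 2 \<in> B" "WCurve (pderiv F) 0 \<in> B"
    using PQ by (simp_all add: B_iff)
  have "\<pi> n e \<odot>\<^bsub>?F\<^esub> lin n 0 (WCurve 0 2) \<ominus>\<^bsub>?F\<^esub> \<pi> n e \<odot>\<^bsub>?F\<^esub> lin n (WCurve (pderiv F) 0) 0 \<in> N"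
    by (rule K.F.submodule_cong_smult[OF N _ _ _ rel]) (use e Bs in simp_all)
  then have 1: "lin n 0 (e * WCurve 0 2) \<ominus>\<^bsub>?F\<^esub> lin n (e * WCurve (pderiv F) 0) 0 \<in> N"
    using e Bs by (simp add: lin_smult)
  have 2: "lin n (e * WCurve (pderiv F) 0) 0 \<ominus>\<^bsub>?F\<^esub> lin n 0 (e * WCurve 0 2) \<in> N"
    by (rule K.F.submodule_cong_sym[OF N _ _ 1]) (use e Bs in simp_all)
  have "lin n (Dv c * wx) (WCurve Q 0) \<oplus>\<^bsub>?F\<^esub> lin n (e * WCurve (pderiv F) 0) 0 \<ominus>\<^bsub>?F\<^esub>
      (lin n (Dv c * wx) (WCurve Q 0) \<oplus>\<^bsub>?F\<^esub> lin n 0 (e * WCurve 0 2)) \<in> N"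
    by (rule K.F.submodule_cong_add[OF N _ _ _ _ refl 2]) (use e Bs c in simp_all)
  then have 3: "lin n (WCurve (pderiv P) (pderiv Q)) (WCurve Q 0) \<ominus>\<^bsub>?F\<^esub> lin n (Dv c * wx) (Dv c * wy) \<in> N"
    using e Bs c by (simp add: lin_add u v)
  have 4: "gen c \<ominus>\<^bsub>?F\<^esub> lin n (WCurve (pderiv P) (pderiv Q)) (WCurve Q 0) \<in> N"
    using T_c by (simp add: T_def)
  have "gen c \<ominus>\<^bsub>?F\<^esub> lin n (Dv c * wx) (Dv c * wy) \<in> N"
    by (rule K.F.submodule_cong_trans[OF N _ _ _ 4 3]) (use Bs c in simp_all)
  then show ?thesis using c by (simp add: gen_def lin_smult)
qed

lemma An_line: "kahler_line (An n) (Rn n) (gn n) (Dn n) (lin n wx wy)"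
proof -
  interpret K: kahler_deriv "An n" "Rn n" "gn n" "Dn n" by (rule An_deriv)
  have g: "free_gen (An n) (\<pi> n cx) \<in> carrier (free_mod (An n))" "free_gen (An n) (\<pi> n cy) \<in> carrier (free_mod (An n))"
    by (simp_all add: K.free_gen_closed E.pi_closed)
  have pi: "\<pi> n wx \<in> carrier (An n)" "\<pi> n wy \<in> carrier (An n)" by (simp_all add: E.pi_closed)
  show ?thesis
  proof (intro kahler_line.intro An_deriv kahler_line_axioms.intro)
    show "lin n wx wy \<in> carrier (free_mod (An n))" using g pi by (simp add: lin_def)
    have "K.Dt (lin n wx wy) = \<pi> n wx \<otimes>\<^bsub>An n\<^esub> \<pi> n (Dv cx) \<oplus>\<^bsub>An n\<^esub> \<pi> n wy \<otimes>\<^bsub>An n\<^esub> \<pi> n (Dv cy)"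
      using g pi by (simp add: lin_def K.Dt_add K.Dt_smult K.Dt_gen E.pi_closed Dn_pi)
    also have "\<dots> = \<pi> n (wx * Dv cx + wy * Dv cy)" by (simp add: E.pi_add E.pi_mult)
    finally show "K.Dt (lin n wx wy) = \<one>\<^bsub>An n\<^esub>" unfolding w_Dv E.pi_one .
    fix N X assume "submodule N (An n) (free_mod (An n))" "kahler_rels (Rn n) (An n) (gn n) \<subseteq> N"
      "X \<in> carrier (An n)"
    then show "free_gen (An n) X \<ominus>\<^bsub>free_mod (An n)\<^esub> Dn n X \<odot>\<^bsub>free_mod (An n)\<^esub> lin n wx wy \<in> N"
      using gen_cong by (auto elim!: level_exhaust simp: Dn_pi)
  qed
qed

subsection \<open>The module of differentials of the completed curve\<close>

abbreviation Kn where "Kn n \<equiv> kahler (Rn n) (An n) (gn n)"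

definition fibn where "fibn n c = kahler_line.fib (An n) (Dn n) (\<pi> n c)"

lemma fibn_carrier: "carrier (Kn n) = fibn n ` B"
proof -
  interpret K: kahler_line "An n" "Rn n" "gn n" "Dn n" "lin n wx wy" by (rule An_line)
  show ?thesis unfolding K.kahler_carrier E.pi_surj fibn_def by (simp add: image_image)
qed

lemma fibn_eq: "c \<in> B \<Longrightarrow> d \<in> B \<Longrightarrow> fibn n c = fibn n d \<longleftrightarrow> B.cg (p ^ n) c d"
proof -
  assume c: "c \<in> B" and d: "d \<in> B"
  interpret K: kahler_line "An n" "Rn n" "gn n" "Dn n" "lin n wx wy" by (rule An_line)
  have "fibn n c = fibn n d \<longleftrightarrow> \<pi> n c = \<pi> n d"
    unfolding fibn_def using K.fib_inj[OF E.pi_closed[OF c, of n], of "\<pi> n d"] by metis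
  then show ?thesis using E.pi_eq[OF c d] by simp
qed

lemma fibn_add: "c \<in> B \<Longrightarrow> d \<in> B \<Longrightarrow> fibn n c \<oplus>\<^bsub>Kn n\<^esub> fibn n d = fibn n (c + d)"
proof -
  assume c: "c \<in> B" and d: "d \<in> B"
  interpret K: kahler_line "An n" "Rn n" "gn n" "Dn n" "lin n wx wy" by (rule An_line)
  show ?thesis unfolding fibn_def
    using K.kahler_add[OF E.pi_closed[OF c, of n] E.pi_closed[OF d, of n]] E.pi_add[OF c d] by simp
qed

lemma fibn_smult: "c \<in> B \<Longrightarrow> d \<in> B \<Longrightarrow> \<pi> n c \<odot>\<^bsub>Kn n\<^esub> fibn n d = fibn n (c * d)"
proof -
  assume c: "c \<in> B" and d: "d \<in> B"
  interpret K: kahler_line "An n" "Rn n" "gn n" "Dn n" "lin n wx wy" by (rule An_line)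
  show ?thesis unfolding fibn_def
    using K.kahler_smult[OF E.pi_closed[OF c, of n] E.pi_closed[OF d, of n]] E.pi_mult[OF c d] by simp
qed

lemma fibn_zero: "\<zero>\<^bsub>Kn n\<^esub> = fibn n 0"
proof -
  interpret K: kahler_line "An n" "Rn n" "gn n" "Dn n" "lin n wx wy" by (rule An_line)
  show ?thesis unfolding fibn_def E.pi_zero by (rule K.kahler_zero)
qed

lemma fibn_d: "c \<in> B \<Longrightarrow> kahler_d (Rn n) (An n) (gn n) (\<pi> n c) = fibn n (Dv c)"
proof -
  assume c: "c \<in> B"
  interpret K: kahler_line "An n" "Rn n" "gn n" "Dn n" "lin n wx wy" by (rule An_line)
  show ?thesis unfolding fibn_def using K.kahler_d[OF E.pi_closed[OF c, of n]] Dn_pi[OF c] by simp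
qed

text \<open>Source and target levels are separate because the projections lower the level by one
  while the Frobenius lift preserves it. Homomorphy of \<open>\<Psi>\<close> is required only to the
  precision of the target.\<close>

lemma level_map:
  assumes h: "\<And>b. b \<in> B \<Longrightarrow> h (\<pi> k b) = \<pi> n (\<Psi> b)"
    and \<Psi>: "\<And>b. b \<in> B \<Longrightarrow> \<Psi> b \<in> B"
      "\<And>b c. b \<in> B \<Longrightarrow> c \<in> B \<Longrightarrow> B.cg (p ^ n) (\<Psi> (b + c)) (\<Psi> b + \<Psi> c)"
      "\<And>b c. b \<in> B \<Longrightarrow> c \<in> B \<Longrightarrow> B.cg (p ^ n) (\<Psi> (b * c)) (\<Psi> b * \<Psi> c)"
      "B.cg (p ^ n) (\<Psi> 1) 1"
    and \<mu>: "\<mu> \<in> B" "\<And>b. b \<in> B \<Longrightarrow> B.cg (p ^ n) (Dv (\<Psi> b)) (\<mu> * \<Psi> (Dv b))"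
    and c: "c \<in> B"
  shows "kahler_map (An k) (Rn n) (An n) (gn n) h (fibn k c) = fibn n (\<mu> * \<Psi> c)"
proof -
  have "kahler_line_map (An k) (Rn k) (gn k) (Dn k) (lin k wx wy) (An n) (Rn n) (gn n) (Dn n) (lin n wx wy)
      h (\<pi> n \<mu>)"
  proof (intro kahler_line_map.intro An_line ring_hom_cring.intro E.level_cring
      ring_hom_cring_axioms.intro ring_hom_memI kahler_line_map_axioms.intro)
    show "\<pi> n \<mu> \<in> carrier (An n)" by (rule E.pi_closed[OF \<mu>(1)])
    show "h \<one>\<^bsub>An k\<^esub> = \<one>\<^bsub>An n\<^esub>"
      unfolding E.pi_one[symmetric] h[OF B.one_mem] using \<Psi>(4) E.pi_eq[OF \<Psi>(1)[OF B.one_mem] B.one_mem] by blast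
    fix X assume "X \<in> carrier (An k)"
    then obtain b where b: "b \<in> B" "X = \<pi> k b" by (rule level_exhaust)
    show "h X \<in> carrier (An n)" unfolding b(2) h[OF b(1)] by (rule E.pi_closed[OF \<Psi>(1)[OF b(1)]])
    show "Dn n (h X) = \<pi> n \<mu> \<otimes>\<^bsub>An n\<^esub> h (Dn k X)"
      unfolding b(2) h[OF b(1)] Dn_pi[OF b(1)] Dn_pi[OF \<Psi>(1)[OF b(1)]] h[OF Dv_B[OF b(1)]]
        E.pi_mult[OF \<mu>(1) \<Psi>(1)[OF Dv_B[OF b(1)]], symmetric]
      using E.pi_eq[of "Dv (\<Psi> b)" "\<mu> * \<Psi> (Dv b)" n] \<mu> \<Psi>(1) b(1) by simp
    fix Y assume "Y \<in> carrier (An k)"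
    then obtain c where c: "c \<in> B" "Y = \<pi> k c" by (rule level_exhaust)
    note \<Psi>bc = \<Psi>(1)[OF b(1)] \<Psi>(1)[OF c(1)]
    show "h (X \<otimes>\<^bsub>An k\<^esub> Y) = h X \<otimes>\<^bsub>An n\<^esub> h Y"
      unfolding b(2) c(2) E.pi_mult[OF b(1) c(1), symmetric] h[OF b(1)] h[OF c(1)] h[OF B.mult_mem[OF b(1) c(1)]]
        E.pi_mult[OF \<Psi>bc, symmetric]
      using E.pi_eq[OF \<Psi>(1)[OF B.mult_mem[OF b(1) c(1)]] B.mult_mem[OF \<Psi>bc]] \<Psi>(3)[OF b(1) c(1)] by blast
    show "h (X \<oplus>\<^bsub>An k\<^esub> Y) = h X \<oplus>\<^bsub>An n\<^esub> h Y"
      unfolding b(2) c(2) E.pi_add[OF b(1) c(1), symmetric] h[OF b(1)] h[OF c(1)] h[OF B.add_mem[OF b(1) c(1)]]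
        E.pi_add[OF \<Psi>bc, symmetric]
      using E.pi_eq[OF \<Psi>(1)[OF B.add_mem[OF b(1) c(1)]] B.add_mem[OF \<Psi>bc]] \<Psi>(2)[OF b(1) c(1)] by blast
  qed
  from kahler_line_map.kahler_map_fib[OF this E.pi_closed[OF c]]
  show ?thesis unfolding fibn_def h[OF c] E.pi_mult[OF \<mu>(1) \<Psi>(1)[OF c]] .
qed

abbreviation Om where "Om \<equiv> Omega p H"

lemma kahler_mod_eq: "kahler_mod p S.C W.A (E_const p H) n = Kn n"
  by (simp add: kahler_mod_def)

lemma Om_eq: "Om = complete_kahler p S.C W.A (E_const p H)"
  by (simp add: Omega_def ER_eq S_ring_def)

lemma fibn_proj: "c \<in> B \<Longrightarrow> kahler_mod_proj p S.C W.A (E_const p H) n (fibn (Suc n) c) = fibn n c"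
  unfolding kahler_mod_proj_def
  using level_map[of "ppow_proj p W.A n" "Suc n" n "\<lambda>b. b" 1 c] E.pi_proj by simp

text \<open>The differential with coefficient sequence \<open>b\<close> relative to the generator
  \<open>r y dx + 2 s dy\<close>.\<close>

definition om :: "(nat \<Rightarrow> wcurve) \<Rightarrow> nat \<Rightarrow> (E_elt set \<Rightarrow> E_elt set) set" where
  "om b = (\<lambda>n. fibn n (b n))"

lemma om_closed: "E.coherent b \<Longrightarrow> om b \<in> carrier Om"
proof -
  assume b: "E.coherent b"
  have "fibn n (b n) \<in> carrier (Kn n)" for n
    unfolding fibn_carrier using E.coherentD(1)[OF b] by blast
  moreover have "kahler_mod_proj p S.C W.A (E_const p H) n (fibn (Suc n) (b (Suc n))) = fibn n (b n)" for n
    unfolding fibn_proj[OF E.coherentD(1)[OF b]]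
    using fibn_eq[OF E.coherentD(1)[OF b] E.coherentD(1)[OF b]] E.coherentD(2)[OF b] by blast
  ultimately show ?thesis unfolding Om_eq complete_kahler_def kahler_mod_eq om_def by simp
qed

lemma om_exhaust:
  assumes "w \<in> carrier Om" obtains b where "E.coherent b" "w = om b"
proof -
  have w: "w n \<in> fibn n ` B" "kahler_mod_proj p S.C W.A (E_const p H) n (w (Suc n)) = w n" for n
    using assms unfolding Om_eq complete_kahler_def kahler_mod_eq fibn_carrier by simp_all
  then have "\<forall>n. \<exists>b. b \<in> B \<and> w n = fibn n b" by blast
  then obtain b where b: "\<And>n. b n \<in> B" "\<And>n. w n = fibn n (b n)" by metis
  have "fibn n (b (Suc n)) = fibn n (b n)" for n
    using w(2)[of n] unfolding b(2) fibn_proj[OF b(1)] .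
  then have "B.cg (p ^ n) (b (Suc n)) (b n)" for n using fibn_eq[OF b(1) b(1)] by blast
  then have "E.coherent b" using b(1) unfolding E.coherent_def by blast
  moreover have "w = om b" unfolding om_def using b(2) by (intro ext)
  ultimately show ?thesis using that by blast
qed

lemma om_eq: "E.coherent b \<Longrightarrow> E.coherent c \<Longrightarrow> om b = om c \<longleftrightarrow> (\<forall>n. B.cg (p ^ n) (b n) (c n))"
  unfolding om_def fun_eq_iff using fibn_eq[OF E.coherentD(1) E.coherentD(1)] by blast

lemma om_add: "E.coherent b \<Longrightarrow> E.coherent c \<Longrightarrow> om b \<oplus>\<^bsub>Om\<^esub> om c = om (\<lambda>n. b n + c n)"
  unfolding om_def Om_eq complete_kahler_def kahler_mod_eq using fibn_add[OF E.coherentD(1) E.coherentD(1)] by simp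

lemma om_smult: "E.coherent b \<Longrightarrow> E.coherent c \<Longrightarrow> E.lim b \<odot>\<^bsub>Om\<^esub> om c = om (\<lambda>n. b n * c n)"
  unfolding om_def E.lim_def Om_eq complete_kahler_def kahler_mod_eq
  using fibn_smult[OF E.coherentD(1) E.coherentD(1)] by simp

lemma om_zero: "\<zero>\<^bsub>Om\<^esub> = om (\<lambda>_. 0)"
  unfolding om_def Om_eq complete_kahler_def kahler_mod_eq using fibn_zero by simp

lemma Om_group: "abelian_group Om"
proof (rule abelian_groupI)
  show "\<zero>\<^bsub>Om\<^esub> \<in> carrier Om" unfolding om_zero by (intro om_closed E.coherent_const) simp
  fix u assume "u \<in> carrier Om"
  then obtain b where b: "E.coherent b" "u = om b" by (rule om_exhaust)
  show "\<zero>\<^bsub>Om\<^esub> \<oplus>\<^bsub>Om\<^esub> u = u" unfolding om_zero b(2) using b(1) by (subst om_add) simp_all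
  have "om (\<lambda>n. - b n) \<oplus>\<^bsub>Om\<^esub> u = \<zero>\<^bsub>Om\<^esub>"
    unfolding om_zero b(2) om_add[OF E.coherent_ops(3)[OF b(1) b(1)] b(1)] by simp
  then show "\<exists>v\<in>carrier Om. v \<oplus>\<^bsub>Om\<^esub> u = \<zero>\<^bsub>Om\<^esub>" using om_closed[OF E.coherent_ops(3)[OF b(1) b(1)]] by blast
  fix v assume "v \<in> carrier Om"
  then obtain c where c: "E.coherent c" "v = om c" by (rule om_exhaust)
  show "u \<oplus>\<^bsub>Om\<^esub> v \<in> carrier Om"
    unfolding b(2) c(2) om_add[OF b(1) c(1)] by (intro om_closed E.coherent_ops(1) b c)
  show "u \<oplus>\<^bsub>Om\<^esub> v = v \<oplus>\<^bsub>Om\<^esub> u"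
    unfolding b(2) c(2) om_add[OF b(1) c(1)] om_add[OF c(1) b(1)] by (simp add: add.commute)
  fix w assume "w \<in> carrier Om"
  then obtain d where d: "E.coherent d" "w = om d" by (rule om_exhaust)
  show "u \<oplus>\<^bsub>Om\<^esub> v \<oplus>\<^bsub>Om\<^esub> w = u \<oplus>\<^bsub>Om\<^esub> (v \<oplus>\<^bsub>Om\<^esub> w)"
    unfolding b(2) c(2) d(2) om_add[OF b(1) c(1)] om_add[OF c(1) d(1)]
      om_add[OF E.coherent_ops(1)[OF b(1) c(1)] d(1)] om_add[OF b(1) E.coherent_ops(1)[OF c(1) d(1)]]
    by (simp add: add.assoc)
qed

lemma om_minus: "E.coherent b \<Longrightarrow> E.coherent c \<Longrightarrow> om b \<ominus>\<^bsub>Om\<^esub> om c = om (\<lambda>n. b n - c n)"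
proof -
  assume b: "E.coherent b" and c: "E.coherent c"
  interpret O: abelian_group Om by (rule Om_group)
  have c': "E.coherent (\<lambda>n. - c n)" by (rule E.coherent_ops(3)[OF c c])
  have "om (\<lambda>n. - c n) \<oplus>\<^bsub>Om\<^esub> om c = \<zero>\<^bsub>Om\<^esub>" unfolding om_add[OF c' c] om_zero by simp
  then have "\<ominus>\<^bsub>Om\<^esub> om c = om (\<lambda>n. - c n)"
    by (rule O.minus_equality[OF _ om_closed[OF c] om_closed[OF c']])
  then show ?thesis unfolding a_minus_def using om_add[OF b c'] by simp
qed

lemma om_add_pow: "E.coherent b \<Longrightarrow> [k] \<cdot>\<^bsub>Om\<^esub> om b = om (\<lambda>n. of_nat k * b n)" for k :: nat
proof (induction k)
  interpret O: abelian_group Om by (rule Om_group)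
  case 0
  then show ?case by (simp add: om_zero)
next
  interpret O: abelian_group Om by (rule Om_group)
  case (Suc k)
  have "[Suc k] \<cdot>\<^bsub>Om\<^esub> om b = om (\<lambda>n. of_nat k * b n) \<oplus>\<^bsub>Om\<^esub> om b"
    using Suc by simp
  then show ?case using om_add[OF E.coherent_of_nat[OF Suc.prems] Suc.prems] by (simp add: algebra_simps)
qed

lemma Ehat_eq: "Ehat p H = E.C"
  by (simp add: Ehat_def ER_eq)

lemma to_completion_iota: "c \<in> B \<Longrightarrow> to_completion p W.A (\<iota> c) = E.lim (\<lambda>_. c)"
  unfolding to_completion_def E.lim_def \<pi>_def by simp

lemma Ehat_y_eq: "Ehat_y p H = E.lim (\<lambda>_. cy)"
proof -
  have "\<iota> cy = E_class p H (var_y (S_ring p H))"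
    unfolding E_class_def S_ring_def W.yb_def[symmetric] by (simp add: \<iota>_def ux_0 ux_one)
  then show ?thesis unfolding Ehat_y_def ER_eq using to_completion_iota[of cy] by simp
qed

lemma Ehat_x_eq: "Ehat_x p H = E.lim (\<lambda>_. cx)"
proof -
  have "ux [:0, 1:] = up_ring.monom W.U \<one>\<^bsub>S.C\<^esub> 1"
    using ux_monom[of 1 1] by (simp add: monom_altdef S.lim_one)
  then have "\<iota> cx = E_class p H (var_x (S_ring p H))"
    by (simp add: \<iota>_def ux_0 W.cst_def var_x_def E_class_def S_ring_def)
  then show ?thesis unfolding Ehat_x_def ER_eq using to_completion_iota[of cx] by simp
qed

lemma Ehat_const_eq:
  assumes t: "S.coherent t"
  shows "E.coherent (\<lambda>n. cc (t n))" "Ehat_const p H (S.lim t) = E.lim (\<lambda>n. cc (t n))"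
proof -
  have "B.cg (p ^ n) (cc (t (Suc n))) (cc (t n))" for n
    using S.coherentD(2)[OF t, of n] by (auto simp: B_cg L.cg_poly_iff coeff_pCons split: nat.split)
  then show "E.coherent (\<lambda>n. cc (t n))" unfolding E.coherent_def using S.coherentD(1)[OF t] by simp
  show "Ehat_const p H (S.lim t) = E.lim (\<lambda>n. cc (t n))"
  proof
    fix n
    show "Ehat_const p H (S.lim t) n = E.lim (\<lambda>n. cc (t n)) n"
      unfolding Ehat_const_def ER_eq to_completion_def E.lim_def
      by (rule const_level[OF S.lim_closed[OF t] S.coherentD(1)[OF t]]) (simp add: S.lim_def)
  qed
qed

text \<open>Existence is \<open>Dv cx = cy\<close>. For uniqueness \<open>y\<close> must be
  cancelled modulo \<open>p ^ n\<close>: the congruence of \<open>cy * b n\<close> with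
  \<open>cy\<close> says that \<open>F * ypart (b n)\<close> vanishes and \<open>xpart (b n)\<close>
  is one, and the monic \<open>F\<close> can be cancelled.\<close>

lemma omega_eq: "omega p H = om (\<lambda>_. 1)"
  unfolding omega_def
proof (rule the_equality)
  have d: "complete_d p (S_ring p H) (E_ring p H) (E_const p H) (Ehat_x p H) = om (\<lambda>_. cy)"
    unfolding complete_d_def Ehat_x_eq ER_eq SR_eq E.lim_def fibn_d[OF gens_B(2)] om_def Dv_cx ..
  have y: "Ehat_y p H \<odot>\<^bsub>Om\<^esub> om b = om (\<lambda>n. cy * b n)" if "E.coherent b" for b
    unfolding Ehat_y_eq using that by (intro om_smult E.coherent_const) simp_all
  have c1: "E.coherent (\<lambda>_. 1)" by (intro E.coherent_const) simp
  show "om (\<lambda>_. 1) \<in> carrier Om \<and> Ehat_y p H \<odot>\<^bsub>Om\<^esub> om (\<lambda>_. 1) =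
      complete_d p (S_ring p H) (E_ring p H) (E_const p H) (Ehat_x p H)"
    unfolding d y[OF c1] using om_closed[OF c1] by simp
  fix w assume w: "w \<in> carrier Om \<and> Ehat_y p H \<odot>\<^bsub>Om\<^esub> w =
      complete_d p (S_ring p H) (E_ring p H) (E_const p H) (Ehat_x p H)"
  then obtain b where b: "E.coherent b" "w = om b" using om_exhaust by blast
  have coh: "E.coherent (\<lambda>n. cy * b n)" "E.coherent (\<lambda>_. cy)"
    using E.coherent_ops(2)[OF E.coherent_const b(1), of cy] E.coherent_const[of cy] by simp_all
  have cyb: "B.cg (p ^ n) (cy * b n) cy" for n
    using w unfolding d b(2) y[OF b(1)] om_eq[OF coh] by blast
  have "B.cg (p ^ n) (b n) 1" for n
  proof -
    have bn: "b n \<in> B" by (rule E.coherentD(1)[OF b(1)])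
    have 1: "L.LX.cg (p ^ n) (F * ypart (b n)) 0" "L.LX.cg (p ^ n) (xpart (b n)) 1"
      using cyb[of n] by (simp_all add: B_cg wF_eq)
    have "L.LX.cg (p ^ n) (ypart (b n)) 0"
    proof (rule L.monic_cancel[where G = F and T = 0])
      show "lead_coeff F = 1" using F_pow_monic[of 1] by simp
    qed (use 1 bn in \<open>simp_all add: B_iff\<close>)
    then show ?thesis using 1 by (simp add: B_cg)
  qed
  then show "w = om (\<lambda>_. 1)" unfolding b(2) om_eq[OF b(1) c1] by blast
qed

end

subsection \<open>The Frobenius lift\<close>

lemma WCurve_power: "WCurve P 0 ^ k = WCurve (P ^ k) 0"
  by (induction k) (simp_all add: one_wcurve_def times_wcurve_def)

context good_prime
begin

lemma cy_power: "cy ^ (2 * k + 1) = WCurve 0 (F ^ k)"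
proof (induction k)
  case 0
  then show ?case by (simp add: cy_def)
next
  case (Suc k)
  have "cy ^ (2 * Suc k + 1) = cy * cy * cy ^ (2 * k + 1)" by (simp add: mult.assoc)
  also have "\<dots> = WCurve 0 (F ^ Suc k)"
    unfolding Suc by (rule wcurve_eqI) (simp_all add: wF_eq)
  finally show ?case .
qed

text \<open>The \<open>p\<close>-th power is additive modulo \<open>p\<close>, and
  \<open>y ^ p = F ^ m y\<close> because \<open>p = 2 * m + 1\<close>.\<close>

lemma frobenius_on_B:
  assumes c: "c \<in> B"
  shows "B.cg p (c ^ p) (WCurve (xpart c ^ p) (ypart c ^ p * F ^ m))"
proof -
  have parts: "WCurve (xpart c) 0 \<in> B" "WCurve (ypart c) 0 \<in> B" using c by (simp_all add: B_iff)
  have "c = WCurve (xpart c) 0 + WCurve (ypart c) 0 * cy" by (rule wcurve_eqI) simp_all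
  then have "c ^ p = (WCurve (xpart c) 0 + WCurve (ypart c) 0 * cy) ^ p" by simp
  also have "B.cg p \<dots> (WCurve (xpart c) 0 ^ p + (WCurve (ypart c) 0 * cy) ^ p)"
    using parts by (intro B.cg_frobenius_add p_prime) simp_all
  also have "WCurve (xpart c) 0 ^ p + (WCurve (ypart c) 0 * cy) ^ p = WCurve (xpart c ^ p) (ypart c ^ p * F ^ m)"
  proof -
    have "cy ^ p = WCurve 0 (F ^ m)" using cy_power[of m] frobenius_curve.p_odd[OF frobenius_curve_axioms] by metis
    then show ?thesis unfolding power_mult_distrib WCurve_power by (intro wcurve_eqI) simp_all
  qed
  finally show ?thesis .
qed

theorem frobenius_lift_exists:
  "\<exists>\<Phi>. frobenius_lift p H \<Phi> \<and> lie_invariant_mod p H \<Phi> 1 (inv\<^bsub>S_ring p H\<^esub> (S_of p H H))"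
proof -
  obtain u v :: "nat \<Rightarrow> zpoly fract poly" where u: "\<And>n. u n \<in> LX" and v: "\<And>n. v n \<in> LX"
    and u_Suc: "\<And>n. L.LX.cg (p ^ n) (u (Suc n)) (u n)" and v_Suc: "\<And>n. L.LX.cg (p ^ n) (v (Suc n)) (v n)"
    and eqn: "\<And>n. L.LX.cg (p ^ (n + 2)) (ev F ([:0, 1:] ^ p + of_nat p * u n)) (F * (F ^ m + of_nat p * v n) ^ 2)"
    and eig: "\<And>n. L.LX.cg p (eigen (u n) (v n)) [:Hinv:]"
    by (rule frobenius_data) (rule that)
  define X where "X n = [:0, 1:] ^ p + of_nat p * u n" for n
  define V where "V n = F ^ m + of_nat p * v n" for n
  define \<kappa> where "\<kappa> n = eigen (u n) (v n)" for n
  have x_LX: "[:0, 1:] \<in> LX" by simp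
  have X: "X n \<in> LX" and V: "V n \<in> LX" and lam: "\<kappa> n \<in> LX" for n
    unfolding X_def V_def \<kappa>_def using u[of n] v[of n] by simp_all
  have X_Suc: "L.LX.cg (p ^ n) (X (Suc n)) (X n)" for n
    unfolding X_def by (intro L.LX.cg_add L.LX.cg_refl L.LX.cg_mult_left L.LX.of_nat_mem u_Suc)
  have V_Suc: "L.LX.cg (p ^ n) (V (Suc n)) (V n)" for n
    unfolding V_def by (intro L.LX.cg_add L.LX.cg_refl L.LX.cg_mult_left L.LX.of_nat_mem v_Suc)
  have lam_Suc: "L.LX.cg (p ^ n) (\<kappa> (Suc n)) (\<kappa> n)" for n
    unfolding \<kappa>_def by (intro eigen_cong u v u_Suc v_Suc)
  have FX: "L.LX.cg (p ^ n) (ev F (X n)) (F * V n ^ 2)" for n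
    unfolding X_def V_def by (rule L.LX.cg_le[OF eqn]) simp
  have lamV: "L.LX.cg (p ^ n) (of_nat p * \<kappa> n * V n) (pderiv (X n))" for n
  proof -
    have "L.LX.cg (p ^ n) (\<kappa> n * V n) (velX (u n))"
      unfolding \<kappa>_def V_def by (rule L.LX.cg_le[OF eigen(1)[OF u v eqn]]) simp
    then have "L.LX.cg (p ^ n) (of_nat p * (\<kappa> n * V n)) (of_nat p * velX (u n))"
      by (intro L.LX.cg_mult_left L.LX.of_nat_mem)
    then show ?thesis unfolding X_def pderiv_X by (simp only: mult.assoc)
  qed
  have lamF: "L.LX.cg (p ^ n) (of_nat p * \<kappa> n * ev (pderiv F) (X n)) (2 * pderiv (V n) * F + V n * pderiv F)" for n
  proof -
    have "L.LX.cg (p ^ n) (\<kappa> n * ev (pderiv F) (X n)) (velV (v n))"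
      unfolding \<kappa>_def X_def by (rule L.LX.cg_le[OF eigen(2)[OF u v eqn]]) simp
    then have "L.LX.cg (p ^ n) (of_nat p * (\<kappa> n * ev (pderiv F) (X n))) (of_nat p * velV (v n))"
      by (intro L.LX.cg_mult_left L.LX.of_nat_mem)
    then show ?thesis unfolding V_def pderiv_V by (simp only: mult.assoc)
  qed
  \<comment> \<open>The substitution \<open>x \<mapsto> X n\<close>,
    \<open>y \<mapsto> V n y\<close> with \<open>phi\<close> on coefficients. It respects
    \<open>y ^ 2 = F\<close> exactly as far as the equation for \<open>X n\<close> and
    \<open>V n\<close> holds, that is modulo \<open>p ^ n\<close>.\<close>
  define \<Psi> where "\<Psi> n c = WCurve (ev (xpart c) (X n)) (ev (ypart c) (X n) * V n)" for n c
  have \<Psi>_parts: "xpart (\<Psi> n c) = ev (xpart c) (X n)" "ypart (\<Psi> n c) = ev (ypart c) (X n) * V n" for n c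
    by (simp_all add: \<Psi>_def)
  have \<Psi>_B: "\<Psi> n c \<in> B" if "c \<in> B" for n c
    using that X V by (simp add: B_iff \<Psi>_parts)
  have \<Psi>_Suc: "B.cg (p ^ n) (\<Psi> (Suc n) c) (\<Psi> n c)" if "c \<in> B" for n c
    using that X V unfolding B_cg \<Psi>_parts B_iff
    by (intro conjI L.LX.cg_mult ev_cg_right X_Suc V_Suc) simp_all
  have \<Psi>_add: "\<Psi> n (b + c) = \<Psi> n b + \<Psi> n c" for n b c
    by (rule wcurve_eqI) (simp_all add: \<Psi>_parts ev_add algebra_simps)
  have \<Psi>_mult: "B.cg (p ^ n) (\<Psi> n (b * c)) (\<Psi> n b * \<Psi> n c)" if bc: "b \<in> B" "c \<in> B" for n b c
  proof -
    have mem: "ev (ypart b) (X n) \<in> LX" "ev (ypart c) (X n) \<in> LX" using bc X by (simp_all add: B_iff)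
    have "xpart (\<Psi> n (b * c)) = ev (xpart b) (X n) * ev (xpart c) (X n) +
        (ev (ypart b) (X n) * ev (ypart c) (X n)) * ev F (X n)"
      by (simp add: \<Psi>_parts wF_eq ev_add ev_mult algebra_simps)
    also have "L.LX.cg (p ^ n) \<dots> (ev (xpart b) (X n) * ev (xpart c) (X n) +
        (ev (ypart b) (X n) * ev (ypart c) (X n)) * (F * V n ^ 2))"
      by (intro L.LX.cg_add L.LX.cg_refl L.LX.cg_mult_left FX L.LX.mult_mem mem)
    also have "\<dots> = xpart (\<Psi> n b * \<Psi> n c)"
      by (simp add: \<Psi>_parts wF_eq power2_eq_square algebra_simps)
    finally have "L.LX.cg (p ^ n) (xpart (\<Psi> n (b * c))) (xpart (\<Psi> n b * \<Psi> n c))" .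
    moreover have "ypart (\<Psi> n (b * c)) = ypart (\<Psi> n b * \<Psi> n c)"
      by (simp add: \<Psi>_parts ev_add ev_mult algebra_simps)
    ultimately show ?thesis by (simp add: B_cg)
  qed
  have \<Psi>_1: "\<Psi> n 1 = 1" for n
    by (rule wcurve_eqI) (simp_all add: \<Psi>_parts)
  have \<Psi>_cg: "B.cg (p ^ n) (\<Psi> n b) (\<Psi> n c)" if "B.cg (p ^ n) b c" for n b c
    using that X V unfolding B_cg \<Psi>_parts
    by (intro conjI ev_cg_left L.LX.cg_mult_right) simp_all
  have family: "E.hom_family \<Psi>"
    unfolding E.hom_family_def using \<Psi>_B \<Psi>_Suc \<Psi>_mult \<Psi>_cg by (simp add: \<Psi>_add \<Psi>_1)
  define \<Phi> where "\<Phi> = E.lim_map \<Psi>"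
  have \<Phi>_lim: "\<Phi> (E.lim b) = E.lim (\<lambda>n. \<Psi> n (b n))" if "E.coherent b" for b
    unfolding \<Phi>_def by (rule E.lim_map_lim[OF family that])
  have \<Psi>_frob: "B.cg p (\<Psi> n c) (c ^ p)" if c: "c \<in> B" for n c
  proof -
    have "L.LX.cg p (X n) ([:0, 1:] ^ p)" unfolding X_def by (rule L.LX.cgI[OF u[of n]]) simp
    then have X': "L.LX.cg p (ev P (X n)) (ev P ([:0, 1:] ^ p))" if "P \<in> LX" for P
      by (intro ev_cg_right that X)
    have ev_p: "L.LX.cg p (ev P (X n)) (P ^ p)" if "P \<in> LX" for P
      by (rule L.LX.cg_trans[OF X'[OF that] ev_frob[OF that]])
    have "L.LX.cg p (V n) (F ^ m)" unfolding V_def by (rule L.LX.cgI[OF v[of n]]) simp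
    then have "B.cg p (\<Psi> n c) (WCurve (xpart c ^ p) (ypart c ^ p * F ^ m))"
      unfolding B_cg \<Psi>_parts wcurve.sel using c V unfolding B_iff
      by (intro conjI L.LX.cg_mult ev_p) simp_all
    then show ?thesis by (rule B.cg_trans[OF _ B.cg_sym[OF frobenius_on_B[OF c]]])
  qed
  have "frobenius_lift p H \<Phi>"
    unfolding frobenius_lift_def Ehat_eq
  proof (intro conjI ballI)
    show "\<Phi> \<in> ring_hom E.C E.C" unfolding \<Phi>_def by (rule E.lim_map_hom[OF family])
    fix t assume "t \<in> carrier (S_ring p H)"
    then obtain b where b: "S.coherent b" "t = S.lim b" unfolding SR_eq by (rule S.lim_exhaust)
    have b': "S.coherent (\<lambda>n. phi (b n))" by (rule S.coherent_map[OF phi_family b(1)])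
    have "\<Psi> n (cc l) = cc (phi l)" for n l
      by (rule wcurve_eqI) (simp_all add: \<Psi>_parts ev_pCons)
    then show "\<Phi> (Ehat_const p H t) = Ehat_const p H (univ_frob p H t)"
      unfolding b(2) univ_frob_lim[OF b(1)] Ehat_const_eq(2)[OF b(1)] Ehat_const_eq(2)[OF b']
        \<Phi>_lim[OF Ehat_const_eq(1)[OF b(1)]] by simp
  next
    fix f assume "f \<in> carrier E.C"
    then obtain b where b: "E.coherent b" "f = E.lim b" by (rule E.lim_exhaust)
    have c1: "E.coherent (\<lambda>n. \<Psi> n (b n))" by (rule E.coherent_map[OF family b(1)])
    have c2: "E.coherent (\<lambda>n. b n ^ p)" by (rule E.coherent_power[OF b(1)])
    \<comment> \<open>Divisibility by \<open>p\<close> in the completion is decided at level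
      \<open>1\<close> alone.\<close>
    have "B.cg p (\<Psi> 1 (b 1) - b 1 ^ p) (b 1 ^ p - b 1 ^ p)"
      by (intro B.cg_diff B.cg_refl \<Psi>_frob E.coherentD(1)[OF b(1)])
    then have "B.cg (p ^ 1) (\<Psi> 1 (b 1) - b 1 ^ p) 0" by simp
    then have "E.lim (\<lambda>n. \<Psi> n (b n) - b n ^ p) \<in> ppow_ideal p E.C 1"
      by (rule E.mem_ppow_ideal_completion[OF E.coherent_ops(4)[OF c1 c2]])
    then show "\<Phi> f \<ominus>\<^bsub>E.C\<^esub> f [^]\<^bsub>E.C\<^esub> p \<in> ppow_ideal p E.C 1"
      unfolding b(2) \<Phi>_lim[OF b(1)] E.lim_power[OF b(1)] E.lim_minus[OF c1 c2] .
  qed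
  moreover have "lie_invariant_mod p H \<Phi> 1 (inv\<^bsub>S_ring p H\<^esub> (S_of p H H))"
  proof -
    \<comment> \<open>\<open>om lc\<close> will be the form
      \<open>\<Phi>\<^sup>*\<omega> / p\<close>.\<close>
    define lc where "lc n = WCurve (\<kappa> n) 0" for n
    have lc_B: "lc n \<in> B" for n using lam by (simp add: lc_def B_iff)
    have lc: "E.coherent lc"
      unfolding E.coherent_def using lc_B lam_Suc by (simp add: B_cg lc_def)
    have c1: "E.coherent (\<lambda>_. 1)" by (intro E.coherent_const B.one_mem)
    \<comment> \<open>\<open>half\<close> occurs in the derivation, so commuting the derivation with
      \<open>\<Psi>\<close> needs that \<open>phi\<close> fixes \<open>1/2\<close>.\<close>
    have ev_half: "ev half Y = half" for Y
    proof -
      have "phi 2 * phi (inverse 2) = 1" unfolding phi_hom(2)[symmetric] by (simp add: phi_hom(3))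
      moreover have "phi 2 = 2" using phi_of_nat[of 2] by simp
      ultimately have "phi (inverse 2) = inverse 2" by (metis inverse_unique)
      then show ?thesis unfolding half_def ev_pCons by simp
    qed
    \<comment> \<open>The factor by which the lift multiplies the derivation, the
      \<open>\<mu>\<close> of \<open>level_map\<close>. The coefficient of \<open>y\<close> is
      \<open>lamV\<close>; the other one needs \<open>lamV\<close>, \<open>lamF\<close> and the
      equation \<open>FX\<close>.\<close>
    have D\<Psi>: "B.cg (p ^ n) (Dv (\<Psi> n c)) (of_nat p * lc n * \<Psi> n (Dv c))" if c: "c \<in> B" for n c
    proof -
      define P Q where "P = xpart c" "Q = ypart c"
      define eP eQ eQ' where "eP = ev (pderiv P) (X n)" "eQ = ev Q (X n)" "eQ' = ev (pderiv Q) (X n)"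
      have PQ: "P \<in> LX" "Q \<in> LX" using c by (simp_all add: P_Q_def B_iff)
      then have mem: "eP \<in> LX" "eQ \<in> LX" "eQ' \<in> LX" using X by (simp_all add: eP_eQ_eQ'_def)
      define \<mu> where "\<mu> = of_nat p * \<kappa> n"
      have \<mu>: "\<mu> \<in> LX" unfolding \<mu>_def using lam by simp
      have "ypart (Dv (\<Psi> n c)) = eP * pderiv (X n)"
        by (simp add: \<Psi>_parts pderiv_ev eP_eQ_eQ'_def P_Q_def)
      also have "L.LX.cg (p ^ n) \<dots> (eP * (\<mu> * V n))"
        unfolding \<mu>_def by (intro L.LX.cg_mult_left L.LX.cg_sym[OF lamV] mem)
      also have "\<dots> = ypart (of_nat p * lc n * \<Psi> n (Dv c))"
        by (simp add: \<Psi>_parts lc_def \<mu>_def eP_eQ_eQ'_def P_Q_def algebra_simps)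
      finally have y: "L.LX.cg (p ^ n) (ypart (Dv (\<Psi> n c))) (ypart (of_nat p * lc n * \<Psi> n (Dv c)))" .
      have "xpart (Dv (\<Psi> n c)) = (eQ' * V n * F) * pderiv (X n) +
          eQ * (pderiv (V n) * F + half * (V n * pderiv F))"
        by (simp add: \<Psi>_parts pderiv_mult pderiv_ev eP_eQ_eQ'_def P_Q_def algebra_simps)
      also have "\<dots> = (eQ' * V n * F) * pderiv (X n) +
          (half * eQ) * (2 * pderiv (V n) * F + V n * pderiv F)"
      proof -
        have "(half * eQ) * (2 * pderiv (V n) * F + V n * pderiv F) =
            eQ * ((2 * half) * (pderiv (V n) * F) + half * (V n * pderiv F))"
          by (simp add: algebra_simps)
        then show ?thesis unfolding half mult_1 by (simp only:)
      qed
      also have "L.LX.cg (p ^ n) \<dots> ((eQ' * V n * F) * (\<mu> * V n) + (half * eQ) * (\<mu> * ev (pderiv F) (X n)))"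
        unfolding \<mu>_def by (intro L.LX.cg_add L.LX.cg_mult_left L.LX.cg_sym[OF lamV] L.LX.cg_sym[OF lamF]
            L.LX.mult_mem mem V F_mem half_mem)
      also have "\<dots> = (\<mu> * eQ') * (F * V n ^ 2) + \<mu> * half * ev (pderiv F) (X n) * eQ"
        by (simp add: algebra_simps power2_eq_square)
      also have "L.LX.cg (p ^ n) \<dots> ((\<mu> * eQ') * ev F (X n) + \<mu> * half * ev (pderiv F) (X n) * eQ)"
        by (intro L.LX.cg_add L.LX.cg_refl L.LX.cg_mult_left L.LX.cg_sym[OF FX] L.LX.mult_mem mem \<mu>)
      also have "\<dots> = xpart (of_nat p * lc n * \<Psi> n (Dv c))"
        by (simp add: \<Psi>_parts lc_def \<mu>_def eP_eQ_eQ'_def P_Q_def ev_add ev_mult ev_half algebra_simps)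
      finally have "L.LX.cg (p ^ n) (xpart (Dv (\<Psi> n c))) (xpart (of_nat p * lc n * \<Psi> n (Dv c)))" .
      with y show ?thesis by (simp add: B_cg)
    qed
    have plc: "E.coherent (\<lambda>n. of_nat p * lc n)" by (rule E.coherent_of_nat[OF lc])
    have pull: "pullback p (S_ring p H) (E_ring p H) (E_const p H) \<Phi> (omega p H) = om (\<lambda>n. of_nat p * lc n)"
    proof
      fix n
      have "kahler_map (An n) (Rn n) (An n) (gn n) (completion_endo_mod p W.A \<Phi> n) (fibn n 1) =
          fibn n (of_nat p * lc n * \<Psi> n 1)"
      proof (rule level_map)
        show "completion_endo_mod p W.A \<Phi> n (\<pi> n b) = \<pi> n (\<Psi> n b)" if "b \<in> B" for b
          unfolding \<Phi>_def by (rule E.completion_endo_mod_lim_map[OF family that])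
      qed (use \<Psi>_B \<Psi>_mult D\<Psi> lc_B in \<open>simp_all add: \<Psi>_add \<Psi>_1\<close>)
      then show "pullback p (S_ring p H) (E_ring p H) (E_const p H) \<Phi> (omega p H) n = om (\<lambda>n. of_nat p * lc n) n"
        unfolding pullback_def omega_eq om_def ER_eq SR_eq \<Psi>_1 by simp
    qed
    have cH: "S.coherent (\<lambda>_. Hinv)" by (rule S.coherent_const[OF h_mem])
    have ccH: "E.coherent (\<lambda>_. cc Hinv)" by (rule E.coherent_const[OF gens_B(1)[OF h_mem]])
    have diff: "om lc \<ominus>\<^bsub>Om\<^esub> Ehat_const p H (S.lim (\<lambda>_. Hinv)) \<odot>\<^bsub>Om\<^esub> omega p H = om (\<lambda>n. lc n - cc Hinv)"
      unfolding omega_eq Ehat_const_eq(2)[OF cH] om_smult[OF ccH c1] mult_1_right om_minus[OF lc ccH] ..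
    have cd: "E.coherent (\<lambda>n. lc n - cc Hinv)" by (rule E.coherent_ops(4)[OF lc ccH])
    \<comment> \<open>The eigenvalue is known modulo \<open>p\<close> at every level, but level
      \<open>1\<close> is enough to divide the coherent difference by \<open>p\<close>.\<close>
    have "L.LX.cg p (\<kappa> 1 - [:Hinv:]) ([:Hinv:] - [:Hinv:])"
      unfolding \<kappa>_def by (intro L.LX.cg_diff L.LX.cg_refl eig)
    then have "B.cg (p ^ 1) (lc 1 - cc Hinv) 0" by (simp add: B_cg lc_def)
    then obtain c where c: "E.coherent c" "E.lim (\<lambda>n. lc n - cc Hinv) = [(p ^ 1)] \<cdot>\<^bsub>E.C\<^esub> E.lim c"
      using E.divide_by_ppow[OF cd] by blast
    have pc: "E.coherent (\<lambda>n. of_nat (p ^ 1) * c n)" by (rule E.coherent_of_nat[OF c(1)])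
    have "om (\<lambda>n. lc n - cc Hinv) = [(p ^ 1)] \<cdot>\<^bsub>Om\<^esub> om c"
      using c(2) unfolding E.lim_add_pow[OF c(1)] om_add_pow[OF c(1)] E.lim_eq[OF cd pc] om_eq[OF cd pc] .
    then show ?thesis
      unfolding lie_invariant_mod_def pull inv_S_of_H
      using om_closed[OF lc] om_closed[OF c(1)] om_add_pow[OF lc, of p] diff by metis
  qed
  ultimately show ?thesis by blast
qed

end

theorem theorem3p1:
  fixes p :: nat
  assumes "prime p" and "p \<noteq> 2" and "p \<noteq> 3"
  shows "\<exists>\<Phi>. frobenius_lift p (Hasse p) \<Phi> \<and>
             lie_invariant_mod p (Hasse p) \<Phi> 1 (inv\<^bsub>S_ring p (Hasse p)\<^esub> (S_of p (Hasse p) (Hasse p)))"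
  using good_prime.frobenius_lift_exists[OF good_prime.intro[OF assms]] .

end
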